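(* Let $(M,\varphi,\xi,\eta,h)$ be a compact quasi-Sasakian manifold and let $f\colon M\to M$ be a diffeomorphism that preserves the almost contact metric structure $(\varphi,\xi,\eta,h)$. For a real number $a>0$, consider the mapping torus $$M_{(f,a)}=(M\times\mathbb{R})/\mathbb{Z},\qquad k\cdot(x,t)=(f^k(x),t+ka).$$ Then the $\mathbb{Z}$-action preserves the quasi-Vaisman structure $(J,g,dt)$ on $M\times\mathbb{R}$ given by $g=h+dt\otimes dt$ and $J=\varphi-\frac{\partial}{\partial t}\otimes\eta+\xi\otimes dt$, and therefore the compact smooth manifold $M_{(f,a)}$ is quasi-Vaisman.
   Context: An almost contact metric structure on a manifold $M$ of odd dimension is a quadruple $(\varphi,\xi,\eta,h)$ of an endomorphism $\varphi$ of $TM$, a vector field $\xi$, a $1$-form $\eta$ and a Riemannian metric $h$ with $\varphi^2=-\mathrm{Id}+\eta\otimes\xi$, $\eta(\xi)=1$, $h(\varphi X,\varphi Y)=h(X,Y)-\eta(X)\eta(Y)$. Its fundamental $2$-form is $\Phi(X,Y)=h(X,\varphi Y)$. It is quasi-Sasakian if $N_\varphi+d\eta\otimes\xi=0$ and $d\Phi=0$, where $N_\varphi(X,Y)=\varphi^2[X,Y]-\varphi([\varphi X,Y]+[X,\varphi Y])+[\varphi X,\varphi Y]$ and $d\eta(X,Y)=X\eta(Y)-Y\eta(X)-\eta([X,Y])$. A quasi-Vaisman structure on a manifold is a triple $(J,g,\theta)$ where $(J,g)$ is a Hermitian structure ($J$ an integrable almost complex structure, $g$ a Riemannian metric with $g(JX,JY)=g(X,Y)$),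 $\theta$ is a closed $1$-form whose metric dual vector field $U$ is unitary, Killing and satisfies $\mathcal{L}_UJ=0$, and $d\Omega=d\eta'\wedge\theta$, where $\Omega(X,Y)=g(X,JY)$ and $\eta'=-\theta\circ J$. A manifold is quasi-Vaisman if it is endowed with such a structure. *)

theory Defs
  imports "HOL-Analysis.Analysis" "HOL-Library.Function_Algebras"
begin

section \<open>Smooth maps between Euclidean spaces\<close>

text \<open>
  Only used on open sets of finite-dimensional spaces, where
  \<open>Ck_on k f S\<close> says that \<open>f\<close> is of class \<open>C^k\<close> on \<open>S\<close>.
\<close>

primrec Ck_on :: "nat \<Rightarrow> ('e::real_normed_vector \<Rightarrow> 'f::real_normed_vector) \<Rightarrow> 'e set \<Rightarrow> bool" where
  "Ck_on 0 f S \<longleftrightarrow> continuous_on S f"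
| "Ck_on (Suc k) f S \<longleftrightarrow> (\<forall>x\<in>S. f differentiable (at x)) \<and>
     (\<forall>v. Ck_on k (\<lambda>x. frechet_derivative f (at x) v) S)"

definition smooth_on :: "'e::real_normed_vector set \<Rightarrow> ('e \<Rightarrow> 'f::real_normed_vector) \<Rightarrow> bool" where
  "smooth_on S f \<longleftrightarrow> (\<forall>k. Ck_on k f S)"

section \<open>Smooth manifolds\<close>

text \<open>
  A chart is a total function together with its domain; its values off the domain are irrelevant.
  A manifold is a topological space (whose points are its \<open>topspace\<close>) with an atlas, not
  required to be maximal, of charts into a Euclidean space \<open>'e\<close>; its dimension is \<open>DIM('e)\<close>.
\<close>

datatype ('a, 'e) chart = Chart (cdom: "'a set") (cmap: "'a \<Rightarrow> 'e")

datatype ('a, 'e) mfd = Mfd (mtop: "'a topology") (atlas: "('a, 'e) chart set")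

definition carr :: "('a, 'e) mfd \<Rightarrow> 'a set" where
  "carr M = topspace (mtop M)"

definition cinv :: "('a, 'e) chart \<Rightarrow> 'e \<Rightarrow> 'a" where
  "cinv c = inv_into (cdom c) (cmap c)"

definition charts_at :: "('a, 'e) mfd \<Rightarrow> 'a \<Rightarrow> ('a, 'e) chart set" where
  "charts_at M p = {c \<in> atlas M. p \<in> cdom c}"

definition is_chart :: "'a topology \<Rightarrow> ('a, 'e::euclidean_space) chart \<Rightarrow> bool" where
  "is_chart X c \<longleftrightarrow> openin X (cdom c) \<and> open (cmap c ` cdom c) \<and>
     homeomorphic_map (subtopology X (cdom c)) (top_of_set (cmap c ` cdom c)) (cmap c)"

definition smooth_manifold :: "('a, 'e::euclidean_space) mfd \<Rightarrow> bool" where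
  "smooth_manifold M \<longleftrightarrow>
     Hausdorff_space (mtop M) \<and> second_countable (mtop M) \<and>
     (\<forall>c\<in>atlas M. is_chart (mtop M) c) \<and>
     (\<Union>c\<in>atlas M. cdom c) = carr M \<and>
     (\<forall>c\<in>atlas M. \<forall>c'\<in>atlas M.
        smooth_on (cmap c ` (cdom c \<inter> cdom c')) (cmap c' \<circ> cinv c))"

definition smooth_map ::
  "('a, 'e::euclidean_space) mfd \<Rightarrow> ('b, 'f::euclidean_space) mfd \<Rightarrow> ('a \<Rightarrow> 'b) \<Rightarrow> bool" where
  "smooth_map M N F \<longleftrightarrow> continuous_map (mtop M) (mtop N) F \<and>
     (\<forall>c\<in>atlas M. \<forall>c'\<in>atlas N.
        smooth_on (cmap c ` {p \<in> cdom c. F p \<in> cdom c'}) (cmap c' \<circ> F \<circ> cinv c))"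

definition diffeomorphism ::
  "('a, 'e::euclidean_space) mfd \<Rightarrow> ('b, 'f::euclidean_space) mfd \<Rightarrow> ('a \<Rightarrow> 'b) \<Rightarrow> bool" where
  "diffeomorphism M N F \<longleftrightarrow> bij_betw F (carr M) (carr N) \<and>
     smooth_map M N F \<and> smooth_map N M (inv_into (carr M) F)"

definition real_mfd :: "(real, real) mfd" where
  "real_mfd = Mfd euclideanreal {Chart UNIV id}"

definition prod_mfd :: "('a, 'e) mfd \<Rightarrow> ('b, 'f) mfd \<Rightarrow> ('a \<times> 'b, 'e \<times> 'f) mfd" where
  "prod_mfd M N = Mfd (prod_topology (mtop M) (mtop N))
     {Chart (cdom c \<times> cdom d) (map_prod (cmap c) (cmap d)) | c d. c \<in> atlas M \<and> d \<in> atlas N}"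

text \<open>
  The quotient of a manifold along a map \<open>q\<close> onto its set of values, with the quotient topology
  and with the charts \<open>\<kappa> \<circ> (q|W)\<^sup>-\<^sup>1\<close>, where \<open>\<kappa>\<close> is a chart and \<open>W\<close> is an open part of its domain
  on which \<open>q\<close> is injective.
\<close>

definition quotient_top :: "'a topology \<Rightarrow> ('a \<Rightarrow> 'b) \<Rightarrow> 'b topology" where
  "quotient_top X q = topology (\<lambda>V. V \<subseteq> q ` topspace X \<and> openin X {x \<in> topspace X. q x \<in> V})"

definition quotient_mfd :: "('a, 'e) mfd \<Rightarrow> ('a \<Rightarrow> 'b) \<Rightarrow> ('b, 'e) mfd" where
  "quotient_mfd M q = Mfd (quotient_top (mtop M) q)
     {Chart (q ` W) (cmap c \<circ> inv_into W q) | c W.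
        c \<in> atlas M \<and> openin (mtop M) W \<and> W \<subseteq> cdom c \<and> inj_on q W}"

section \<open>Tangent vectors and differentials\<close>

text \<open>
  A tangent vector at \<open>p\<close> is given by its coordinates in each chart around \<open>p\<close>, subject to the
  transformation law under change of charts. The coordinates in all other charts are set to \<open>0\<close>, so
  that equality of tangent vectors is equality of functions; the vector space
  operations are the pointwise ones.
\<close>

type_synonym ('a, 'e) tangent = "('a, 'e) chart \<Rightarrow> 'e"
type_synonym ('a, 'e) vfield = "'a \<Rightarrow> ('a, 'e) tangent"
type_synonym ('a, 'e) endo = "'a \<Rightarrow> ('a, 'e) tangent \<Rightarrow> ('a, 'e) tangent"
type_synonym ('a, 'e) form1 = "'a \<Rightarrow> ('a, 'e) tangent \<Rightarrow> real"
type_synonym ('a, 'e) form2 = "'a \<Rightarrow> ('a, 'e) tangent \<Rightarrow> ('a, 'e) tangent \<Rightarrow> real"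

definition tscale :: "real \<Rightarrow> ('a, 'e::real_vector) tangent \<Rightarrow> ('a, 'e) tangent"
    (infixr "*\<^sub>T" 75) where
  "r *\<^sub>T v = (\<lambda>c. r *\<^sub>R v c)"

definition tangent_space :: "('a, 'e::euclidean_space) mfd \<Rightarrow> 'a \<Rightarrow> ('a, 'e) tangent set" where
  "tangent_space M p = {v.
     (\<forall>c\<in>charts_at M p. \<forall>c'\<in>charts_at M p.
        v c' = frechet_derivative (cmap c' \<circ> cinv c) (at (cmap c p)) (v c)) \<and>
     (\<forall>c. c \<notin> charts_at M p \<longrightarrow> v c = 0)}"

text \<open>Neither of the next two notions depends on the choice of the chart around \<open>p\<close>.\<close>

definition chart_at :: "('a, 'e) mfd \<Rightarrow> 'a \<Rightarrow> ('a, 'e) chart" where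
  "chart_at M p = (SOME c. c \<in> charts_at M p)"

definition dderiv ::
  "('a, 'e::euclidean_space) mfd \<Rightarrow> 'a \<Rightarrow> ('a, 'e) tangent \<Rightarrow> ('a \<Rightarrow> real) \<Rightarrow> real" where
  "dderiv M p v u = (let c = chart_at M p in
     frechet_derivative (u \<circ> cinv c) (at (cmap c p)) (v c))"

definition differential ::
  "('a, 'e::euclidean_space) mfd \<Rightarrow> ('b, 'f::euclidean_space) mfd \<Rightarrow> ('a \<Rightarrow> 'b) \<Rightarrow>
   'a \<Rightarrow> ('a, 'e) tangent \<Rightarrow> ('b, 'f) tangent" where
  "differential M N F p v = (\<lambda>c'. if c' \<in> charts_at N (F p)
     then (let c = chart_at M p in
       frechet_derivative (cmap c' \<circ> F \<circ> cinv c) (at (cmap c p)) (v c))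
     else 0)"

section \<open>Tensor fields\<close>

definition smooth_fun :: "('a, 'e::euclidean_space) mfd \<Rightarrow> 'a set \<Rightarrow> ('a \<Rightarrow> real) \<Rightarrow> bool" where
  "smooth_fun M W u \<longleftrightarrow> (\<forall>c\<in>atlas M. smooth_on (cmap c ` (cdom c \<inter> W)) (u \<circ> cinv c))"

definition vector_field :: "('a, 'e::euclidean_space) mfd \<Rightarrow> 'a set \<Rightarrow> ('a, 'e) vfield \<Rightarrow> bool" where
  "vector_field M W X \<longleftrightarrow> openin (mtop M) W \<and> (\<forall>p\<in>W. X p \<in> tangent_space M p) \<and>
     (\<forall>c\<in>atlas M. smooth_on (cmap c ` (cdom c \<inter> W)) (\<lambda>y. X (cinv c y) c))"

definition linear_form_on :: "('a, 'e::real_vector) tangent set \<Rightarrow> (('a, 'e) tangent \<Rightarrow> real) \<Rightarrow> bool" where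
  "linear_form_on T l \<longleftrightarrow>
     (\<forall>v\<in>T. \<forall>w\<in>T. l (v + w) = l v + l w) \<and> (\<forall>r. \<forall>v\<in>T. l (r *\<^sub>T v) = r * l v)"

definition endomorphism_field :: "('a, 'e::euclidean_space) mfd \<Rightarrow> ('a, 'e) endo \<Rightarrow> bool" where
  "endomorphism_field M A \<longleftrightarrow>
     (\<forall>p\<in>carr M. \<forall>v\<in>tangent_space M p. A p v \<in> tangent_space M p \<and>
        (\<forall>w\<in>tangent_space M p. A p (v + w) = A p v + A p w) \<and>
        (\<forall>r. A p (r *\<^sub>T v) = r *\<^sub>T A p v)) \<and>
     (\<forall>W X. vector_field M W X \<longrightarrow> vector_field M W (\<lambda>p. A p (X p)))"

definition one_form :: "('a, 'e::euclidean_space) mfd \<Rightarrow> ('a, 'e) form1 \<Rightarrow> bool" where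
  "one_form M \<theta> \<longleftrightarrow>
     (\<forall>p\<in>carr M. linear_form_on (tangent_space M p) (\<theta> p)) \<and>
     (\<forall>W X. vector_field M W X \<longrightarrow> smooth_fun M W (\<lambda>p. \<theta> p (X p)))"

definition riemannian_metric :: "('a, 'e::euclidean_space) mfd \<Rightarrow> ('a, 'e) form2 \<Rightarrow> bool" where
  "riemannian_metric M g \<longleftrightarrow>
     (\<forall>p\<in>carr M. \<forall>v\<in>tangent_space M p.
        linear_form_on (tangent_space M p) (g p v) \<and>
        (\<forall>w\<in>tangent_space M p. g p v w = g p w v) \<and>
        (v \<noteq> 0 \<longrightarrow> g p v v > 0)) \<and>
     (\<forall>W X Y. vector_field M W X \<and> vector_field M W Y \<longrightarrow>
        smooth_fun M W (\<lambda>p. g p (X p) (Y p)))"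

text \<open>
  In a chart, \<open>[X, Y]\<^sup>i = X\<^sup>j \<partial>\<^sub>j Y\<^sup>i - Y\<^sup>j \<partial>\<^sub>j X\<^sup>i\<close>, that is \<open>[X, Y] u = X (Y u) - Y (X u)\<close>.
\<close>

definition lie_bracket ::
  "('a, 'e::euclidean_space) mfd \<Rightarrow> ('a, 'e) vfield \<Rightarrow> ('a, 'e) vfield \<Rightarrow> ('a, 'e) vfield" where
  "lie_bracket M X Y p = (\<lambda>c. if c \<in> charts_at M p
     then frechet_derivative (\<lambda>y. Y (cinv c y) c) (at (cmap c p)) (X p c)
        - frechet_derivative (\<lambda>y. X (cinv c y) c) (at (cmap c p)) (Y p c)
     else 0)"

text \<open>
  Below, identities between tensor fields defined through brackets are required at \<open>p \<in> W\<close> for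
  all smooth vector fields on an arbitrary open set \<open>W\<close>.
\<close>

text \<open>The bracket formula for \<open>N_A\<close>, with \<open>A\<^sup>2 [X, Y]\<close> as its first term.\<close>

definition nijenhuis ::
  "('a, 'e::euclidean_space) mfd \<Rightarrow> ('a, 'e) endo \<Rightarrow>
   ('a, 'e) vfield \<Rightarrow> ('a, 'e) vfield \<Rightarrow> ('a, 'e) vfield" where
  "nijenhuis M A X Y p =
     A p (A p (lie_bracket M X Y p))
     - A p (lie_bracket M (\<lambda>x. A x (X x)) Y p + lie_bracket M X (\<lambda>x. A x (Y x)) p)
     + lie_bracket M (\<lambda>x. A x (X x)) (\<lambda>x. A x (Y x)) p"

text \<open>Exterior derivatives are normalised without factors \<open>1/2\<close>, \<open>1/3\<close>.\<close>

definition ext_deriv1 ::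
  "('a, 'e::euclidean_space) mfd \<Rightarrow> ('a, 'e) form1 \<Rightarrow>
   ('a, 'e) vfield \<Rightarrow> ('a, 'e) vfield \<Rightarrow> 'a \<Rightarrow> real" where
  "ext_deriv1 M \<theta> X Y p =
     dderiv M p (X p) (\<lambda>x. \<theta> x (Y x)) - dderiv M p (Y p) (\<lambda>x. \<theta> x (X x))
     - \<theta> p (lie_bracket M X Y p)"

definition ext_deriv2 ::
  "('a, 'e::euclidean_space) mfd \<Rightarrow> ('a, 'e) form2 \<Rightarrow>
   ('a, 'e) vfield \<Rightarrow> ('a, 'e) vfield \<Rightarrow> ('a, 'e) vfield \<Rightarrow> 'a \<Rightarrow> real" where
  "ext_deriv2 M \<omega> X Y Z p =
     dderiv M p (X p) (\<lambda>x. \<omega> x (Y x) (Z x))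
     - dderiv M p (Y p) (\<lambda>x. \<omega> x (X x) (Z x))
     + dderiv M p (Z p) (\<lambda>x. \<omega> x (X x) (Y x))
     - \<omega> p (lie_bracket M X Y p) (Z p)
     + \<omega> p (lie_bracket M X Z p) (Y p)
     - \<omega> p (lie_bracket M Y Z p) (X p)"

definition fundamental_form :: "('a, 'e) form2 \<Rightarrow> ('a, 'e) endo \<Rightarrow> ('a, 'e) form2" where
  "fundamental_form g A p v w = g p v (A p w)"

section \<open>Quasi-Sasakian structures\<close>

definition almost_contact_metric ::
  "('a, 'e::euclidean_space) mfd \<Rightarrow> ('a, 'e) endo \<Rightarrow> ('a, 'e) vfield \<Rightarrow> ('a, 'e) form1 \<Rightarrow>
   ('a, 'e) form2 \<Rightarrow> bool" where
  "almost_contact_metric M \<phi> \<xi> \<eta> h \<longleftrightarrow>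
     odd DIM('e) \<and>
     endomorphism_field M \<phi> \<and> vector_field M (carr M) \<xi> \<and> one_form M \<eta> \<and> riemannian_metric M h \<and>
     (\<forall>p\<in>carr M. \<eta> p (\<xi> p) = 1 \<and>
        (\<forall>v\<in>tangent_space M p. \<phi> p (\<phi> p v) = - v + \<eta> p v *\<^sub>T \<xi> p) \<and>
        (\<forall>v\<in>tangent_space M p. \<forall>w\<in>tangent_space M p.
           h p (\<phi> p v) (\<phi> p w) = h p v w - \<eta> p v * \<eta> p w))"

definition quasi_sasakian ::
  "('a, 'e::euclidean_space) mfd \<Rightarrow> ('a, 'e) endo \<Rightarrow> ('a, 'e) vfield \<Rightarrow> ('a, 'e) form1 \<Rightarrow>
   ('a, 'e) form2 \<Rightarrow> bool" where
  "quasi_sasakian M \<phi> \<xi> \<eta> h \<longleftrightarrow>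
     almost_contact_metric M \<phi> \<xi> \<eta> h \<and>
     (\<forall>W X Y. vector_field M W X \<and> vector_field M W Y \<longrightarrow>
        (\<forall>p\<in>W. nijenhuis M \<phi> X Y p + ext_deriv1 M \<eta> X Y p *\<^sub>T \<xi> p = 0)) \<and>
     (\<forall>W X Y Z. vector_field M W X \<and> vector_field M W Y \<and> vector_field M W Z \<longrightarrow>
        (\<forall>p\<in>W. ext_deriv2 M (fundamental_form h \<phi>) X Y Z p = 0))"

section \<open>Quasi-Vaisman structures\<close>

text \<open>Integrability of \<open>J\<close> is the vanishing of its Nijenhuis tensor.\<close>

definition integrable_almost_complex ::
  "('a, 'e::euclidean_space) mfd \<Rightarrow> ('a, 'e) endo \<Rightarrow> bool" where
  "integrable_almost_complex M J \<longleftrightarrow>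
     endomorphism_field M J \<and>
     (\<forall>p\<in>carr M. \<forall>v\<in>tangent_space M p. J p (J p v) = - v) \<and>
     (\<forall>W X Y. vector_field M W X \<and> vector_field M W Y \<longrightarrow> (\<forall>p\<in>W. nijenhuis M J X Y p = 0))"

definition hermitian_structure ::
  "('a, 'e::euclidean_space) mfd \<Rightarrow> ('a, 'e) endo \<Rightarrow> ('a, 'e) form2 \<Rightarrow> bool" where
  "hermitian_structure M J g \<longleftrightarrow>
     integrable_almost_complex M J \<and> riemannian_metric M g \<and>
     (\<forall>p\<in>carr M. \<forall>v\<in>tangent_space M p. \<forall>w\<in>tangent_space M p.
        g p (J p v) (J p w) = g p v w)"

definition metric_dual ::
  "('a, 'e::euclidean_space) mfd \<Rightarrow> ('a, 'e) form2 \<Rightarrow> ('a, 'e) form1 \<Rightarrow> ('a, 'e) vfield \<Rightarrow> bool" where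
  "metric_dual M g \<theta> U \<longleftrightarrow> vector_field M (carr M) U \<and>
     (\<forall>p\<in>carr M. \<forall>v\<in>tangent_space M p. g p (U p) v = \<theta> p v)"

text \<open>\<open>L_U g = 0\<close> and \<open>L_U A = 0\<close>, where \<open>(L_U A) X = [U, A X] - A [U, X]\<close>.\<close>

definition killing_field ::
  "('a, 'e::euclidean_space) mfd \<Rightarrow> ('a, 'e) form2 \<Rightarrow> ('a, 'e) vfield \<Rightarrow> bool" where
  "killing_field M g U \<longleftrightarrow>
     (\<forall>W X Y. vector_field M W X \<and> vector_field M W Y \<longrightarrow>
        (\<forall>p\<in>W. dderiv M p (U p) (\<lambda>x. g x (X x) (Y x))
           - g p (lie_bracket M U X p) (Y p) - g p (X p) (lie_bracket M U Y p) = 0))"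

definition lie_deriv_endo_zero ::
  "('a, 'e::euclidean_space) mfd \<Rightarrow> ('a, 'e) endo \<Rightarrow> ('a, 'e) vfield \<Rightarrow> bool" where
  "lie_deriv_endo_zero M A U \<longleftrightarrow>
     (\<forall>W X. vector_field M W X \<longrightarrow>
        (\<forall>p\<in>W. lie_bracket M U (\<lambda>x. A x (X x)) p - A p (lie_bracket M U X p) = 0))"

text \<open>
  The last condition is \<open>d\<Omega> = d\<eta>' \<and> \<theta>\<close> with \<open>\<eta>' = - \<theta> \<circ> J\<close>, the wedge product of the 2-form
  \<open>d\<eta>'\<close> and the 1-form \<open>\<theta>\<close> being the cyclic sum.
\<close>

definition quasi_vaisman ::
  "('a, 'e::euclidean_space) mfd \<Rightarrow> ('a, 'e) endo \<Rightarrow> ('a, 'e) form2 \<Rightarrow> ('a, 'e) form1 \<Rightarrow> bool" where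
  "quasi_vaisman M J g \<theta> \<longleftrightarrow>
     hermitian_structure M J g \<and> one_form M \<theta> \<and>
     (\<forall>W X Y. vector_field M W X \<and> vector_field M W Y \<longrightarrow> (\<forall>p\<in>W. ext_deriv1 M \<theta> X Y p = 0)) \<and>
     (\<exists>U. metric_dual M g \<theta> U \<and> (\<forall>p\<in>carr M. g p (U p) (U p) = 1) \<and>
        killing_field M g U \<and> lie_deriv_endo_zero M J U) \<and>
     (let \<eta>' = (\<lambda>p v. - \<theta> p (J p v)) in
      \<forall>W X Y Z. vector_field M W X \<and> vector_field M W Y \<and> vector_field M W Z \<longrightarrow>
        (\<forall>p\<in>W. ext_deriv2 M (fundamental_form g J) X Y Z p =
           ext_deriv1 M \<eta>' X Y p * \<theta> p (Z p) + ext_deriv1 M \<eta>' Y Z p * \<theta> p (X p)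
           + ext_deriv1 M \<eta>' Z X p * \<theta> p (Y p)))"

definition quasi_vaisman_manifold :: "('a, 'e::euclidean_space) mfd \<Rightarrow> bool" where
  "quasi_vaisman_manifold M \<longleftrightarrow> smooth_manifold M \<and> (\<exists>J g \<theta>. quasi_vaisman M J g \<theta>)"

section \<open>Maps preserving structures\<close>

definition preserves_endo ::
  "('a, 'e::euclidean_space) mfd \<Rightarrow> ('a \<Rightarrow> 'a) \<Rightarrow> ('a, 'e) endo \<Rightarrow> bool" where
  "preserves_endo M F A \<longleftrightarrow> (\<forall>p\<in>carr M. \<forall>v\<in>tangent_space M p.
     differential M M F p (A p v) = A (F p) (differential M M F p v))"

definition preserves_vfield ::
  "('a, 'e::euclidean_space) mfd \<Rightarrow> ('a \<Rightarrow> 'a) \<Rightarrow> ('a, 'e) vfield \<Rightarrow> bool" where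
  "preserves_vfield M F X \<longleftrightarrow> (\<forall>p\<in>carr M. differential M M F p (X p) = X (F p))"

definition preserves_form1 ::
  "('a, 'e::euclidean_space) mfd \<Rightarrow> ('a \<Rightarrow> 'a) \<Rightarrow> ('a, 'e) form1 \<Rightarrow> bool" where
  "preserves_form1 M F \<theta> \<longleftrightarrow> (\<forall>p\<in>carr M. \<forall>v\<in>tangent_space M p.
     \<theta> (F p) (differential M M F p v) = \<theta> p v)"

definition preserves_metric ::
  "('a, 'e::euclidean_space) mfd \<Rightarrow> ('a \<Rightarrow> 'a) \<Rightarrow> ('a, 'e) form2 \<Rightarrow> bool" where
  "preserves_metric M F g \<longleftrightarrow> (\<forall>p\<in>carr M. \<forall>v\<in>tangent_space M p. \<forall>w\<in>tangent_space M p.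
     g (F p) (differential M M F p v) (differential M M F p w) = g p v w)"

definition preserves_almost_contact_metric ::
  "('a, 'e::euclidean_space) mfd \<Rightarrow> ('a \<Rightarrow> 'a) \<Rightarrow> ('a, 'e) endo \<Rightarrow> ('a, 'e) vfield \<Rightarrow>
   ('a, 'e) form1 \<Rightarrow> ('a, 'e) form2 \<Rightarrow> bool" where
  "preserves_almost_contact_metric M F \<phi> \<xi> \<eta> h \<longleftrightarrow>
     preserves_endo M F \<phi> \<and> preserves_vfield M F \<xi> \<and> preserves_form1 M F \<eta> \<and> preserves_metric M F h"

definition preserves_quasi_vaisman ::
  "('a, 'e::euclidean_space) mfd \<Rightarrow> ('a \<Rightarrow> 'a) \<Rightarrow> ('a, 'e) endo \<Rightarrow> ('a, 'e) form2 \<Rightarrow>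
   ('a, 'e) form1 \<Rightarrow> bool" where
  "preserves_quasi_vaisman M F J g \<theta> \<longleftrightarrow>
     preserves_endo M F J \<and> preserves_metric M F g \<and> preserves_form1 M F \<theta>"

section \<open>The structure on \<open>M \<times> \<real>\<close>\<close>

definition cyl :: "('a, 'e) mfd \<Rightarrow> ('a \<times> real, 'e \<times> real) mfd" where
  "cyl M = prod_mfd M real_mfd"

text \<open>The isomorphism \<open>T(M \<times> \<real>) = TM \<oplus> T\<real>\<close> is made explicit by the differentials of the
  projection to \<open>M\<close> and of the inclusions of the slices.\<close>

definition cyl_proj ::
  "('a, 'e::euclidean_space) mfd \<Rightarrow> 'a \<times> real \<Rightarrow> ('a \<times> real, 'e \<times> real) tangent \<Rightarrow> ('a, 'e) tangent" where
  "cyl_proj M p v = differential (cyl M) M fst p v"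

definition cyl_lift ::
  "('a, 'e::euclidean_space) mfd \<Rightarrow> 'a \<times> real \<Rightarrow> ('a, 'e) tangent \<Rightarrow> ('a \<times> real, 'e \<times> real) tangent" where
  "cyl_lift M p w = differential M (cyl M) (\<lambda>x. (x, snd p)) (fst p) w"

definition real_unit_vfield :: "(real, real) vfield" where
  "real_unit_vfield s = (\<lambda>c. if c \<in> charts_at real_mfd s then 1 else 0)"

definition cyl_dt_vfield :: "('a, 'e::euclidean_space) mfd \<Rightarrow> ('a \<times> real, 'e \<times> real) vfield" where
  "cyl_dt_vfield M p =
     differential real_mfd (cyl M) (\<lambda>s. (fst p, s)) (snd p) (real_unit_vfield (snd p))"

definition cyl_dt :: "('a, 'e::euclidean_space) mfd \<Rightarrow> ('a \<times> real, 'e \<times> real) form1" where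
  "cyl_dt M p v = dderiv (cyl M) p v snd"

definition cyl_metric ::
  "('a, 'e::euclidean_space) mfd \<Rightarrow> ('a, 'e) form2 \<Rightarrow> ('a \<times> real, 'e \<times> real) form2" where
  "cyl_metric M h p v w =
     h (fst p) (cyl_proj M p v) (cyl_proj M p w) + cyl_dt M p v * cyl_dt M p w"

definition cyl_J ::
  "('a, 'e::euclidean_space) mfd \<Rightarrow> ('a, 'e) endo \<Rightarrow> ('a, 'e) vfield \<Rightarrow> ('a, 'e) form1 \<Rightarrow>
   ('a \<times> real, 'e \<times> real) endo" where
  "cyl_J M \<phi> \<xi> \<eta> p v =
     cyl_lift M p (\<phi> (fst p) (cyl_proj M p v))
     - \<eta> (fst p) (cyl_proj M p v) *\<^sub>T cyl_dt_vfield M p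
     + cyl_dt M p v *\<^sub>T cyl_lift M p (\<xi> (fst p))"

section \<open>Mapping tori\<close>

definition int_iterate :: "'a set \<Rightarrow> ('a \<Rightarrow> 'a) \<Rightarrow> int \<Rightarrow> 'a \<Rightarrow> 'a" where
  "int_iterate S f k = (if k \<ge> 0 then f ^^ nat k else inv_into S f ^^ nat (- k))"

definition torus_action ::
  "('a, 'e) mfd \<Rightarrow> ('a \<Rightarrow> 'a) \<Rightarrow> real \<Rightarrow> int \<Rightarrow> 'a \<times> real \<Rightarrow> 'a \<times> real" where
  "torus_action M f a k = (\<lambda>(x, t). (int_iterate (carr M) f k x, t + of_int k * a))"

definition torus_orbit :: "('a, 'e) mfd \<Rightarrow> ('a \<Rightarrow> 'a) \<Rightarrow> real \<Rightarrow> 'a \<times> real \<Rightarrow> ('a \<times> real) set" where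
  "torus_orbit M f a p = range (\<lambda>k. torus_action M f a k p)"

definition mapping_torus ::
  "('a, 'e) mfd \<Rightarrow> ('a \<Rightarrow> 'a) \<Rightarrow> real \<Rightarrow> (('a \<times> real) set, 'e \<times> real) mfd" where
  "mapping_torus M f a = quotient_mfd (cyl M) (torus_orbit M f a)"

end

theory Submission
  imports Defs
begin

text \<open>
  All structures here are tensor fields, and both properties in question are identities between
  brackets and derivatives of tensor fields. In a chart every such identity becomes an identity
  between the components and their first derivatives at a point, because the derivatives of the vector fields
  inserted into it cancel. The proof therefore reduces the quasi-Sasakian condition to a
  statement \<open>quasi_sasakian_coords\<close> about functions on an open set \<open>S\<close> of the model space, and the
  quasi-Vaisman condition to a statement \<open>quasi_vaisman_coords\<close> of the same kind
  (\<open>quasi_sasakian_coordsI\<close>, \<open>quasi_vaismanI\<close>). For brackets to be tangent vectors at all,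
  second derivatives of changes of charts have to be symmetric (\<open>lie_bracket_mem\<close>).

  The geometric content is \<open>quasi_vaisman_coords_cylinder\<close>. On \<open>S \<times> \<real>\<close> nothing depends on \<open>t\<close>, hence
  \<open>\<partial>/\<partial>t\<close> is Killing and preserves \<open>J\<close>, and it is the unit vector field dual to the closed form \<open>dt\<close>.
  The fundamental form of \<open>(J, g)\<close> is \<open>\<Phi> + \<eta> \<and> dt\<close>, and \<open>\<eta> = - dt \<circ> J\<close>, so that \<open>d\<Phi> = 0\<close> gives
  \<open>d\<Omega> = d\<eta> \<and> dt\<close>. The components of the Nijenhuis tensor of \<open>J\<close> are \<open>N\<^sub>\<phi> + d\<eta> \<otimes> \<xi>\<close>, the Lie derivatives
  of \<open>\<phi>\<close> and \<open>\<eta>\<close> along \<open>\<xi>\<close>, and \<open>d\<eta>(\<phi> \<cdot>, \<cdot>) + d\<eta>(\<cdot>, \<phi> \<cdot>)\<close>; the last three vanish as a consequence of the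
  vanishing of the first (\<open>normal_almost_contact_consequences\<close>).

  The map \<open>(x, t) \<mapsto> (f\<^sup>k x, t + k a)\<close> has differential \<open>df\<^sup>k\<close> on \<open>TM\<close> and the identity on \<open>T\<real>\<close>, so it
  preserves every tensor built from \<open>dt\<close> and the tensors that \<open>f\<close> preserves (\<open>cyl_map_preserves\<close>). The translations of
  the second coordinate make the action free and discontinuous (\<open>discrete_action_torus\<close>). For any such
  action the orbit map \<open>q\<close> is a local diffeomorphism onto a manifold whose charts are those upstairs
  read through a local inverse of \<open>q\<close>. An invariant tensor descends, and in these charts
  it has the components it has upstairs. The coordinate criterion for the
  quotient is thus literally the one for the cylinder (\<open>quasi_vaisman_quotient\<close>). Compactness holds because
  \<open>M \<times> [0, a]\<close> meets all orbits.
\<close>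

section \<open>Calculus of smooth maps on open sets\<close>

lemma Ck_on_continuous: "Ck_on k f S \<Longrightarrow> continuous_on S f"
  by (cases k) (auto intro!: continuous_at_imp_continuous_on differentiable_imp_continuous_within)

lemma Ck_on_Suc_D: "Ck_on (Suc k) f S \<Longrightarrow> Ck_on k f S"
proof (induction k arbitrary: f)
  case 0
  then show ?case using Ck_on_continuous by fastforce
next
  case (Suc k)
  then show ?case using Ck_on.simps(2) by blast
qed

lemma Ck_on_cong:
  assumes "open S" "\<And>x. x \<in> S \<Longrightarrow> f x = g x" "Ck_on k f S"
  shows "Ck_on k g S"
  using assms(2,3)
proof (induction k arbitrary: f g)
  case 0
  then show ?case by (auto cong: continuous_on_cong)
next
  case (Suc k)
  have d: "f differentiable (at x)" if "x \<in> S" for x using Suc.prems that by auto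
  have "g differentiable (at x)" if "x \<in> S" for x
    using d[OF that] \<open>open S\<close> that Suc.prems(1)
    by (metis differentiable_def has_derivative_transform_within_open)
  moreover have "Ck_on k (\<lambda>x. frechet_derivative g (at x) v) S" for v
  proof (rule Suc.IH)
    show "Ck_on k (\<lambda>x. frechet_derivative f (at x) v) S" using Suc.prems by auto
    show "frechet_derivative f (at x) v = frechet_derivative g (at x) v" if "x \<in> S" for x
      using frechet_derivative_transform_within_open[OF d[OF that] \<open>open S\<close> that] Suc.prems(1) by metis
  qed
  ultimately show ?case by simp
qed

lemma Ck_on_subset: "Ck_on k f S \<Longrightarrow> T \<subseteq> S \<Longrightarrow> Ck_on k f T"
  by (induction k arbitrary: f) (auto intro: continuous_on_subset)

lemma Ck_on_local:
  assumes "\<And>x. x \<in> S \<Longrightarrow> \<exists>T. open T \<and> x \<in> T \<and> Ck_on k f T"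
  shows "Ck_on k f S"
  using assms
proof (induction k arbitrary: f)
  case 0
  show ?case unfolding Ck_on.simps
  proof (rule continuous_at_imp_continuous_on, rule)
    fix x assume "x \<in> S"
    then show "isCont f x" using 0 by (metis Ck_on.simps(1) continuous_on_eq_continuous_at)
  qed
next
  case (Suc k)
  have "f differentiable (at x)" if "x \<in> S" for x using Suc.prems[OF that] by auto
  moreover have "Ck_on k (\<lambda>x. frechet_derivative f (at x) v) S" for v
    by (rule Suc.IH) (metis Suc.prems Ck_on.simps(2))
  ultimately show ?case by simp
qed

lemma Ck_on_const: "Ck_on k (\<lambda>x. c) S"
  by (induction k arbitrary: c) auto

lemma Ck_on_bounded_linear:
  assumes "bounded_linear L" "open S"
  shows "Ck_on k f S \<Longrightarrow> Ck_on k (\<lambda>x. L (f x)) S"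
proof (induction k arbitrary: f)
  case 0
  then show ?case
    using bounded_linear.continuous_on[OF assms(1)] by auto
next
  case (Suc k)
  have hd: "((\<lambda>x. L (f x)) has_derivative (\<lambda>v. L (frechet_derivative f (at x) v))) (at x)"
    if "x \<in> S" for x
    using Suc.prems that
    by (intro bounded_linear.has_derivative[OF assms(1)]) (auto simp: frechet_derivative_works)
  have "(\<lambda>x. L (f x)) differentiable (at x)" if "x \<in> S" for x
    using hd[OF that] by (rule differentiableI)
  moreover have "Ck_on k (\<lambda>x. frechet_derivative (\<lambda>x. L (f x)) (at x) v) S" for v
  proof (rule Ck_on_cong[OF \<open>open S\<close> _ Suc.IH])
    show "Ck_on k (\<lambda>x. frechet_derivative f (at x) v) S" using Suc.prems by simp
  qed (simp add: frechet_derivative_at[OF hd, symmetric])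
  ultimately show ?case by simp
qed

lemma Ck_on_add:
  assumes "open S"
  shows "Ck_on k f S \<Longrightarrow> Ck_on k g S \<Longrightarrow> Ck_on k (\<lambda>x. f x + g x) S"
proof (induction k arbitrary: f g)
  case 0
  then show ?case by (auto intro: continuous_on_add)
next
  case (Suc k)
  have hd: "((\<lambda>x. f x + g x) has_derivative
      (\<lambda>v. frechet_derivative f (at x) v + frechet_derivative g (at x) v)) (at x)"
    if "x \<in> S" for x
    using Suc.prems that by (intro has_derivative_add) (auto simp: frechet_derivative_works)
  have "(\<lambda>x. f x + g x) differentiable (at x)" if "x \<in> S" for x
    using hd[OF that] by (rule differentiableI)
  moreover have "Ck_on k (\<lambda>x. frechet_derivative (\<lambda>x. f x + g x) (at x) v) S" for v
  proof (rule Ck_on_cong[OF \<open>open S\<close> _ Suc.IH])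
    show "Ck_on k (\<lambda>x. frechet_derivative f (at x) v) S"
      "Ck_on k (\<lambda>x. frechet_derivative g (at x) v) S" using Suc.prems by simp_all
  qed (simp add: frechet_derivative_at[OF hd, symmetric])
  ultimately show ?case by simp
qed

lemma Ck_on_bounded_bilinear:
  assumes "bounded_bilinear L" "open S"
  shows "Ck_on k f S \<Longrightarrow> Ck_on k g S \<Longrightarrow> Ck_on k (\<lambda>x. L (f x) (g x)) S"
proof (induction k arbitrary: f g)
  case 0
  then show ?case using bounded_bilinear.continuous_on[OF assms(1)] by auto
next
  case (Suc k)
  have hd: "((\<lambda>x. L (f x) (g x)) has_derivative
      (\<lambda>v. L (f x) (frechet_derivative g (at x) v) + L (frechet_derivative f (at x) v) (g x))) (at x)"
    if "x \<in> S" for x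
    using Suc.prems that
    by (intro bounded_bilinear.FDERIV[OF assms(1)]) (auto simp: frechet_derivative_works)
  have "(\<lambda>x. L (f x) (g x)) differentiable (at x)" if "x \<in> S" for x
    using hd[OF that] by (rule differentiableI)
  moreover have "Ck_on k (\<lambda>x. frechet_derivative (\<lambda>x. L (f x) (g x)) (at x) v) S" for v
  proof (rule Ck_on_cong[OF \<open>open S\<close> _ Ck_on_add[OF \<open>open S\<close>
        Suc.IH[of f "\<lambda>x. frechet_derivative g (at x) v"] Suc.IH[of "\<lambda>x. frechet_derivative f (at x) v" g]]])
    show "Ck_on k (\<lambda>x. frechet_derivative f (at x) v) S"
      "Ck_on k (\<lambda>x. frechet_derivative g (at x) v) S" using Suc.prems by auto
    show "Ck_on k f S" "Ck_on k g S" using Suc.prems Ck_on_Suc_D by blast+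
  qed (simp add: frechet_derivative_at[OF hd, symmetric])
  ultimately show ?case by simp
qed

lemma Ck_on_sum:
  assumes "open S" "\<And>i. i \<in> I \<Longrightarrow> Ck_on k (f i) S"
  shows "Ck_on k (\<lambda>x. \<Sum>i\<in>I. f i x) S"
  using assms(2)
  by (induction I rule: infinite_finite_induct) (auto intro!: Ck_on_const Ck_on_add[OF assms(1)])

text \<open>By the chain rule, a directional derivative of \<open>g \<circ> f\<close> is a sum of products of components of
  \<open>D f\<close> with partial derivatives of \<open>g\<close> along \<open>f\<close>, which is of class \<open>C^k\<close> by induction.\<close>

lemma Ck_on_compose:
  fixes f :: "'d::real_normed_vector \<Rightarrow> 'e::euclidean_space"
  assumes "open S" "open T" "f ` S \<subseteq> T"
  shows "Ck_on k f S \<Longrightarrow> Ck_on k g T \<Longrightarrow> Ck_on k (\<lambda>x. g (f x)) S"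
proof (induction k arbitrary: g)
  case 0
  then show ?case using continuous_on_compose2[of T g S f] assms(3) by auto
next
  case (Suc k)
  have gd: "g differentiable (at (f x))" if "x \<in> S" for x using Suc.prems assms(3) that by auto
  have hd: "((\<lambda>x. g (f x)) has_derivative
      (\<lambda>v. frechet_derivative g (at (f x)) (frechet_derivative f (at x) v))) (at x)"
    if "x \<in> S" for x
    using Suc.prems that gd[OF that]
    by (intro has_derivative_compose[of f _ x UNIV g]) (auto simp: frechet_derivative_works)
  have "(\<lambda>x. g (f x)) differentiable (at x)" if "x \<in> S" for x
    using hd[OF that] by (rule differentiableI)
  moreover have "Ck_on k (\<lambda>x. frechet_derivative (\<lambda>x. g (f x)) (at x) v) S" for v
  proof (rule Ck_on_cong[OF \<open>open S\<close>])
    show "Ck_on k (\<lambda>x. \<Sum>b\<in>Basis. (frechet_derivative f (at x) v \<bullet> b) *\<^sub>R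
        (\<lambda>z. frechet_derivative g (at z) b) (f x)) S"
    proof (intro Ck_on_sum[OF \<open>open S\<close>] Ck_on_bounded_bilinear[OF bounded_bilinear_scaleR \<open>open S\<close>]
        Ck_on_bounded_linear[OF bounded_linear_inner_left \<open>open S\<close>])
      show "Ck_on k (\<lambda>x. (\<lambda>z. frechet_derivative g (at z) b) (f x)) S" for b
        by (rule Suc.IH) (use Suc.prems Ck_on_Suc_D[of k f S] in auto)
    qed (use Suc.prems in auto)
    fix x assume x: "x \<in> S"
    let ?l = "frechet_derivative g (at (f x))" and ?v = "frechet_derivative f (at x) v"
    have l: "linear ?l" by (rule linear_frechet_derivative[OF gd[OF x]])
    have "(\<Sum>b\<in>Basis. (?v \<bullet> b) *\<^sub>R ?l b) = ?l (\<Sum>b\<in>Basis. (?v \<bullet> b) *\<^sub>R b)"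
      by (simp add: linear_sum[OF l] linear_cmul[OF l])
    also have "\<dots> = ?l ?v" by (simp add: euclidean_representation)
    also have "\<dots> = frechet_derivative (\<lambda>x. g (f x)) (at x) v"
      by (simp add: frechet_derivative_at[OF hd[OF x], symmetric])
    finally show "(\<Sum>b\<in>Basis. (?v \<bullet> b) *\<^sub>R (\<lambda>z. frechet_derivative g (at z) b) (f x)) =
      frechet_derivative (\<lambda>x. g (f x)) (at x) v" by simp
  qed
  ultimately show ?case by simp
qed

lemma smooth_on_cong:
  "open S \<Longrightarrow> (\<And>x. x \<in> S \<Longrightarrow> f x = g x) \<Longrightarrow> smooth_on S f \<Longrightarrow> smooth_on S g"
  unfolding smooth_on_def by (blast intro: Ck_on_cong)

lemma smooth_on_subset: "smooth_on S f \<Longrightarrow> T \<subseteq> S \<Longrightarrow> smooth_on T f"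
  unfolding smooth_on_def by (blast intro: Ck_on_subset)

lemma smooth_on_local:
  assumes "\<And>x. x \<in> S \<Longrightarrow> \<exists>T. open T \<and> x \<in> T \<and> smooth_on T f"
  shows "smooth_on S f"
  unfolding smooth_on_def
proof
  fix k
  show "Ck_on k f S"
  proof (rule Ck_on_local)
    fix x assume "x \<in> S"
    then obtain T where "open T" "x \<in> T" "smooth_on T f" using assms by blast
    then show "\<exists>T. open T \<and> x \<in> T \<and> Ck_on k f T" unfolding smooth_on_def by blast
  qed
qed

lemma smooth_on_const: "smooth_on S (\<lambda>x. c)"
  unfolding smooth_on_def by (simp add: Ck_on_const)

lemma smooth_on_differentiable: "smooth_on S f \<Longrightarrow> x \<in> S \<Longrightarrow> f differentiable (at x)"
  unfolding smooth_on_def using Ck_on.simps(2) by blast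

lemma smooth_on_deriv: "smooth_on S f \<Longrightarrow> smooth_on S (\<lambda>x. frechet_derivative f (at x) v)"
  unfolding smooth_on_def using Ck_on.simps(2) by blast

lemma smooth_on_continuous: "smooth_on S f \<Longrightarrow> continuous_on S f"
  unfolding smooth_on_def using Ck_on_continuous by blast

lemma smooth_on_has_derivative:
  "smooth_on S f \<Longrightarrow> x \<in> S \<Longrightarrow> (f has_derivative frechet_derivative f (at x)) (at x)"
  using smooth_on_differentiable frechet_derivative_works by blast

lemma smooth_on_bounded_linear:
  "bounded_linear L \<Longrightarrow> open S \<Longrightarrow> smooth_on S f \<Longrightarrow> smooth_on S (\<lambda>x. L (f x))"
  unfolding smooth_on_def by (blast intro: Ck_on_bounded_linear)

lemma smooth_on_add:
  "open S \<Longrightarrow> smooth_on S f \<Longrightarrow> smooth_on S g \<Longrightarrow> smooth_on S (\<lambda>x. f x + g x)"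
  unfolding smooth_on_def by (blast intro: Ck_on_add)

lemma smooth_on_scaleR:
  fixes f :: "'e::real_normed_vector \<Rightarrow> real"
  shows "open S \<Longrightarrow> smooth_on S f \<Longrightarrow> smooth_on S g \<Longrightarrow> smooth_on S (\<lambda>x. f x *\<^sub>R g x)"
  unfolding smooth_on_def by (auto intro: Ck_on_bounded_bilinear[OF bounded_bilinear_scaleR])

lemma smooth_on_uminus: "open S \<Longrightarrow> smooth_on S f \<Longrightarrow> smooth_on S (\<lambda>x. - f x)"
  by (rule smooth_on_bounded_linear[OF bounded_linear_minus[OF bounded_linear_ident]])

lemma smooth_on_sum:
  "open S \<Longrightarrow> (\<And>i. i \<in> I \<Longrightarrow> smooth_on S (f i)) \<Longrightarrow> smooth_on S (\<lambda>x. \<Sum>i\<in>I. f i x)"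
  unfolding smooth_on_def by (blast intro: Ck_on_sum)

lemma smooth_on_compose:
  fixes f :: "'d::real_normed_vector \<Rightarrow> 'e::euclidean_space"
  shows "open S \<Longrightarrow> open T \<Longrightarrow> f ` S \<subseteq> T \<Longrightarrow> smooth_on S f \<Longrightarrow> smooth_on T g \<Longrightarrow>
    smooth_on S (\<lambda>x. g (f x))"
  unfolding smooth_on_def by (blast intro: Ck_on_compose)

lemma smooth_on_id: "smooth_on S (\<lambda>x. x)"
proof -
  have "Ck_on k (\<lambda>x. x) S" for k by (cases k) (auto simp: Ck_on_const)
  then show ?thesis by (simp add: smooth_on_def)
qed

lemma smooth_on_Pair:
  assumes "open S" "smooth_on S f" "smooth_on S g"
  shows "smooth_on S (\<lambda>x. (f x, g x))"
proof -
  have "smooth_on S (\<lambda>x. (f x, 0) + (0, g x))"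
    using assms by (intro smooth_on_add smooth_on_bounded_linear[where L="\<lambda>x. (x, 0)"]
        smooth_on_bounded_linear[where L="\<lambda>x. (0, x)"])
      (auto intro!: bounded_linear_Pair bounded_linear_ident bounded_linear_zero)
  then show ?thesis by simp
qed

lemma smooth_on_fst: "open S \<Longrightarrow> smooth_on S f \<Longrightarrow> smooth_on S (\<lambda>x. fst (f x))"
  by (rule smooth_on_bounded_linear[OF bounded_linear_fst])

lemma smooth_on_snd: "open S \<Longrightarrow> smooth_on S f \<Longrightarrow> smooth_on S (\<lambda>x. snd (f x))"
  by (rule smooth_on_bounded_linear[OF bounded_linear_snd])

lemma frechet_derivative_cong:
  assumes "open S" "x \<in> S" "\<And>z. z \<in> S \<Longrightarrow> f z = g z"
  shows "frechet_derivative f (at x) = frechet_derivative g (at x)"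
proof -
  have "(f has_derivative D) (at x) \<longleftrightarrow> (g has_derivative D) (at x)" for D
    using has_derivative_transform_within_open[of f D x UNIV S g]
      has_derivative_transform_within_open[of g D x UNIV S f] assms by auto
  then show ?thesis by (simp add: frechet_derivative_def)
qed

subsection \<open>Symmetry of second derivatives\<close>

lemma frechet_derivative_along_line:
  fixes f :: "'e::real_normed_vector \<Rightarrow> real"
  assumes "f differentiable (at (p + s *\<^sub>R u))"
  shows "((\<lambda>s. f (p + s *\<^sub>R u)) has_real_derivative frechet_derivative f (at (p + s *\<^sub>R u)) u) (at s)"
proof -
  let ?D = "frechet_derivative f (at (p + s *\<^sub>R u))"
  have l: "linear ?D" by (rule linear_frechet_derivative[OF assms])
  have "((\<lambda>s. p + s *\<^sub>R u) has_derivative (\<lambda>h. h *\<^sub>R u)) (at s)"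
    by (auto intro!: derivative_eq_intros)
  moreover have "(f has_derivative ?D) (at (p + s *\<^sub>R u))"
    using assms by (simp add: frechet_derivative_works)
  ultimately have "((\<lambda>s. f (p + s *\<^sub>R u)) has_derivative (\<lambda>h. ?D (h *\<^sub>R u))) (at s)"
    by (rule has_derivative_compose)
  then show ?thesis
    by (simp add: has_field_derivative_def linear_cmul[OF l] mult.commute[of "?D u"] mult_commute_abs)
qed

text \<open>The second difference of \<open>f\<close> over a small parallelogram is, by two applications of the mean
  value theorem, a value of either mixed derivative near the vertex.\<close>

lemma second_difference_mean_value:
  fixes f :: "'e::real_normed_vector \<Rightarrow> real"
  assumes f: "\<And>z. z \<in> S \<Longrightarrow> f differentiable (at z)"
    and fu: "\<And>z. z \<in> S \<Longrightarrow> (\<lambda>z. frechet_derivative f (at z) u) differentiable (at z)"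
    and h: "h > 0" and S: "\<And>s t. 0 \<le> s \<Longrightarrow> s \<le> h \<Longrightarrow> 0 \<le> t \<Longrightarrow> t \<le> h \<Longrightarrow> p + s *\<^sub>R u + t *\<^sub>R v \<in> S"
  shows "\<exists>s t. 0 \<le> s \<and> s \<le> h \<and> 0 \<le> t \<and> t \<le> h \<and>
    f (p + h *\<^sub>R u + h *\<^sub>R v) - f (p + h *\<^sub>R u) - f (p + h *\<^sub>R v) + f p =
    h * h * frechet_derivative (\<lambda>z. frechet_derivative f (at z) u) (at (p + s *\<^sub>R u + t *\<^sub>R v)) v"
proof -
  let ?fu = "\<lambda>z. frechet_derivative f (at z) u"
  define \<phi> where "\<phi> = (\<lambda>s. f ((p + h *\<^sub>R v) + s *\<^sub>R u) - f (p + s *\<^sub>R u))"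
  have d\<phi>: "(\<phi> has_real_derivative (?fu ((p + h *\<^sub>R v) + s *\<^sub>R u) - ?fu (p + s *\<^sub>R u))) (at s)"
    if "0 \<le> s" "s \<le> h" for s
    unfolding \<phi>_def using that h S[of s 0] S[of s h]
    by (intro DERIV_diff frechet_derivative_along_line f) (auto simp: algebra_simps)
  obtain s where s: "0 < s" "s < h"
    and e1: "\<phi> h - \<phi> 0 = (h - 0) * (?fu ((p + h *\<^sub>R v) + s *\<^sub>R u) - ?fu (p + s *\<^sub>R u))"
    using MVT2[OF h, of \<phi> "\<lambda>s. ?fu ((p + h *\<^sub>R v) + s *\<^sub>R u) - ?fu (p + s *\<^sub>R u)"] d\<phi> by blast
  have d2: "((\<lambda>t. ?fu ((p + s *\<^sub>R u) + t *\<^sub>R v)) has_real_derivative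
     frechet_derivative ?fu (at ((p + s *\<^sub>R u) + t *\<^sub>R v)) v) (at t)" if "0 \<le> t" "t \<le> h" for t
    using that s S[of s t] by (intro frechet_derivative_along_line fu) auto
  obtain t where t: "0 < t" "t < h"
    and e2: "?fu ((p + s *\<^sub>R u) + h *\<^sub>R v) - ?fu ((p + s *\<^sub>R u) + 0 *\<^sub>R v) =
      (h - 0) * frechet_derivative ?fu (at ((p + s *\<^sub>R u) + t *\<^sub>R v)) v"
    using MVT2[OF h, of "\<lambda>t. ?fu ((p + s *\<^sub>R u) + t *\<^sub>R v)"
        "\<lambda>t. frechet_derivative ?fu (at ((p + s *\<^sub>R u) + t *\<^sub>R v)) v"] d2 by blast
  have "f (p + h *\<^sub>R u + h *\<^sub>R v) - f (p + h *\<^sub>R u) - f (p + h *\<^sub>R v) + f p = \<phi> h - \<phi> 0"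
    by (simp add: \<phi>_def algebra_simps)
  also have "\<dots> = h * (h * frechet_derivative ?fu (at ((p + s *\<^sub>R u) + t *\<^sub>R v)) v)"
    using e1 e2 by (simp add: algebra_simps)
  finally show ?thesis using s t by (intro exI[of _ s] exI[of _ t]) auto
qed

lemma symmetric_second_derivative_real:
  fixes f :: "'e::real_normed_vector \<Rightarrow> real"
  assumes S: "open S" and f: "smooth_on S f" and p: "p \<in> S"
  shows "frechet_derivative (\<lambda>z. frechet_derivative f (at z) u) (at p) v =
    frechet_derivative (\<lambda>z. frechet_derivative f (at z) v) (at p) u"
proof -
  define A where "A = (\<lambda>z. frechet_derivative (\<lambda>z. frechet_derivative f (at z) u) (at z) v)"
  define B where "B = (\<lambda>z. frechet_derivative (\<lambda>z. frechet_derivative f (at z) v) (at z) u)"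
  have "smooth_on S A" "smooth_on S B" unfolding A_def B_def by (intro smooth_on_deriv f)+
  have cA: "isCont A p" and cB: "isCont B p"
    using \<open>smooth_on S A\<close> \<open>smooth_on S B\<close> S p smooth_on_continuous continuous_on_eq_continuous_at
    by blast+
  have "\<bar>A p - B p\<bar> < \<epsilon>" if e: "\<epsilon> > 0" for \<epsilon>
  proof -
    obtain d1 where d1: "d1 > 0" "\<And>z. dist z p < d1 \<Longrightarrow> dist (A z) (A p) < \<epsilon>/2"
      using cA e unfolding continuous_at_eps_delta by (metis half_gt_zero)
    obtain d2 where d2: "d2 > 0" "\<And>z. dist z p < d2 \<Longrightarrow> dist (B z) (B p) < \<epsilon>/2"
      using cB e unfolding continuous_at_eps_delta by (metis half_gt_zero)
    obtain d3 where d3: "d3 > 0" "ball p d3 \<subseteq> S" using S p open_contains_ball by blast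
    define d where "d = min d1 (min d2 d3)"
    have d: "d > 0" using d1 d2 d3 by (simp add: d_def)
    \<comment> \<open>so small that the parallelogram with edges \<open>h u\<close> and \<open>h v\<close> lies in the ball of radius \<open>d\<close>\<close>
    define h where "h = d / (2 * (norm u + norm v + 1))"
    have h: "h > 0" using d by (simp add: h_def add_nonneg_pos)
    have close: "dist (p + s *\<^sub>R u + t *\<^sub>R v) p < d"
      if "0 \<le> s" "s \<le> h" "0 \<le> t" "t \<le> h" for s t
    proof -
      have "dist (p + s *\<^sub>R u + t *\<^sub>R v) p \<le> s * norm u + t * norm v"
        using that norm_triangle_ineq[of "s *\<^sub>R u" "t *\<^sub>R v"] by (simp add: dist_norm)
      also have "\<dots> \<le> h * norm u + h * norm v"
        using that by (intro add_mono mult_right_mono) auto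
      also have "\<dots> \<le> h * (norm u + norm v + 1)" using h by (simp add: algebra_simps)
      also have "\<dots> = d / 2"
      proof -
        have "norm u + norm v + 1 > 0" by (simp add: add_nonneg_pos)
        then show ?thesis unfolding h_def times_divide_eq_left by (subst frac_eq_eq) auto
      qed
      also have "\<dots> < d" using d by simp
      finally show ?thesis .
    qed
    have inS: "p + s *\<^sub>R u + t *\<^sub>R v \<in> S" if "0 \<le> s" "s \<le> h" "0 \<le> t" "t \<le> h" for s t
      using close[OF that] d3(2) by (auto simp: d_def dist_commute subset_iff)
    have sm: "\<And>z. z \<in> S \<Longrightarrow> f differentiable (at z)"
      "\<And>z w. z \<in> S \<Longrightarrow> (\<lambda>z. frechet_derivative f (at z) w) differentiable (at z)"
      using f smooth_on_deriv smooth_on_differentiable by blast+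
    obtain s t where st: "0 \<le> s" "s \<le> h" "0 \<le> t" "t \<le> h" and
      e1: "f (p + h *\<^sub>R u + h *\<^sub>R v) - f (p + h *\<^sub>R u) - f (p + h *\<^sub>R v) + f p =
        h * h * A (p + s *\<^sub>R u + t *\<^sub>R v)"
      unfolding A_def using second_difference_mean_value[OF sm(1) sm(2)[where w=u] h inS] by auto
    have inS': "p + s *\<^sub>R v + t *\<^sub>R u \<in> S" if "0 \<le> s" "s \<le> h" "0 \<le> t" "t \<le> h" for s t
      using inS[of t s] that by (simp add: algebra_simps)
    obtain s' t' where st': "0 \<le> s'" "s' \<le> h" "0 \<le> t'" "t' \<le> h" and
      e2: "f (p + h *\<^sub>R v + h *\<^sub>R u) - f (p + h *\<^sub>R v) - f (p + h *\<^sub>R u) + f p =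
        h * h * B (p + s' *\<^sub>R v + t' *\<^sub>R u)"
      unfolding B_def using second_difference_mean_value[OF sm(1) sm(2)[where w=v] h inS'] by auto
    have "h * h * A (p + s *\<^sub>R u + t *\<^sub>R v) = h * h * B (p + s' *\<^sub>R v + t' *\<^sub>R u)"
      using e1 e2 by (simp add: algebra_simps)
    then have eq: "A (p + s *\<^sub>R u + t *\<^sub>R v) = B (p + t' *\<^sub>R u + s' *\<^sub>R v)"
      using h by (simp add: algebra_simps)
    have "dist (A (p + s *\<^sub>R u + t *\<^sub>R v)) (A p) < \<epsilon>/2"
      by (rule d1(2)) (use close[of s t] st in \<open>simp add: d_def\<close>)
    moreover have "dist (B (p + t' *\<^sub>R u + s' *\<^sub>R v)) (B p) < \<epsilon>/2"
      by (rule d2(2)) (use close[of t' s'] st' in \<open>simp add: d_def\<close>)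
    ultimately show ?thesis using eq by (simp add: dist_real_def abs_if split: if_splits)
  qed
  then have "A p = B p" by (metis eq_iff_diff_eq_0 less_irrefl zero_less_abs_iff)
  then show ?thesis by (simp add: A_def B_def)
qed

lemma symmetric_second_derivative:
  fixes f :: "'e::real_normed_vector \<Rightarrow> 'f::euclidean_space"
  assumes S: "open S" and f: "smooth_on S f" and p: "p \<in> S"
  shows "frechet_derivative (\<lambda>z. frechet_derivative f (at z) u) (at p) v =
    frechet_derivative (\<lambda>z. frechet_derivative f (at z) v) (at p) u"
proof (rule euclidean_eqI)
  fix b :: 'f assume "b \<in> Basis"
  have inner: "frechet_derivative (\<lambda>z. g z \<bullet> b) (at z) w = frechet_derivative g (at z) w \<bullet> b"
    if "smooth_on S g" "z \<in> S" for g :: "'e \<Rightarrow> 'f" and z w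
    using frechet_derivative_at[OF bounded_linear.has_derivative[OF bounded_linear_inner_left
          smooth_on_has_derivative[OF that]], of b] by metis
  have two: "frechet_derivative (\<lambda>z. frechet_derivative f (at z) u) (at p) v \<bullet> b =
     frechet_derivative (\<lambda>z. frechet_derivative (\<lambda>z. f z \<bullet> b) (at z) u) (at p) v" for u v
  proof -
    have "frechet_derivative (\<lambda>z. frechet_derivative (\<lambda>z. f z \<bullet> b) (at z) u) (at p) =
      frechet_derivative (\<lambda>z. frechet_derivative f (at z) u \<bullet> b) (at p)"
      by (rule frechet_derivative_cong[OF S p]) (simp add: inner[OF f])
    then show ?thesis by (simp add: inner[OF smooth_on_deriv[OF f] p])
  qed
  have "smooth_on S (\<lambda>z. f z \<bullet> b)" by (rule smooth_on_bounded_linear[OF bounded_linear_inner_left S f])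
  from symmetric_second_derivative_real[OF S this p]
  show "frechet_derivative (\<lambda>z. frechet_derivative f (at z) u) (at p) v \<bullet> b =
    frechet_derivative (\<lambda>z. frechet_derivative f (at z) v) (at p) u \<bullet> b" by (simp add: two)
qed

section \<open>Smooth fields of linear maps in coordinates\<close>

text \<open>Smoothness is asked for constant arguments only. Since the argument ranges over a space of finite
  dimension, linearity extends it to arguments that depend smoothly on the point.\<close>

definition smooth_lin ::
  "'e::euclidean_space set \<Rightarrow> ('e \<Rightarrow> 'v::euclidean_space \<Rightarrow> 'f::real_normed_vector) \<Rightarrow> bool" where
  "smooth_lin S B \<longleftrightarrow> (\<forall>y\<in>S. linear (B y)) \<and> (\<forall>w. smooth_on S (\<lambda>y. B y w))"

text \<open>The flat covariant derivative \<open>(D\<^sub>v B) w\<close> at \<open>y\<close>.\<close>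

definition coord_deriv ::
  "('e::euclidean_space \<Rightarrow> 'v \<Rightarrow> 'f::real_normed_vector) \<Rightarrow> 'e \<Rightarrow> 'e \<Rightarrow> 'v \<Rightarrow> 'f" where
  "coord_deriv B y v w = frechet_derivative (\<lambda>z. B z w) (at y) v"

lemma linear_eq_sum_Basis:
  fixes l :: "'v::euclidean_space \<Rightarrow> 'f::real_normed_vector"
  assumes "linear l"
  shows "l x = (\<Sum>b\<in>Basis. (x \<bullet> b) *\<^sub>R l b)"
proof -
  have "l x = l (\<Sum>b\<in>Basis. (x \<bullet> b) *\<^sub>R b)" by (simp add: euclidean_representation)
  then show ?thesis by (simp add: linear_sum[OF assms] linear_cmul[OF assms])
qed

lemma smooth_lin_subset: "smooth_lin S B \<Longrightarrow> T \<subseteq> S \<Longrightarrow> smooth_lin T B"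
  unfolding smooth_lin_def using smooth_on_subset by blast

lemma smooth_lin_cong:
  assumes "open S" "smooth_lin S B" "\<And>y w. y \<in> S \<Longrightarrow> B y w = C y w"
  shows "smooth_lin S C"
proof -
  have "B y = C y" if "y \<in> S" for y using assms(3)[OF that] by auto
  then show ?thesis using assms(2) smooth_on_cong[OF assms(1)]
    unfolding smooth_lin_def by (metis (no_types, lifting))
qed

lemma smooth_lin_linear: "smooth_lin S B \<Longrightarrow> y \<in> S \<Longrightarrow> linear (B y)"
  by (simp add: smooth_lin_def)

lemma smooth_lin_apply:
  assumes "open S" "smooth_lin S B" "smooth_on S X"
  shows "smooth_on S (\<lambda>y. B y (X y))"
proof (rule smooth_on_cong[OF assms(1)])
  show "smooth_on S (\<lambda>y. \<Sum>b\<in>Basis. (X y \<bullet> b) *\<^sub>R B y b)"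
  proof (intro smooth_on_sum[OF assms(1)] smooth_on_scaleR[OF assms(1)])
    show "smooth_on S (\<lambda>y. X y \<bullet> b)" for b
      by (rule smooth_on_bounded_linear[OF bounded_linear_inner_left assms(1,3)])
    show "smooth_on S (\<lambda>y. B y b)" for b using assms(2) by (simp add: smooth_lin_def)
  qed
qed (use assms(2) linear_eq_sum_Basis in \<open>metis smooth_lin_def\<close>)

text \<open>The Leibniz rule for the evaluation of a field of linear maps on a vector-valued function.\<close>

lemma smooth_lin_derivative:
  assumes "open S" "smooth_lin S B" "y \<in> S" "X differentiable (at y)"
  shows "frechet_derivative (\<lambda>z. B z (X z)) (at y) v =
    coord_deriv B y v (X y) + B y (frechet_derivative X (at y) v)"
proof -
  let ?X' = "frechet_derivative X (at y)"
  have sB: "smooth_on S (\<lambda>z. B z w)" for w using assms(2) by (simp add: smooth_lin_def)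
  have dX: "((\<lambda>z. X z \<bullet> b) has_derivative (\<lambda>v. ?X' v \<bullet> b)) (at y)" for b
    using assms(4) frechet_derivative_works
    by (intro bounded_linear.has_derivative[OF bounded_linear_inner_left]) blast
  have "((\<lambda>z. \<Sum>b\<in>Basis. (X z \<bullet> b) *\<^sub>R B z b) has_derivative
    (\<lambda>v. \<Sum>b\<in>Basis. (X y \<bullet> b) *\<^sub>R coord_deriv B y v b + (?X' v \<bullet> b) *\<^sub>R B y b)) (at y)"
    unfolding coord_deriv_def
    by (intro has_derivative_sum has_derivative_scaleR dX smooth_on_has_derivative[OF sB assms(3)])
  then have 1: "((\<lambda>z. B z (X z)) has_derivative
    (\<lambda>v. \<Sum>b\<in>Basis. (X y \<bullet> b) *\<^sub>R coord_deriv B y v b + (?X' v \<bullet> b) *\<^sub>R B y b)) (at y)"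
    by (rule has_derivative_transform_within_open[OF _ assms(1,3)])
      (metis assms(2) smooth_lin_linear linear_eq_sum_Basis)
  have "((\<lambda>z. \<Sum>b\<in>Basis. (X y \<bullet> b) *\<^sub>R B z b) has_derivative
    (\<lambda>v. \<Sum>b\<in>Basis. (X y \<bullet> b) *\<^sub>R coord_deriv B y v b)) (at y)"
    unfolding coord_deriv_def
    by (intro has_derivative_sum has_derivative_scaleR_right smooth_on_has_derivative[OF sB assms(3)])
  then have 2: "((\<lambda>z. B z (X y)) has_derivative
    (\<lambda>v. \<Sum>b\<in>Basis. (X y \<bullet> b) *\<^sub>R coord_deriv B y v b)) (at y)"
    by (rule has_derivative_transform_within_open[OF _ assms(1,3)])
      (metis assms(2) smooth_lin_linear linear_eq_sum_Basis)
  have "coord_deriv B y v (X y) = (\<Sum>b\<in>Basis. (X y \<bullet> b) *\<^sub>R coord_deriv B y v b)"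
    unfolding coord_deriv_def[of B y v "X y"] by (simp add: frechet_derivative_at[OF 2, symmetric])
  moreover have "B y (?X' v) = (\<Sum>b\<in>Basis. (?X' v \<bullet> b) *\<^sub>R B y b)"
    by (rule linear_eq_sum_Basis[OF smooth_lin_linear[OF assms(2,3)]])
  ultimately show ?thesis
    by (simp add: frechet_derivative_at[OF 1, symmetric] sum.distrib)
qed

lemma coord_deriv_linear1:
  "smooth_lin S B \<Longrightarrow> y \<in> S \<Longrightarrow> linear (\<lambda>v. coord_deriv B y v w)"
  unfolding coord_deriv_def smooth_lin_def
  by (intro linear_frechet_derivative smooth_on_differentiable) auto

lemma coord_deriv_linear2:
  assumes "open S" "smooth_lin S B" "y \<in> S"
  shows "linear (coord_deriv B y v)"
proof (rule linearI)
  have sB: "smooth_on S (\<lambda>z. B z w)" for w using assms(2) by (simp add: smooth_lin_def)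
  note hd = smooth_on_has_derivative[OF sB assms(3)]
  have lin: "linear (B z)" if "z \<in> S" for z using assms(2) that by (simp add: smooth_lin_def)
  show "coord_deriv B y v (a + b) = coord_deriv B y v a + coord_deriv B y v b" for a b
  proof -
    have "((\<lambda>z. B z (a + b)) has_derivative
       (\<lambda>v. frechet_derivative (\<lambda>z. B z a) (at y) v + frechet_derivative (\<lambda>z. B z b) (at y) v)) (at y)"
      by (rule has_derivative_transform_within_open[OF has_derivative_add[OF hd hd] assms(1,3)])
        (simp add: linear_add[OF lin])
    then show ?thesis unfolding coord_deriv_def
      by (simp add: frechet_derivative_at[of "\<lambda>z. B z (a + b)", symmetric])
  qed
  show "coord_deriv B y v (r *\<^sub>R a) = r *\<^sub>R coord_deriv B y v a" for r a
  proof -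
    have "((\<lambda>z. B z (r *\<^sub>R a)) has_derivative (\<lambda>v. r *\<^sub>R frechet_derivative (\<lambda>z. B z a) (at y) v)) (at y)"
      by (rule has_derivative_transform_within_open[OF has_derivative_scaleR_right[OF hd] assms(1,3)])
        (simp add: linear_cmul[OF lin])
    then show ?thesis unfolding coord_deriv_def
      by (simp add: frechet_derivative_at[of "\<lambda>z. B z (r *\<^sub>R a)", symmetric])
  qed
qed

lemma coord_deriv_cong:
  assumes "open S" "y \<in> S" "\<And>z. z \<in> S \<Longrightarrow> B z w = C z w"
  shows "coord_deriv B y v w = coord_deriv C y v w"
  unfolding coord_deriv_def using frechet_derivative_cong[OF assms(1,2), of "\<lambda>z. B z w" "\<lambda>z. C z w"]
  assms(3) by simp

section \<open>Charts, tangent vectors and differentials\<close>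

lemma manifold_is_chart: "smooth_manifold M \<Longrightarrow> c \<in> atlas M \<Longrightarrow> is_chart (mtop M) c"
  by (simp add: smooth_manifold_def)

lemma charts_atD: "c \<in> charts_at M p \<Longrightarrow> c \<in> atlas M" "c \<in> charts_at M p \<Longrightarrow> p \<in> cdom c"
  by (simp_all add: charts_at_def)

lemma charts_atI: "c \<in> atlas M \<Longrightarrow> p \<in> cdom c \<Longrightarrow> c \<in> charts_at M p"
  by (simp add: charts_at_def)

lemma is_chart_dom: "is_chart X c \<Longrightarrow> openin X (cdom c)"
  by (simp add: is_chart_def)

lemma is_chart_subset: "is_chart X c \<Longrightarrow> cdom c \<subseteq> topspace X"
  using is_chart_dom openin_subset by blast

lemma is_chart_topspace: "is_chart X c \<Longrightarrow> topspace (subtopology X (cdom c)) = cdom c"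
  using is_chart_subset by force

lemma is_chart_inj: "is_chart X c \<Longrightarrow> inj_on (cmap c) (cdom c)"
  using homeomorphic_imp_injective_map is_chart_topspace unfolding is_chart_def by metis

lemma is_chart_cinv: "is_chart X c \<Longrightarrow> p \<in> cdom c \<Longrightarrow> cinv c (cmap c p) = p"
  by (simp add: cinv_def is_chart_inj)

lemma cmap_cinv: "y \<in> cmap c ` cdom c \<Longrightarrow> cmap c (cinv c y) = y"
  by (simp add: cinv_def f_inv_into_f)

lemma cinv_in: "y \<in> cmap c ` cdom c \<Longrightarrow> cinv c y \<in> cdom c"
  by (simp add: cinv_def inv_into_into)

lemma is_chart_open_image:
  assumes "is_chart X c" "openin X W" "W \<subseteq> cdom c"
  shows "open (cmap c ` W)"
proof -
  have "openin (subtopology X (cdom c)) W"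
    using assms by (metis openin_subset_topspace_eq openin_subtopology inf.absorb_iff1)
  then have "openin (top_of_set (cmap c ` cdom c)) (cmap c ` W)"
    using assms(1) homeomorphic_imp_open_map unfolding is_chart_def open_map_def by blast
  then show ?thesis using assms(1) unfolding is_chart_def by (metis openin_open_eq)
qed

lemma is_chart_open_preimage:
  assumes "is_chart X c" "open S"
  shows "openin X {p \<in> cdom c. cmap c p \<in> S}"
proof -
  have "continuous_map (subtopology X (cdom c)) (top_of_set (cmap c ` cdom c)) (cmap c)"
    using assms(1) homeomorphic_imp_continuous_map unfolding is_chart_def by blast
  then have "continuous_map (subtopology X (cdom c)) euclidean (cmap c)"
    using continuous_map_in_subtopology by blast
  then have "openin (subtopology X (cdom c)) {p \<in> topspace (subtopology X (cdom c)). cmap c p \<in> S}"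
    using assms(2) unfolding continuous_map_def by (metis open_openin)
  then have "openin (subtopology X (cdom c)) {p \<in> cdom c. cmap c p \<in> S}"
    unfolding is_chart_topspace[OF assms(1)] .
  then show ?thesis by (rule openin_trans_full) (rule is_chart_dom[OF assms(1)])
qed

lemma chart_open_Int:
  "smooth_manifold M \<Longrightarrow> c \<in> atlas M \<Longrightarrow> openin (mtop M) W \<Longrightarrow> open (cmap c ` (cdom c \<inter> W))"
  by (meson Int_lower1 is_chart_dom is_chart_open_image manifold_is_chart openin_Int)

lemma chart_open: "smooth_manifold M \<Longrightarrow> c \<in> atlas M \<Longrightarrow> open (cmap c ` cdom c)"
  using manifold_is_chart is_chart_def by blast

lemma chart_cinv: "smooth_manifold M \<Longrightarrow> c \<in> atlas M \<Longrightarrow> p \<in> cdom c \<Longrightarrow> cinv c (cmap c p) = p"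
  by (rule is_chart_cinv[OF manifold_is_chart])

lemma chart_dom_carr: "smooth_manifold M \<Longrightarrow> c \<in> atlas M \<Longrightarrow> cdom c \<subseteq> carr M"
  unfolding carr_def by (rule is_chart_subset[OF manifold_is_chart])

lemma chart_at_mem: "smooth_manifold M \<Longrightarrow> p \<in> carr M \<Longrightarrow> chart_at M p \<in> charts_at M p"
  unfolding chart_at_def
proof (rule someI_ex)
  assume "smooth_manifold M" "p \<in> carr M"
  then show "\<exists>c. c \<in> charts_at M p" unfolding smooth_manifold_def charts_at_def by blast
qed

lemma transition_smooth:
  "smooth_manifold M \<Longrightarrow> c \<in> atlas M \<Longrightarrow> c' \<in> atlas M \<Longrightarrow>
    smooth_on (cmap c ` (cdom c \<inter> cdom c')) (\<lambda>y. cmap c' (cinv c y))"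
  unfolding smooth_manifold_def comp_def by blast

lemma transition_open:
  "smooth_manifold M \<Longrightarrow> c \<in> atlas M \<Longrightarrow> c' \<in> atlas M \<Longrightarrow> open (cmap c ` (cdom c \<inter> cdom c'))"
  by (meson chart_open_Int is_chart_dom manifold_is_chart)

lemma smooth_map_coord_open:
  assumes "smooth_manifold M" "smooth_manifold N" "continuous_map (mtop M) (mtop N) F"
    "c \<in> atlas M" "c' \<in> atlas N"
  shows "open (cmap c ` {p \<in> cdom c. F p \<in> cdom c'})"
proof -
  have "openin (mtop M) {p \<in> topspace (mtop M). F p \<in> cdom c'}"
    using assms(3) is_chart_dom[OF manifold_is_chart[OF assms(2,5)]]
    by (rule openin_continuous_map_preimage)
  from chart_open_Int[OF assms(1,4) this]
  have "open (cmap c ` (cdom c \<inter> {p \<in> topspace (mtop M). F p \<in> cdom c'}))" .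
  moreover have "cdom c \<inter> {p \<in> topspace (mtop M). F p \<in> cdom c'} = {p \<in> cdom c. F p \<in> cdom c'}"
    using chart_dom_carr[OF assms(1,4)] unfolding carr_def by auto
  ultimately show ?thesis by simp
qed

lemma smooth_map_coord:
  "smooth_map M N F \<Longrightarrow> c \<in> atlas M \<Longrightarrow> c' \<in> atlas N \<Longrightarrow>
    smooth_on (cmap c ` {p \<in> cdom c. F p \<in> cdom c'}) (\<lambda>y. cmap c' (F (cinv c y)))"
  unfolding smooth_map_def comp_def by blast

lemma smooth_map_continuous: "smooth_map M N F \<Longrightarrow> continuous_map (mtop M) (mtop N) F"
  by (simp add: smooth_map_def)

lemma smooth_map_carr: "smooth_map M N F \<Longrightarrow> p \<in> carr M \<Longrightarrow> F p \<in> carr N"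
  unfolding smooth_map_def carr_def using continuous_map_image_subset_topspace by blast

lemma smooth_map_coord_differentiable:
  assumes "smooth_manifold M" "smooth_map M N F" "c \<in> charts_at M p" "c' \<in> charts_at N (F p)"
  shows "(\<lambda>y. cmap c' (F (cinv c y))) differentiable (at (cmap c p))"
  by (rule smooth_on_differentiable[OF smooth_map_coord[OF assms(2)]])
    (use assms in \<open>auto simp: charts_at_def\<close>)

lemma smooth_map_id: "smooth_manifold M \<Longrightarrow> smooth_map M M (\<lambda>x. x)"
  unfolding smooth_map_def comp_def
proof (intro conjI ballI)
  fix c c' assume "smooth_manifold M" "c \<in> atlas M" "c' \<in> atlas M"
  from transition_smooth[OF this]
  show "smooth_on (cmap c ` {p \<in> cdom c. p \<in> cdom c'}) (\<lambda>x. cmap c' (cinv c x))"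
    by (simp add: Int_def)
qed simp

lemma smooth_map_cong:
  assumes M: "smooth_manifold M" and N: "smooth_manifold N" and F: "smooth_map M N F"
    and eq: "\<And>p. p \<in> carr M \<Longrightarrow> F p = G p"
  shows "smooth_map M N G"
  unfolding smooth_map_def comp_def
proof (intro conjI ballI)
  show "continuous_map (mtop M) (mtop N) G"
    by (rule continuous_map_eq[OF smooth_map_continuous[OF F]]) (simp add: eq carr_def)
  fix c c' assume c: "c \<in> atlas M" "c' \<in> atlas N"
  have eq': "{p \<in> cdom c. F p \<in> cdom c'} = {p \<in> cdom c. G p \<in> cdom c'}"
    using eq chart_dom_carr[OF M c(1)] by auto
  show "smooth_on (cmap c ` {p \<in> cdom c. G p \<in> cdom c'}) (\<lambda>x. cmap c' (G (cinv c x)))"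
  proof (rule smooth_on_cong[OF _ _ smooth_map_coord[OF F c, unfolded eq']])
    show "open (cmap c ` {p \<in> cdom c. G p \<in> cdom c'})"
      using smooth_map_coord_open[OF M N smooth_map_continuous[OF F] c] by (simp add: eq')
    show "cmap c' (F (cinv c y)) = cmap c' (G (cinv c y))"
      if "y \<in> cmap c ` {p \<in> cdom c. G p \<in> cdom c'}" for y
    proof -
      have "cinv c y \<in> carr M" using that chart_cinv[OF M c(1)] chart_dom_carr[OF M c(1)] by auto
      then show ?thesis by (simp add: eq)
    qed
  qed
qed

lemma smooth_map_compose:
  assumes M: "smooth_manifold M" and N: "smooth_manifold N" and P: "smooth_manifold P"
    and F: "smooth_map M N F" and G: "smooth_map N P G"
  shows "smooth_map M P (\<lambda>x. G (F x))"
  unfolding smooth_map_def comp_def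
proof (intro conjI ballI)
  show cGF: "continuous_map (mtop M) (mtop P) (\<lambda>x. G (F x))"
    using continuous_map_compose[OF smooth_map_continuous[OF F] smooth_map_continuous[OF G]]
    by (simp add: comp_def)
  fix c d assume c: "c \<in> atlas M" and d: "d \<in> atlas P"
  show "smooth_on (cmap c ` {p \<in> cdom c. G (F p) \<in> cdom d}) (\<lambda>x. cmap d (G (F (cinv c x))))"
  proof (rule smooth_on_local)
    fix y assume "y \<in> cmap c ` {p \<in> cdom c. G (F p) \<in> cdom d}"
    then obtain p where p: "p \<in> cdom c" "G (F p) \<in> cdom d" "y = cmap c p" by auto
    have Fp: "F p \<in> carr N" using smooth_map_carr[OF F] chart_dom_carr[OF M c] p(1) by blast
    obtain e where e: "e \<in> atlas N" "F p \<in> cdom e"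
      using chart_at_mem[OF N Fp] by (auto simp: charts_at_def)
    define S where "S = cmap c ` {p \<in> cdom c. F p \<in> cdom e}"
    define T where "T = cmap e ` {p \<in> cdom e. G p \<in> cdom d}"
    define R where "R = S \<inter> cmap c ` {p \<in> cdom c. G (F p) \<in> cdom d}"
    have oS: "open S" unfolding S_def
      by (rule smooth_map_coord_open[OF M N smooth_map_continuous[OF F] c e(1)])
    have oT: "open T" unfolding T_def
      by (rule smooth_map_coord_open[OF N P smooth_map_continuous[OF G] e(1) d])
    have oR: "open R" unfolding R_def
      by (rule open_Int[OF oS smooth_map_coord_open[OF M P cGF c d]])
    have sF: "smooth_on R (\<lambda>y. cmap e (F (cinv c y)))"
      using smooth_map_coord[OF F c e(1)] unfolding R_def S_def by (rule smooth_on_subset) auto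
    have mem: "F (cinv c y) \<in> cdom e \<and> G (F (cinv c y)) \<in> cdom d" if "y \<in> R" for y
    proof
      have "y \<in> S" using that by (simp add: R_def)
      then show "F (cinv c y) \<in> cdom e" using chart_cinv[OF M c] unfolding S_def by auto
      show "G (F (cinv c y)) \<in> cdom d" using that chart_cinv[OF M c] unfolding R_def by auto
    qed
    have "smooth_on R (\<lambda>y. cmap d (G (cinv e (cmap e (F (cinv c y))))))"
      using mem by (intro smooth_on_compose[OF oR oT _ sF smooth_map_coord[OF G e(1) d, folded T_def]])
        (auto simp: T_def)
    then have "smooth_on R (\<lambda>y. cmap d (G (F (cinv c y))))"
      by (rule smooth_on_cong[OF oR, rotated]) (simp add: chart_cinv[OF N e(1)] mem)
    moreover have "y \<in> R" using p e unfolding R_def S_def by blast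
    ultimately show "\<exists>T. open T \<and> y \<in> T \<and> smooth_on T (\<lambda>x. cmap d (G (F (cinv c x))))"
      using oR by blast
  qed
qed

lemma coord_compose_derivative:
  assumes M: "smooth_manifold M" and N: "smooth_manifold N" and P: "smooth_manifold P"
    and F: "smooth_map M N F" and G: "smooth_map N P G"
    and c: "c \<in> charts_at M p" and e: "e \<in> charts_at N (F p)" and d: "d \<in> charts_at P (G (F p))"
  shows "frechet_derivative (\<lambda>y. cmap d (G (F (cinv c y)))) (at (cmap c p)) v =
    frechet_derivative (\<lambda>y. cmap d (G (cinv e y))) (at (cmap e (F p)))
      (frechet_derivative (\<lambda>y. cmap e (F (cinv c y))) (at (cmap c p)) v)"
proof -
  let ?f = "\<lambda>y. cmap e (F (cinv c y))" and ?g = "\<lambda>y. cmap d (G (cinv e y))"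
  have cp: "cinv c (cmap c p) = p" using chart_cinv[OF M] c by (simp add: charts_at_def)
  have "(?f has_derivative frechet_derivative ?f (at (cmap c p))) (at (cmap c p))"
    using smooth_map_coord_differentiable[OF M F c e] frechet_derivative_works by blast
  moreover have "(?g has_derivative frechet_derivative ?g (at (cmap e (F p)))) (at (?f (cmap c p)))"
    unfolding cp using smooth_map_coord_differentiable[OF N G e d] frechet_derivative_works by blast
  ultimately have "((\<lambda>y. ?g (?f y)) has_derivative (\<lambda>v. frechet_derivative ?g (at (cmap e (F p)))
      (frechet_derivative ?f (at (cmap c p)) v))) (at (cmap c p))"
    by (rule has_derivative_compose)
  then have "((\<lambda>y. cmap d (G (F (cinv c y)))) has_derivative
      (\<lambda>v. frechet_derivative ?g (at (cmap e (F p)))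
        (frechet_derivative ?f (at (cmap c p)) v))) (at (cmap c p))"
  proof (rule has_derivative_transform_within_open)
    show "open (cmap c ` {p \<in> cdom c. F p \<in> cdom e})"
      using smooth_map_coord_open[OF M N smooth_map_continuous[OF F]] c e
      by (simp add: charts_at_def)
    show "cmap c p \<in> cmap c ` {p \<in> cdom c. F p \<in> cdom e}" using c e by (simp add: charts_at_def)
    show "?g (?f y) = cmap d (G (F (cinv c y)))" if "y \<in> cmap c ` {p \<in> cdom c. F p \<in> cdom e}" for y
      using that chart_cinv[OF N charts_atD(1)[OF e]] chart_cinv[OF M charts_atD(1)[OF c]] by auto
  qed
  from frechet_derivative_at[OF this] show ?thesis by metis
qed

lemmas transition_compose_derivative =
  coord_compose_derivative[OF _ _ _ smooth_map_id smooth_map_id]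

lemma transition_self_derivative:
  assumes "smooth_manifold M" "c \<in> charts_at M p"
  shows "frechet_derivative (\<lambda>y. cmap c (cinv c y)) (at (cmap c p)) v = v"
proof -
  have "frechet_derivative (\<lambda>y. cmap c (cinv c y)) (at (cmap c p)) =
      frechet_derivative (\<lambda>y. y) (at (cmap c p))"
    by (rule frechet_derivative_cong[OF chart_open[OF assms(1)]])
      (use assms(2) in \<open>auto simp: charts_at_def cmap_cinv\<close>)
  then show ?thesis by simp
qed

lemma tscale_apply [simp]: "(r *\<^sub>T v) c = r *\<^sub>R v c"
  by (simp add: tscale_def)

lemma tangent_transition:
  "v \<in> tangent_space M p \<Longrightarrow> c \<in> charts_at M p \<Longrightarrow> c' \<in> charts_at M p \<Longrightarrow>
    v c' = frechet_derivative (\<lambda>y. cmap c' (cinv c y)) (at (cmap c p)) (v c)"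
  unfolding tangent_space_def comp_def by blast

lemma tangent_off_chart: "v \<in> tangent_space M p \<Longrightarrow> c \<notin> charts_at M p \<Longrightarrow> v c = 0"
  unfolding tangent_space_def by blast

lemma transition_linear:
  assumes "smooth_manifold M" "c \<in> charts_at M p" "c' \<in> charts_at M p"
  shows "linear (frechet_derivative (\<lambda>y. cmap c' (cinv c y)) (at (cmap c p)))"
  by (rule linear_frechet_derivative
      smooth_map_coord_differentiable[OF assms(1) smooth_map_id[OF assms(1)] assms(2,3)])+

lemma tangent_spaceI:
  assumes "\<And>c c'. c \<in> charts_at M p \<Longrightarrow> c' \<in> charts_at M p \<Longrightarrow>
      v c' = frechet_derivative (\<lambda>y. cmap c' (cinv c y)) (at (cmap c p)) (v c)"
    and "\<And>c. c \<notin> charts_at M p \<Longrightarrow> v c = 0"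
  shows "v \<in> tangent_space M p"
  unfolding tangent_space_def comp_def using assms by blast

lemma tangent_add:
  assumes "smooth_manifold M" "v \<in> tangent_space M p" "w \<in> tangent_space M p"
  shows "v + w \<in> tangent_space M p"
proof (rule tangent_spaceI)
  fix c c' assume c: "c \<in> charts_at M p" "c' \<in> charts_at M p"
  show "(v + w) c' = frechet_derivative (\<lambda>y. cmap c' (cinv c y)) (at (cmap c p)) ((v + w) c)"
    unfolding plus_fun_apply linear_add[OF transition_linear[OF assms(1) c]]
    by (simp only: tangent_transition[OF assms(2) c] tangent_transition[OF assms(3) c])
qed (simp add: tangent_off_chart[OF assms(2)] tangent_off_chart[OF assms(3)])

lemma tangent_scale:
  assumes "smooth_manifold M" "v \<in> tangent_space M p"
  shows "r *\<^sub>T v \<in> tangent_space M p"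
proof (rule tangent_spaceI)
  fix c c' assume c: "c \<in> charts_at M p" "c' \<in> charts_at M p"
  show "(r *\<^sub>T v) c' = frechet_derivative (\<lambda>y. cmap c' (cinv c y)) (at (cmap c p)) ((r *\<^sub>T v) c)"
    unfolding tscale_apply linear_cmul[OF transition_linear[OF assms(1) c]]
    by (simp only: tangent_transition[OF assms(2) c])
qed (simp add: tangent_off_chart[OF assms(2)])

lemma tangent_minus:
  assumes "smooth_manifold M" "v \<in> tangent_space M p"
  shows "- v \<in> tangent_space M p"
proof -
  have "- v = (-1) *\<^sub>T v" by (auto simp: tscale_def)
  then show ?thesis using tangent_scale[OF assms] by simp
qed

lemma tangent_diff:
  assumes "smooth_manifold M" "v \<in> tangent_space M p" "w \<in> tangent_space M p"
  shows "v - w \<in> tangent_space M p"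
  using tangent_add[OF assms(1,2) tangent_minus[OF assms(1,3)]] by simp

text \<open>The inverse of the isomorphism \<open>v \<mapsto> v c\<close> from the tangent space to the model space.\<close>

definition tvec ::
  "('a, 'e::euclidean_space) mfd \<Rightarrow> ('a, 'e) chart \<Rightarrow> 'a \<Rightarrow> 'e \<Rightarrow> ('a, 'e) tangent" where
  "tvec M c p w = (\<lambda>c'. if c' \<in> charts_at M p
     then frechet_derivative (\<lambda>y. cmap c' (cinv c y)) (at (cmap c p)) w else 0)"

lemma tvec_mem:
  assumes "smooth_manifold M" "c \<in> charts_at M p"
  shows "tvec M c p w \<in> tangent_space M p"
proof (rule tangent_spaceI)
  fix d d' assume d: "d \<in> charts_at M p" "d' \<in> charts_at M p"
  show "tvec M c p w d' = frechet_derivative (\<lambda>y. cmap d' (cinv d y)) (at (cmap d p)) (tvec M c p w d)"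
    using d transition_compose_derivative[OF assms(1) assms(1) assms(1) assms(1) assms(1) assms(2) d]
    by (simp add: tvec_def)
qed (simp add: tvec_def)

lemma tvec_self: "smooth_manifold M \<Longrightarrow> c \<in> charts_at M p \<Longrightarrow> tvec M c p w c = w"
  by (simp add: tvec_def transition_self_derivative)

lemma tangent_eq_tvec:
  assumes "smooth_manifold M" "c \<in> charts_at M p" "v \<in> tangent_space M p"
  shows "tvec M c p (v c) = v"
  using tangent_transition[OF assms(3,2)] tangent_off_chart[OF assms(3)]
  by (auto simp: tvec_def fun_eq_iff)

lemma tangent_eqI:
  assumes "smooth_manifold M" "c \<in> charts_at M p" "v \<in> tangent_space M p" "w \<in> tangent_space M p"
    and "v c = w c"
  shows "v = w"
  using assms tangent_eq_tvec by metis

lemma tangent_zero: "smooth_manifold M \<Longrightarrow> 0 \<in> tangent_space M p"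
  by (rule tangent_spaceI) (simp_all add: linear_0[OF transition_linear])

lemma tvec_add:
  "smooth_manifold M \<Longrightarrow> c \<in> charts_at M p \<Longrightarrow> tvec M c p (v + w) = tvec M c p v + tvec M c p w"
  by (rule tangent_eqI) (auto simp: tvec_self intro!: tangent_add tvec_mem)

lemma tvec_scale:
  "smooth_manifold M \<Longrightarrow> c \<in> charts_at M p \<Longrightarrow> tvec M c p (r *\<^sub>R w) = r *\<^sub>T tvec M c p w"
  by (rule tangent_eqI) (auto simp: tvec_self intro!: tangent_scale tvec_mem)

subsection \<open>Differentials\<close>

lemma differential_coord:
  assumes M: "smooth_manifold M" and N: "smooth_manifold N" and F: "smooth_map M N F"
    and c: "c \<in> charts_at M p" and d: "d \<in> charts_at N (F p)" and v: "v \<in> tangent_space M p"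
  shows "differential M N F p v d = frechet_derivative (\<lambda>y. cmap d (F (cinv c y))) (at (cmap c p)) (v c)"
proof -
  let ?b = "chart_at M p"
  have "p \<in> carr M" using c chart_dom_carr[OF M] by (auto simp: charts_at_def)
  then have b: "?b \<in> charts_at M p" by (rule chart_at_mem[OF M])
  have "differential M N F p v d = frechet_derivative (\<lambda>y. cmap d (F (cinv ?b y))) (at (cmap ?b p)) (v ?b)"
    using d by (simp add: differential_def comp_def Let_def)
  also have "v ?b = frechet_derivative (\<lambda>y. cmap ?b (cinv c y)) (at (cmap c p)) (v c)"
    by (rule tangent_transition[OF v c b])
  also have "frechet_derivative (\<lambda>y. cmap d (F (cinv ?b y))) (at (cmap ?b p)) \<dots> =
      frechet_derivative (\<lambda>y. cmap d (F (cinv c y))) (at (cmap c p)) (v c)"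
    by (rule coord_compose_derivative[OF M M N smooth_map_id[OF M] F c b d, symmetric])
  finally show ?thesis .
qed

lemma differential_off_chart: "d \<notin> charts_at N (F p) \<Longrightarrow> differential M N F p v d = 0"
  by (simp add: differential_def)

lemma differential_mem:
  assumes M: "smooth_manifold M" and N: "smooth_manifold N" and F: "smooth_map M N F"
    and p: "p \<in> carr M" and v: "v \<in> tangent_space M p"
  shows "differential M N F p v \<in> tangent_space N (F p)"
proof -
  obtain c where c: "c \<in> charts_at M p" using chart_at_mem[OF M p] by blast
  show ?thesis
  proof (rule tangent_spaceI)
    fix d d' assume d: "d \<in> charts_at N (F p)" "d' \<in> charts_at N (F p)"
    show "differential M N F p v d' =
      frechet_derivative (\<lambda>y. cmap d' (cinv d y)) (at (cmap d (F p))) (differential M N F p v d)"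
      unfolding differential_coord[OF M N F c d(1) v] differential_coord[OF M N F c d(2) v]
      by (rule coord_compose_derivative[OF M N N F smooth_map_id[OF N] c d])
  qed (rule differential_off_chart)
qed

lemma differential_compose:
  assumes M: "smooth_manifold M" and N: "smooth_manifold N" and P: "smooth_manifold P"
    and F: "smooth_map M N F" and G: "smooth_map N P G"
    and p: "p \<in> carr M" and v: "v \<in> tangent_space M p"
  shows "differential M P (\<lambda>x. G (F x)) p v = differential N P G (F p) (differential M N F p v)"
proof
  fix d
  obtain c where c: "c \<in> charts_at M p" using chart_at_mem[OF M p] by blast
  obtain e where e: "e \<in> charts_at N (F p)" using chart_at_mem[OF N smooth_map_carr[OF F p]] by blast
  show "differential M P (\<lambda>x. G (F x)) p v d = differential N P G (F p) (differential M N F p v) d"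
  proof (cases "d \<in> charts_at P (G (F p))")
    case True
    show ?thesis
      using coord_compose_derivative[OF M N P F G c e True]
      by (simp add: differential_coord[OF M P smooth_map_compose[OF M N P F G] c True v]
          differential_coord[OF N P G e True differential_mem[OF M N F p v]]
          differential_coord[OF M N F c e v])
  qed (simp add: differential_off_chart)
qed

lemma differential_ident:
  assumes "smooth_manifold M" "p \<in> carr M" "v \<in> tangent_space M p"
  shows "differential M M (\<lambda>x. x) p v = v"
proof
  fix d
  have c: "chart_at M p \<in> charts_at M p" by (rule chart_at_mem[OF assms(1,2)])
  show "differential M M (\<lambda>x. x) p v d = v d"
  proof (cases "d \<in> charts_at M p")
    case True
    then show ?thesis using tangent_transition[OF assms(3) c]
      by (simp add: differential_coord[OF assms(1,1) smooth_map_id[OF assms(1)] c True assms(3)])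
  next
    case False
    then show ?thesis
      using differential_off_chart[of d M "\<lambda>x. x" p] tangent_off_chart[OF assms(3)] by simp
  qed
qed

lemma differential_cong:
  fixes M :: "('a, 'e::euclidean_space) mfd" and N :: "('b, 'f::euclidean_space) mfd"
  assumes M: "smooth_manifold M" and eq: "\<And>x. x \<in> carr M \<Longrightarrow> F x = G x" and p: "p \<in> carr M"
  shows "differential M N F p v = differential M N G p v"
proof
  fix d :: "('b, 'f) chart"
  let ?c = "chart_at M p"
  have c: "?c \<in> charts_at M p" by (rule chart_at_mem[OF M p])
  have "frechet_derivative (\<lambda>y. cmap d (F (cinv ?c y))) (at (cmap ?c p)) =
      frechet_derivative (\<lambda>y. cmap d (G (cinv ?c y))) (at (cmap ?c p))"
  proof (rule frechet_derivative_cong[OF chart_open[OF M charts_atD(1)[OF c]]])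
    show "cmap ?c p \<in> cmap ?c ` cdom ?c" using c by (simp add: charts_at_def)
    show "cmap d (F (cinv ?c y)) = cmap d (G (cinv ?c y))" if "y \<in> cmap ?c ` cdom ?c" for y
      using cinv_in[OF that] eq chart_dom_carr[OF M charts_atD(1)[OF c]] by (simp add: subset_iff)
  qed
  then show "differential M N F p v d = differential M N G p v d"
    by (simp add: differential_def comp_def Let_def eq[OF p])
qed

lemma differential_linear:
  assumes M: "smooth_manifold M" and N: "smooth_manifold N" and F: "smooth_map M N F"
    and p: "p \<in> carr M" and v: "v \<in> tangent_space M p"
  shows "w \<in> tangent_space M p \<Longrightarrow>
      differential M N F p (v + w) = differential M N F p v + differential M N F p w"
    and "differential M N F p (r *\<^sub>T v) = r *\<^sub>T differential M N F p v"
proof -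
  have c: "chart_at M p \<in> charts_at M p" by (rule chart_at_mem[OF M p])
  have lin: "linear (frechet_derivative (\<lambda>y. cmap d (F (cinv (chart_at M p) y))) (at (cmap (chart_at M p) p)))"
    if "d \<in> charts_at N (F p)" for d
    by (rule linear_frechet_derivative smooth_map_coord_differentiable[OF M F c that])+
  have eq: "differential M N F p u = (\<lambda>d. if d \<in> charts_at N (F p)
      then frechet_derivative (\<lambda>y. cmap d (F (cinv (chart_at M p) y))) (at (cmap (chart_at M p) p))
        (u (chart_at M p)) else 0)" for u
    unfolding differential_def comp_def Let_def by (rule refl)
  show "differential M N F p (v + w) = differential M N F p v + differential M N F p w"
    if "w \<in> tangent_space M p"
    unfolding eq by (rule ext) (simp add: linear_add[OF lin])
  show "differential M N F p (r *\<^sub>T v) = r *\<^sub>T differential M N F p v"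
    unfolding eq by (rule ext) (simp add: linear_cmul[OF lin])
qed

lemma dderiv_coord:
  assumes M: "smooth_manifold M" and u: "smooth_fun M W u" and W: "openin (mtop M) W" and p: "p \<in> W"
    and c: "c \<in> charts_at M p" and v: "v \<in> tangent_space M p"
  shows "dderiv M p v u = frechet_derivative (\<lambda>y. u (cinv c y)) (at (cmap c p)) (v c)"
proof -
  let ?b = "chart_at M p"
  have "p \<in> carr M" using c chart_dom_carr[OF M] by (auto simp: charts_at_def)
  then have b: "?b \<in> charts_at M p" by (rule chart_at_mem[OF M])
  note bA = charts_atD[OF b] and cA = charts_atD[OF c]
  let ?f = "\<lambda>y. cmap ?b (cinv c y)" and ?g = "\<lambda>y. u (cinv ?b y)"
  have cp: "cinv c (cmap c p) = p" using chart_cinv[OF M cA] .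
  have "(?f has_derivative frechet_derivative ?f (at (cmap c p))) (at (cmap c p))"
    using smooth_map_coord_differentiable[OF M smooth_map_id[OF M] c b] frechet_derivative_works by blast
  moreover have "(?g has_derivative frechet_derivative ?g (at (cmap ?b p))) (at (?f (cmap c p)))"
    unfolding cp
  proof (rule smooth_on_has_derivative)
    show "smooth_on (cmap ?b ` (cdom ?b \<inter> W)) ?g"
      using u bA(1) unfolding smooth_fun_def comp_def by blast
  qed (use bA p in auto)
  ultimately have "((\<lambda>y. ?g (?f y)) has_derivative (\<lambda>v. frechet_derivative ?g (at (cmap ?b p))
      (frechet_derivative ?f (at (cmap c p)) v))) (at (cmap c p))"
    by (rule has_derivative_compose)
  then have "((\<lambda>y. u (cinv c y)) has_derivative (\<lambda>v. frechet_derivative ?g (at (cmap ?b p))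
      (frechet_derivative ?f (at (cmap c p)) v))) (at (cmap c p))"
  proof (rule has_derivative_transform_within_open)
    show "open (cmap c ` (cdom c \<inter> cdom ?b))" by (rule transition_open[OF M cA(1) bA(1)])
    show "cmap c p \<in> cmap c ` (cdom c \<inter> cdom ?b)" using bA cA by blast
    show "?g (?f y) = u (cinv c y)" if "y \<in> cmap c ` (cdom c \<inter> cdom ?b)" for y
      using that chart_cinv[OF M bA(1)] chart_cinv[OF M cA(1)] by auto
  qed
  from frechet_derivative_at[OF this]
  show ?thesis unfolding dderiv_def Let_def comp_def
    using tangent_transition[OF v c b] by metis
qed

section \<open>Tensor fields in coordinates\<close>

definition coord_endo ::
  "('a, 'e::euclidean_space) mfd \<Rightarrow> ('a, 'e) chart \<Rightarrow> ('a, 'e) endo \<Rightarrow> 'e \<Rightarrow> 'e \<Rightarrow> 'e" where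
  "coord_endo M c A y w = A (cinv c y) (tvec M c (cinv c y) w) c"

definition coord_form ::
  "('a, 'e::euclidean_space) mfd \<Rightarrow> ('a, 'e) chart \<Rightarrow> ('a, 'e) form1 \<Rightarrow> 'e \<Rightarrow> 'e \<Rightarrow> real" where
  "coord_form M c \<theta> y w = \<theta> (cinv c y) (tvec M c (cinv c y) w)"

definition coord_form2 ::
  "('a, 'e::euclidean_space) mfd \<Rightarrow> ('a, 'e) chart \<Rightarrow> ('a, 'e) form2 \<Rightarrow> 'e \<Rightarrow> 'e \<Rightarrow> 'e \<Rightarrow> real" where
  "coord_form2 M c g y v w = g (cinv c y) (tvec M c (cinv c y) v) (tvec M c (cinv c y) w)"

definition smooth_bilin ::
  "'e::euclidean_space set \<Rightarrow> ('e \<Rightarrow> 'e \<Rightarrow> 'e \<Rightarrow> real) \<Rightarrow> bool" where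
  "smooth_bilin S g \<longleftrightarrow> (\<forall>v. smooth_lin S (\<lambda>y. g y v)) \<and> (\<forall>w. smooth_lin S (\<lambda>y v. g y v w))"

definition endo_tangent :: "('a, 'e::euclidean_space) mfd \<Rightarrow> ('a, 'e) endo \<Rightarrow> bool" where
  "endo_tangent M A \<longleftrightarrow> (\<forall>p\<in>carr M. \<forall>v\<in>tangent_space M p. A p v \<in> tangent_space M p)"

lemma cinv_charts_at: "c \<in> atlas M \<Longrightarrow> y \<in> cmap c ` cdom c \<Longrightarrow> c \<in> charts_at M (cinv c y)"
  by (simp add: charts_at_def cinv_in)

lemma cinv_carr: "smooth_manifold M \<Longrightarrow> c \<in> atlas M \<Longrightarrow> y \<in> cmap c ` cdom c \<Longrightarrow> cinv c y \<in> carr M"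
  by (rule subsetD[OF chart_dom_carr cinv_in])

lemma charts_at_carr: "smooth_manifold M \<Longrightarrow> c \<in> charts_at M p \<Longrightarrow> p \<in> carr M"
  by (rule subsetD[OF chart_dom_carr[OF _ charts_atD(1)] charts_atD(2)])

lemma vector_field_openin: "vector_field M W X \<Longrightarrow> openin (mtop M) W"
  by (simp add: vector_field_def)

lemma vector_field_mem: "vector_field M W X \<Longrightarrow> p \<in> W \<Longrightarrow> X p \<in> tangent_space M p"
  by (simp add: vector_field_def)

lemma vector_field_coord:
  "vector_field M W X \<Longrightarrow> c \<in> atlas M \<Longrightarrow> smooth_on (cmap c ` (cdom c \<inter> W)) (\<lambda>y. X (cinv c y) c)"
  by (simp add: vector_field_def)

lemma vector_field_carr: "vector_field M W X \<Longrightarrow> p \<in> W \<Longrightarrow> p \<in> carr M"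
  unfolding vector_field_def carr_def using openin_subset by blast

lemma vector_field_restrict:
  assumes "vector_field M W X" "openin (mtop M) V" "V \<subseteq> W"
  shows "vector_field M V X"
  unfolding vector_field_def
proof (intro conjI ballI)
  fix c assume "c \<in> atlas M"
  from vector_field_coord[OF assms(1) this]
  show "smooth_on (cmap c ` (cdom c \<inter> V)) (\<lambda>y. X (cinv c y) c)"
    by (rule smooth_on_subset) (use assms(3) in auto)
qed (use assms vector_field_mem[OF assms(1)] in auto)

lemma vector_field_tvec:
  assumes "smooth_manifold M" "vector_field M W X" "c \<in> charts_at M p" "p \<in> W"
  shows "tvec M c p (X p c) = X p"
  by (rule tangent_eq_tvec[OF assms(1,3) vector_field_mem[OF assms(2,4)]])

text \<open>The coordinate fields of a chart serve to read off coordinate identities from identities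
  between tensor fields.\<close>

lemma vector_field_const:
  assumes M: "smooth_manifold M" and c: "c \<in> atlas M"
  shows "vector_field M (cdom c) (\<lambda>p. tvec M c p w)"
  unfolding vector_field_def
proof (intro conjI ballI)
  show "openin (mtop M) (cdom c)" by (rule is_chart_dom[OF manifold_is_chart[OF M c]])
  show "tvec M c p w \<in> tangent_space M p" if "p \<in> cdom c" for p
    by (rule tvec_mem[OF M charts_atI[OF c that]])
  fix d assume d: "d \<in> atlas M"
  let ?S = "cmap d ` (cdom d \<inter> cdom c)" and ?T = "cmap c ` (cdom c \<inter> cdom d)"
  have "(\<lambda>y. cmap c (cinv d y)) ` ?S \<subseteq> ?T" using chart_cinv[OF M d] by auto
  from smooth_on_compose[OF transition_open[OF M d c] transition_open[OF M c d] this
      transition_smooth[OF M d c] smooth_on_deriv[OF transition_smooth[OF M c d], of w]]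
  have "smooth_on ?S (\<lambda>y. frechet_derivative (\<lambda>y. cmap d (cinv c y)) (at (cmap c (cinv d y))) w)" .
  then show "smooth_on ?S (\<lambda>y. tvec M c (cinv d y) w d)"
  proof (rule smooth_on_cong[OF transition_open[OF M d c], rotated])
    fix y assume "y \<in> ?S"
    then have "d \<in> charts_at M (cinv d y)" using chart_cinv[OF M d] d by (auto simp: charts_at_def)
    then show "frechet_derivative (\<lambda>y. cmap d (cinv c y)) (at (cmap c (cinv d y))) w =
      tvec M c (cinv d y) w d" by (simp add: tvec_def)
  qed
qed

lemma cmap_cinv_mem:
  "smooth_manifold M \<Longrightarrow> c \<in> atlas M \<Longrightarrow> y \<in> cmap c ` (cdom c \<inter> W) \<Longrightarrow>
    cinv c y \<in> W \<and> y \<in> cmap c ` cdom c \<and> c \<in> charts_at M (cinv c y)"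
  by (auto simp: charts_at_def chart_cinv)

lemma coord_endo_apply:
  assumes M: "smooth_manifold M" and X: "vector_field M W X" and c: "c \<in> atlas M"
    and y: "y \<in> cmap c ` (cdom c \<inter> W)"
  shows "A (cinv c y) (X (cinv c y)) c = coord_endo M c A y (X (cinv c y) c)"
  using vector_field_tvec[OF M X] cmap_cinv_mem[OF M c y] by (simp add: coord_endo_def)

lemma coord_form_apply:
  assumes M: "smooth_manifold M" and X: "vector_field M W X" and c: "c \<in> atlas M"
    and y: "y \<in> cmap c ` (cdom c \<inter> W)"
  shows "\<theta> (cinv c y) (X (cinv c y)) = coord_form M c \<theta> y (X (cinv c y) c)"
  using vector_field_tvec[OF M X] cmap_cinv_mem[OF M c y] by (simp add: coord_form_def)

lemma coord_form2_apply:
  assumes M: "smooth_manifold M" and X: "vector_field M W X" and Y: "vector_field M W Y"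
    and c: "c \<in> atlas M" and y: "y \<in> cmap c ` (cdom c \<inter> W)"
  shows "g (cinv c y) (X (cinv c y)) (Y (cinv c y)) =
    coord_form2 M c g y (X (cinv c y) c) (Y (cinv c y) c)"
  using vector_field_tvec[OF M X] vector_field_tvec[OF M Y] cmap_cinv_mem[OF M c y]
  by (simp add: coord_form2_def)

lemma coord_endo_tangent:
  assumes "smooth_manifold M" "c \<in> charts_at M p" "v \<in> tangent_space M p"
  shows "A p v c = coord_endo M c A (cmap c p) (v c)"
  using assms charts_atD[OF assms(2)] by (simp add: coord_endo_def chart_cinv tangent_eq_tvec)

lemma coord_form_tangent:
  assumes "smooth_manifold M" "c \<in> charts_at M p" "v \<in> tangent_space M p"
  shows "\<theta> p v = coord_form M c \<theta> (cmap c p) (v c)"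
  using assms charts_atD[OF assms(2)] by (simp add: coord_form_def chart_cinv tangent_eq_tvec)

lemma coord_form2_tangent:
  assumes "smooth_manifold M" "c \<in> charts_at M p" "v \<in> tangent_space M p" "w \<in> tangent_space M p"
  shows "g p v w = coord_form2 M c g (cmap c p) (v c) (w c)"
  using assms charts_atD[OF assms(2)] by (simp add: coord_form2_def chart_cinv tangent_eq_tvec)

subsection \<open>Smoothness and linearity in coordinates\<close>

lemma vector_field_endo:
  assumes M: "smooth_manifold M" and T: "endo_tangent M A"
    and S: "\<And>c. c \<in> atlas M \<Longrightarrow> smooth_lin (cmap c ` cdom c) (coord_endo M c A)"
    and X: "vector_field M W X"
  shows "vector_field M W (\<lambda>p. A p (X p))"
  unfolding vector_field_def
proof (intro conjI ballI)
  show "openin (mtop M) W" by (rule vector_field_openin[OF X])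
  show "A p (X p) \<in> tangent_space M p" if "p \<in> W" for p
    using T vector_field_mem[OF X that] vector_field_carr[OF X that] by (simp add: endo_tangent_def)
  fix c assume c: "c \<in> atlas M"
  have o: "open (cmap c ` (cdom c \<inter> W))" by (rule chart_open_Int[OF M c vector_field_openin[OF X]])
  have "smooth_on (cmap c ` (cdom c \<inter> W)) (\<lambda>y. coord_endo M c A y (X (cinv c y) c))"
    by (rule smooth_lin_apply[OF o smooth_lin_subset[OF S[OF c]] vector_field_coord[OF X c]]) auto
  then show "smooth_on (cmap c ` (cdom c \<inter> W)) (\<lambda>y. A (cinv c y) (X (cinv c y)) c)"
    by (rule smooth_on_cong[OF o, rotated]) (simp add: coord_endo_apply[OF M X c])
qed

lemma endomorphism_fieldI:
  assumes M: "smooth_manifold M" and T: "endo_tangent M A"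
    and S: "\<And>c. c \<in> atlas M \<Longrightarrow> smooth_lin (cmap c ` cdom c) (coord_endo M c A)"
  shows "endomorphism_field M A"
  unfolding endomorphism_field_def
proof (intro conjI ballI allI impI)
  fix p v assume p: "p \<in> carr M" and v: "v \<in> tangent_space M p"
  show Av: "A p v \<in> tangent_space M p" using T p v by (simp add: endo_tangent_def)
  let ?c = "chart_at M p"
  have c: "?c \<in> charts_at M p" by (rule chart_at_mem[OF M p])
  have lin: "linear (coord_endo M ?c A (cmap ?c p))"
    by (rule smooth_lin_linear[OF S]) (use c in \<open>auto simp: charts_at_def\<close>)
  show "A p (v + w) = A p v + A p w" if w: "w \<in> tangent_space M p" for w
  proof (rule tangent_eqI[OF M c])
    have Aw: "A p w \<in> tangent_space M p" using T p w by (simp add: endo_tangent_def)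
    show "A p v + A p w \<in> tangent_space M p" by (rule tangent_add[OF M Av Aw])
    show "A p (v + w) \<in> tangent_space M p"
      using T p tangent_add[OF M v w] by (simp add: endo_tangent_def)
    show "A p (v + w) ?c = (A p v + A p w) ?c"
      by (simp add: coord_endo_tangent[OF M c v] coord_endo_tangent[OF M c w]
          coord_endo_tangent[OF M c tangent_add[OF M v w]] linear_add[OF lin])
  qed
  show "A p (r *\<^sub>T v) = r *\<^sub>T A p v" for r
  proof (rule tangent_eqI[OF M c])
    show "r *\<^sub>T A p v \<in> tangent_space M p" by (rule tangent_scale[OF M Av])
    show "A p (r *\<^sub>T v) \<in> tangent_space M p"
      using T p tangent_scale[OF M v] by (simp add: endo_tangent_def)
    show "A p (r *\<^sub>T v) ?c = (r *\<^sub>T A p v) ?c"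
      by (simp add: coord_endo_tangent[OF M c v]
          coord_endo_tangent[OF M c tangent_scale[OF M v]] linear_cmul[OF lin])
  qed
qed (rule vector_field_endo[OF M T S])

lemma endomorphism_field_tangent: "endomorphism_field M A \<Longrightarrow> endo_tangent M A"
  unfolding endomorphism_field_def endo_tangent_def by blast

lemma endomorphism_field_coord:
  assumes M: "smooth_manifold M" and A: "endomorphism_field M A" and c: "c \<in> atlas M"
  shows "smooth_lin (cmap c ` cdom c) (coord_endo M c A)"
  unfolding smooth_lin_def
proof (intro conjI ballI allI)
  fix y assume y: "y \<in> cmap c ` cdom c"
  note cy = cinv_charts_at[OF c y] and py = cinv_carr[OF M c y]
  show "linear (coord_endo M c A y)"
  proof (rule linearI)
    show "coord_endo M c A y (v + w) = coord_endo M c A y v + coord_endo M c A y w" for v w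
      using A py tvec_mem[OF M cy] unfolding coord_endo_def endomorphism_field_def tvec_add[OF M cy]
      by simp
    show "coord_endo M c A y (r *\<^sub>R v) = r *\<^sub>R coord_endo M c A y v" for r v
      using A py tvec_mem[OF M cy] unfolding coord_endo_def endomorphism_field_def tvec_scale[OF M cy]
      by simp
  qed
next
  fix w
  have "vector_field M (cdom c) (\<lambda>p. A p (tvec M c p w))"
    using A vector_field_const[OF M c] unfolding endomorphism_field_def by blast
  from vector_field_coord[OF this c] show "smooth_on (cmap c ` cdom c) (\<lambda>y. coord_endo M c A y w)"
    by (simp add: coord_endo_def)
qed

lemma smooth_fun_form:
  assumes M: "smooth_manifold M"
    and S: "\<And>c. c \<in> atlas M \<Longrightarrow> smooth_lin (cmap c ` cdom c) (coord_form M c \<theta>)"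
    and X: "vector_field M W X"
  shows "smooth_fun M W (\<lambda>p. \<theta> p (X p))"
  unfolding smooth_fun_def comp_def
proof
  fix c assume c: "c \<in> atlas M"
  have o: "open (cmap c ` (cdom c \<inter> W))" by (rule chart_open_Int[OF M c vector_field_openin[OF X]])
  have "smooth_on (cmap c ` (cdom c \<inter> W)) (\<lambda>y. coord_form M c \<theta> y (X (cinv c y) c))"
    by (rule smooth_lin_apply[OF o smooth_lin_subset[OF S[OF c]] vector_field_coord[OF X c]]) auto
  then show "smooth_on (cmap c ` (cdom c \<inter> W)) (\<lambda>y. \<theta> (cinv c y) (X (cinv c y)))"
    by (rule smooth_on_cong[OF o, rotated]) (simp add: coord_form_apply[OF M X c])
qed

lemma one_formI:
  assumes M: "smooth_manifold M"
    and S: "\<And>c. c \<in> atlas M \<Longrightarrow> smooth_lin (cmap c ` cdom c) (coord_form M c \<theta>)"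
  shows "one_form M \<theta>"
  unfolding one_form_def linear_form_on_def
proof (intro conjI ballI allI impI)
  fix p v assume p: "p \<in> carr M" and v: "v \<in> tangent_space M p"
  let ?c = "chart_at M p"
  have c: "?c \<in> charts_at M p" by (rule chart_at_mem[OF M p])
  have lin: "linear (coord_form M ?c \<theta> (cmap ?c p))"
    by (rule smooth_lin_linear[OF S]) (use c in \<open>auto simp: charts_at_def\<close>)
  show "\<theta> p (v + w) = \<theta> p v + \<theta> p w" if w: "w \<in> tangent_space M p" for w
    by (simp add: coord_form_tangent[OF M c v] coord_form_tangent[OF M c w]
        coord_form_tangent[OF M c tangent_add[OF M v w]] linear_add[OF lin])
  show "\<theta> p (r *\<^sub>T v) = r * \<theta> p v" for r
    by (simp add: coord_form_tangent[OF M c v]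
        coord_form_tangent[OF M c tangent_scale[OF M v]] linear_cmul[OF lin])
qed (rule smooth_fun_form[OF M S])

lemma one_form_coord:
  assumes M: "smooth_manifold M" and A: "one_form M \<theta>" and c: "c \<in> atlas M"
  shows "smooth_lin (cmap c ` cdom c) (coord_form M c \<theta>)"
  unfolding smooth_lin_def
proof (intro conjI ballI allI)
  fix y assume y: "y \<in> cmap c ` cdom c"
  note cy = cinv_charts_at[OF c y] and py = cinv_carr[OF M c y]
  show "linear (coord_form M c \<theta> y)"
  proof (rule linearI)
    show "coord_form M c \<theta> y (v + w) = coord_form M c \<theta> y v + coord_form M c \<theta> y w" for v w
      using A py tvec_mem[OF M cy]
      unfolding coord_form_def one_form_def linear_form_on_def tvec_add[OF M cy] by simp
    show "coord_form M c \<theta> y (r *\<^sub>R v) = r *\<^sub>R coord_form M c \<theta> y v" for r v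
      using A py tvec_mem[OF M cy]
      unfolding coord_form_def one_form_def linear_form_on_def tvec_scale[OF M cy] by simp
  qed
next
  fix w
  have "smooth_fun M (cdom c) (\<lambda>p. \<theta> p (tvec M c p w))"
    using A vector_field_const[OF M c] unfolding one_form_def by blast
  then have "smooth_on (cmap c ` (cdom c \<inter> cdom c)) (\<lambda>y. \<theta> (cinv c y) (tvec M c (cinv c y) w))"
    using c unfolding smooth_fun_def comp_def by blast
  then show "smooth_on (cmap c ` cdom c) (\<lambda>y. coord_form M c \<theta> y w)"
    by (simp add: coord_form_def)
qed

lemma smooth_bilin_subset: "smooth_bilin S g \<Longrightarrow> T \<subseteq> S \<Longrightarrow> smooth_bilin T g"
  unfolding smooth_bilin_def by (auto intro: smooth_lin_subset[where S=S and T=T])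

lemma smooth_bilin_contract:
  assumes "open S" "smooth_bilin S g" "smooth_on S Y"
  shows "smooth_lin S (\<lambda>y v. g y v (Y y))"
  unfolding smooth_lin_def
proof (intro conjI ballI allI)
  show "linear (\<lambda>v. g y v (Y y))" if "y \<in> S" for y
    using assms(2) that by (simp add: smooth_bilin_def smooth_lin_def)
  show "smooth_on S (\<lambda>y. g y v (Y y))" for v
    using assms(2) by (intro smooth_lin_apply[OF assms(1) _ assms(3)]) (simp add: smooth_bilin_def)
qed

lemma smooth_fun_form2:
  assumes M: "smooth_manifold M"
    and S: "\<And>c. c \<in> atlas M \<Longrightarrow> smooth_bilin (cmap c ` cdom c) (coord_form2 M c g)"
    and X: "vector_field M W X" and Y: "vector_field M W Y"
  shows "smooth_fun M W (\<lambda>p. g p (X p) (Y p))"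
  unfolding smooth_fun_def comp_def
proof
  fix c assume c: "c \<in> atlas M"
  have o: "open (cmap c ` (cdom c \<inter> W))" by (rule chart_open_Int[OF M c vector_field_openin[OF X]])
  have "smooth_bilin (cmap c ` (cdom c \<inter> W)) (coord_form2 M c g)"
    by (rule smooth_bilin_subset[OF S[OF c]]) auto
  then have "smooth_on (cmap c ` (cdom c \<inter> W))
      (\<lambda>y. coord_form2 M c g y (X (cinv c y) c) (Y (cinv c y) c))"
    by (rule smooth_lin_apply[OF o smooth_bilin_contract[OF o _ vector_field_coord[OF Y c]]
          vector_field_coord[OF X c]])
  then show "smooth_on (cmap c ` (cdom c \<inter> W)) (\<lambda>y. g (cinv c y) (X (cinv c y)) (Y (cinv c y)))"
    by (rule smooth_on_cong[OF o, rotated]) (simp add: coord_form2_apply[OF M X Y c])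
qed

lemma riemannian_metricI:
  assumes M: "smooth_manifold M"
    and S: "\<And>c. c \<in> atlas M \<Longrightarrow> smooth_bilin (cmap c ` cdom c) (coord_form2 M c g)"
    and sym: "\<And>c y v w. c \<in> atlas M \<Longrightarrow> y \<in> cmap c ` cdom c \<Longrightarrow>
      coord_form2 M c g y v w = coord_form2 M c g y w v"
    and pos: "\<And>c y v. c \<in> atlas M \<Longrightarrow> y \<in> cmap c ` cdom c \<Longrightarrow> v \<noteq> 0 \<Longrightarrow> coord_form2 M c g y v v > 0"
  shows "riemannian_metric M g"
  unfolding riemannian_metric_def linear_form_on_def
proof (intro conjI ballI allI impI)
  fix p v assume p: "p \<in> carr M" and v: "v \<in> tangent_space M p"
  let ?c = "chart_at M p"
  have c: "?c \<in> charts_at M p" by (rule chart_at_mem[OF M p])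
  have cA: "?c \<in> atlas M" and y: "cmap ?c p \<in> cmap ?c ` cdom ?c" using c by (auto simp: charts_at_def)
  have lin: "linear (coord_form2 M ?c g (cmap ?c p) (v ?c))"
    by (rule smooth_lin_linear[OF _ y]) (use S[OF cA] in \<open>simp add: smooth_bilin_def\<close>)
  show "g p v (w + w') = g p v w + g p v w'"
    if w: "w \<in> tangent_space M p" and w': "w' \<in> tangent_space M p" for w w'
    by (simp add: coord_form2_tangent[OF M c v w] coord_form2_tangent[OF M c v w']
        coord_form2_tangent[OF M c v tangent_add[OF M w w']] linear_add[OF lin])
  show "g p v (r *\<^sub>T w) = r * g p v w" if w: "w \<in> tangent_space M p" for r w
    by (simp add: coord_form2_tangent[OF M c v w]
        coord_form2_tangent[OF M c v tangent_scale[OF M w]] linear_cmul[OF lin])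
  show "g p v w = g p w v" if w: "w \<in> tangent_space M p" for w
    using sym[OF cA y] by (simp add: coord_form2_tangent[OF M c v w] coord_form2_tangent[OF M c w v])
  show "g p v v > 0" if "v \<noteq> 0"
  proof -
    have "v ?c \<noteq> 0" using tangent_eqI[OF M c v tangent_zero[OF M]] that by auto
    then show ?thesis using pos[OF cA y] by (simp add: coord_form2_tangent[OF M c v v])
  qed
qed (erule conjE, rule smooth_fun_form2[OF M S])

lemma riemannian_metric_coord:
  assumes M: "smooth_manifold M" and g: "riemannian_metric M g" and c: "c \<in> atlas M"
  shows "smooth_bilin (cmap c ` cdom c) (coord_form2 M c g)"
    and "y \<in> cmap c ` cdom c \<Longrightarrow> coord_form2 M c g y v w = coord_form2 M c g y w v"
    and "y \<in> cmap c ` cdom c \<Longrightarrow> v \<noteq> 0 \<Longrightarrow> coord_form2 M c g y v v > 0"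
proof -
  show sym: "coord_form2 M c g y v w = coord_form2 M c g y w v" if y: "y \<in> cmap c ` cdom c" for y v w
    using g cinv_carr[OF M c y] tvec_mem[OF M cinv_charts_at[OF c y]]
    unfolding riemannian_metric_def coord_form2_def by blast
  show "coord_form2 M c g y v v > 0" if y: "y \<in> cmap c ` cdom c" and v: "v \<noteq> 0" for y v
  proof -
    note cy = cinv_charts_at[OF c y]
    have "tvec M c (cinv c y) v \<noteq> 0"
    proof
      assume "tvec M c (cinv c y) v = 0"
      then have "tvec M c (cinv c y) v c = 0" by simp
      then show False using v by (simp add: tvec_self[OF M cy])
    qed
    then show ?thesis using g cinv_carr[OF M c y] tvec_mem[OF M cy]
      by (simp add: riemannian_metric_def coord_form2_def)
  qed
  have sm: "smooth_on (cmap c ` cdom c) (\<lambda>y. coord_form2 M c g y v w)" for v w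
  proof -
    have "vector_field M W X \<Longrightarrow> vector_field M W Y \<Longrightarrow> smooth_fun M W (\<lambda>p. g p (X p) (Y p))" for W X Y
      using g by (simp add: riemannian_metric_def)
    from this[OF vector_field_const[OF M c] vector_field_const[OF M c]]
    have "smooth_fun M (cdom c) (\<lambda>p. g p (tvec M c p v) (tvec M c p w))" .
    then have "smooth_on (cmap c ` (cdom c \<inter> cdom c))
        (\<lambda>y. g (cinv c y) (tvec M c (cinv c y) v) (tvec M c (cinv c y) w))"
      using c unfolding smooth_fun_def comp_def by blast
    then show ?thesis by (simp add: coord_form2_def)
  qed
  have lin: "linear (coord_form2 M c g y v)" if y: "y \<in> cmap c ` cdom c" for y v
  proof (rule linearI)
    note cy = cinv_charts_at[OF c y] and py = cinv_carr[OF M c y]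
    show "coord_form2 M c g y v (w + w') = coord_form2 M c g y v w + coord_form2 M c g y v w'" for w w'
      using g py tvec_mem[OF M cy]
      unfolding coord_form2_def riemannian_metric_def linear_form_on_def tvec_add[OF M cy] by simp
    show "coord_form2 M c g y v (r *\<^sub>R w) = r *\<^sub>R coord_form2 M c g y v w" for r w
      using g py tvec_mem[OF M cy]
      unfolding coord_form2_def riemannian_metric_def linear_form_on_def tvec_scale[OF M cy] by simp
  qed
  have "linear (\<lambda>v. coord_form2 M c g y v w)" if y: "y \<in> cmap c ` cdom c" for y w
    using lin[OF y, of w] by (simp add: sym[OF y, of _ w])
  then show "smooth_bilin (cmap c ` cdom c) (coord_form2 M c g)"
    using sm lin by (simp add: smooth_bilin_def smooth_lin_def)
qed

subsection \<open>Brackets\<close>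

lemma lie_bracket_coord:
  "c \<in> charts_at M p \<Longrightarrow> lie_bracket M X Y p c =
    frechet_derivative (\<lambda>y. Y (cinv c y) c) (at (cmap c p)) (X p c)
    - frechet_derivative (\<lambda>y. X (cinv c y) c) (at (cmap c p)) (Y p c)"
  by (simp add: lie_bracket_def)

lemma vector_field_change_chart_derivative:
  assumes M: "smooth_manifold M" and Y: "vector_field M W Y" and p: "p \<in> W"
    and c: "c \<in> charts_at M p" and d: "d \<in> charts_at M p" and u: "u \<in> tangent_space M p"
  shows "frechet_derivative (\<lambda>y. Y (cinv d y) d) (at (cmap d p)) (u d) =
    frechet_derivative (\<lambda>z. frechet_derivative (\<lambda>y. cmap d (cinv c y)) (at z) (Y p c)) (at (cmap c p)) (u c)
    + frechet_derivative (\<lambda>y. cmap d (cinv c y)) (at (cmap c p))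
        (frechet_derivative (\<lambda>y. Y (cinv c y) c) (at (cmap c p)) (u c))"
proof -
  note cA = charts_atD[OF c] and dA = charts_atD[OF d]
  let ?\<psi> = "\<lambda>y. cmap d (cinv c y)"
  let ?S = "cmap c ` (cdom c \<inter> (cdom d \<inter> W))"
  have oW: "openin (mtop M) (cdom d \<inter> W)"
    by (intro openin_Int is_chart_dom[OF manifold_is_chart[OF M dA(1)]] vector_field_openin[OF Y])
  have oS: "open ?S" by (rule chart_open_Int[OF M cA(1) oW])
  have yS: "cmap c p \<in> ?S" using cA dA p by auto
  have inv: "cinv c (cmap c p) = p" using chart_cinv[OF M cA] .
  have sub: "?S \<subseteq> cmap c ` (cdom c \<inter> cdom d)" "?S \<subseteq> cmap c ` (cdom c \<inter> W)" by auto
  have s\<psi>: "smooth_on ?S ?\<psi>" by (rule smooth_on_subset[OF transition_smooth[OF M cA(1) dA(1)] sub(1)])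
  have sY: "smooth_on ?S (\<lambda>y. Y (cinv c y) c)"
    by (rule smooth_on_subset[OF vector_field_coord[OF Y cA(1)] sub(2)])
  have sYd: "smooth_on (cmap d ` (cdom d \<inter> W)) (\<lambda>y. Y (cinv d y) d)"
    by (rule vector_field_coord[OF Y dA(1)])
  have lin: "smooth_lin ?S (\<lambda>z. frechet_derivative ?\<psi> (at z))"
    unfolding smooth_lin_def
    by (intro conjI ballI allI smooth_on_deriv[OF s\<psi>] linear_frechet_derivative
        smooth_on_differentiable[OF s\<psi>])
  have eq: "frechet_derivative ?\<psi> (at z) (Y (cinv c z) c) = Y (cinv d (?\<psi> z)) d" if z: "z \<in> ?S" for z
  proof -
    have zc: "cinv c z \<in> cdom c \<inter> (cdom d \<inter> W)" "cmap c (cinv c z) = z"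
      using z chart_cinv[OF M cA(1)] by auto
    have ch: "c \<in> charts_at M (cinv c z)" "d \<in> charts_at M (cinv c z)"
      using zc cA dA by (auto simp: charts_at_def)
    show ?thesis
      using tangent_transition[OF vector_field_mem[OF Y] ch, symmetric] zc chart_cinv[OF M dA(1)]
      by simp
  qed
  have "(?\<psi> has_derivative frechet_derivative ?\<psi> (at (cmap c p))) (at (cmap c p))"
    by (rule smooth_on_has_derivative[OF s\<psi> yS])
  moreover have "((\<lambda>y. Y (cinv d y) d) has_derivative frechet_derivative (\<lambda>y. Y (cinv d y) d) (at (cmap d p)))
      (at (?\<psi> (cmap c p)))"
    unfolding inv by (rule smooth_on_has_derivative[OF sYd]) (use dA p in auto)
  ultimately have "((\<lambda>y. Y (cinv d (?\<psi> y)) d) has_derivative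
      (\<lambda>v. frechet_derivative (\<lambda>y. Y (cinv d y) d) (at (cmap d p)) (frechet_derivative ?\<psi> (at (cmap c p)) v)))
      (at (cmap c p))"
    by (rule has_derivative_compose)
  from frechet_derivative_at[OF this]
  have "frechet_derivative (\<lambda>y. Y (cinv d y) d) (at (cmap d p)) (u d) =
    frechet_derivative (\<lambda>y. Y (cinv d (?\<psi> y)) d) (at (cmap c p)) (u c)"
    using tangent_transition[OF u c d] by metis
  also have "frechet_derivative (\<lambda>y. Y (cinv d (?\<psi> y)) d) (at (cmap c p)) =
    frechet_derivative (\<lambda>z. frechet_derivative ?\<psi> (at z) (Y (cinv c z) c)) (at (cmap c p))"
    by (rule frechet_derivative_cong[OF oS yS]) (rule eq[symmetric])
  also have "\<dots> (u c) = coord_deriv (\<lambda>z. frechet_derivative ?\<psi> (at z)) (cmap c p) (u c) (Y (cinv c (cmap c p)) c)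
    + frechet_derivative ?\<psi> (at (cmap c p)) (frechet_derivative (\<lambda>y. Y (cinv c y) c) (at (cmap c p)) (u c))"
    by (rule smooth_lin_derivative[OF oS lin yS smooth_on_differentiable[OF sY yS]])
  finally show ?thesis by (simp add: coord_deriv_def inv)
qed

text \<open>Under a change of charts each half of the coordinate formula for \<open>[X, Y]\<close> acquires a term with the
  second derivative of the change of charts. It is symmetric in \<open>X\<close> and \<open>Y\<close> and cancels in the difference.\<close>

lemma lie_bracket_mem:
  assumes M: "smooth_manifold M" and X: "vector_field M W X" and Y: "vector_field M W Y" and p: "p \<in> W"
  shows "lie_bracket M X Y p \<in> tangent_space M p"
proof (rule tangent_spaceI)
  fix c d assume c: "c \<in> charts_at M p" and d: "d \<in> charts_at M p"
  note cA = charts_atD[OF c] and dA = charts_atD[OF d]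
  let ?\<psi> = "\<lambda>y. cmap d (cinv c y)"
  have sym: "frechet_derivative (\<lambda>z. frechet_derivative ?\<psi> (at z) (Y p c)) (at (cmap c p)) (X p c) =
    frechet_derivative (\<lambda>z. frechet_derivative ?\<psi> (at z) (X p c)) (at (cmap c p)) (Y p c)"
    by (rule symmetric_second_derivative[OF transition_open[OF M cA(1) dA(1)]
          transition_smooth[OF M cA(1) dA(1)]]) (use cA dA in auto)
  show "lie_bracket M X Y p d = frechet_derivative ?\<psi> (at (cmap c p)) (lie_bracket M X Y p c)"
    unfolding lie_bracket_coord[OF c] lie_bracket_coord[OF d]
      vector_field_change_chart_derivative[OF M Y p c d vector_field_mem[OF X p]]
      vector_field_change_chart_derivative[OF M X p c d vector_field_mem[OF Y p]]
    by (simp add: sym linear_diff[OF transition_linear[OF M c d]])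
qed (simp add: lie_bracket_def)

subsection \<open>Brackets, exterior derivatives and Nijenhuis tensors in coordinates\<close>

text \<open>The invariant formulas for \<open>N\<^sub>A\<close>, \<open>d\<theta>\<close> and \<open>d\<omega>\<close>, evaluated on vector fields with constant
  components, whose brackets vanish.\<close>

definition coord_nijenhuis ::
  "('e::euclidean_space \<Rightarrow> 'e \<Rightarrow> 'e) \<Rightarrow> 'e \<Rightarrow> 'e \<Rightarrow> 'e \<Rightarrow> 'e" where
  "coord_nijenhuis A y v w = coord_deriv A y (A y v) w - coord_deriv A y (A y w) v
     - A y (coord_deriv A y v w - coord_deriv A y w v)"

definition coord_d1 :: "('e::euclidean_space \<Rightarrow> 'e \<Rightarrow> real) \<Rightarrow> 'e \<Rightarrow> 'e \<Rightarrow> 'e \<Rightarrow> real" where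
  "coord_d1 \<theta> y v w = coord_deriv \<theta> y v w - coord_deriv \<theta> y w v"

definition coord_d2 ::
  "('e::euclidean_space \<Rightarrow> 'e \<Rightarrow> 'e \<Rightarrow> real) \<Rightarrow> 'e \<Rightarrow> 'e \<Rightarrow> 'e \<Rightarrow> 'e \<Rightarrow> real" where
  "coord_d2 \<omega> y u v w = coord_deriv (\<lambda>z. \<omega> z v) y u w - coord_deriv (\<lambda>z. \<omega> z u) y v w
     + coord_deriv (\<lambda>z. \<omega> z u) y w v"

lemma smooth_lin_compose:
  assumes "open S" "smooth_lin S \<theta>" "smooth_lin S J"
  shows "smooth_lin S (\<lambda>y v. \<theta> y (J y v))"
  unfolding smooth_lin_def
proof (intro conjI ballI allI)
  show "linear (\<lambda>v. \<theta> y (J y v))" if "y \<in> S" for y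
    using linear_compose[OF smooth_lin_linear[OF assms(3) that] smooth_lin_linear[OF assms(2) that]]
    by (simp add: comp_def)
  show "smooth_on S (\<lambda>y. \<theta> y (J y w))" for w
    by (rule smooth_lin_apply[OF assms(1,2)]) (use assms(3) in \<open>simp add: smooth_lin_def\<close>)
qed

lemma smooth_lin_uminus:
  "open S \<Longrightarrow> smooth_lin S \<theta> \<Longrightarrow> smooth_lin S (\<lambda>y v. - \<theta> y v)"
  unfolding smooth_lin_def by (simp add: smooth_on_uminus linear_compose_neg)

lemma smooth_bilinD1: "smooth_bilin S g \<Longrightarrow> smooth_lin S (\<lambda>y. g y v)"
  by (simp add: smooth_bilin_def)

lemma smooth_bilinD2: "smooth_bilin S g \<Longrightarrow> smooth_lin S (\<lambda>y v. g y v w)"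
  by (simp add: smooth_bilin_def)

lemma smooth_bilin_compose:
  assumes "open S" "smooth_bilin S g" "smooth_lin S J"
  shows "smooth_bilin S (\<lambda>y v w. g y v (J y w))"
  unfolding smooth_bilin_def
proof (intro conjI allI)
  show "smooth_lin S (\<lambda>y w. g y v (J y w))" for v
    by (rule smooth_lin_compose[OF assms(1) smooth_bilinD1[OF assms(2)] assms(3)])
  show "smooth_lin S (\<lambda>y v. g y v (J y w))" for w
    by (rule smooth_bilin_contract[OF assms(1,2)]) (use assms(3) in \<open>simp add: smooth_lin_def\<close>)
qed

lemma smooth_bilin_derivative:
  assumes S: "open S" and g: "smooth_bilin S g" and y: "y \<in> S"
    and X: "smooth_on S X" and Y: "smooth_on S Y"
  shows "frechet_derivative (\<lambda>z. g z (X z) (Y z)) (at y) v =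
    coord_deriv (\<lambda>z. g z (X y)) y v (Y y) + g y (frechet_derivative X (at y) v) (Y y)
    + g y (X y) (frechet_derivative Y (at y) v)"
  using smooth_lin_derivative[OF S smooth_bilin_contract[OF S g Y] y smooth_on_differentiable[OF X y], of v]
    smooth_lin_derivative[OF S smooth_bilinD1[OF g] y smooth_on_differentiable[OF Y y], of "X y" v]
  by (simp add: coord_deriv_def[of "\<lambda>y v. g y v (Y y)"])

lemma coord_d1_cong:
  assumes "open S" "y \<in> S" "\<And>z w. z \<in> S \<Longrightarrow> \<theta> z w = \<theta>' z w"
  shows "coord_d1 \<theta> y v w = coord_d1 \<theta>' y v w"
  unfolding coord_d1_def
  using coord_deriv_cong[OF assms(1,2), of \<theta> v \<theta>' w] coord_deriv_cong[OF assms(1,2), of \<theta> w \<theta>' v]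
  by (simp add: assms(3))

lemma coord_d2_cong:
  assumes "open S" "y \<in> S" "\<And>z v w. z \<in> S \<Longrightarrow> \<omega> z v w = \<omega>' z v w"
  shows "coord_d2 \<omega> y u v w = coord_d2 \<omega>' y u v w"
proof -
  have "coord_deriv (\<lambda>z. \<omega> z a) y b c = coord_deriv (\<lambda>z. \<omega>' z a) y b c" for a b c
    by (rule coord_deriv_cong[OF assms(1,2)]) (rule assms(3))
  then show ?thesis by (simp add: coord_d2_def)
qed

lemma coord_nijenhuis_cong:
  assumes "open S" "y \<in> S" "\<And>z w. z \<in> S \<Longrightarrow> A z w = B z w"
  shows "coord_nijenhuis A y v w = coord_nijenhuis B y v w"
proof -
  have "coord_deriv A y a b = coord_deriv B y a b" for a b
    by (rule coord_deriv_cong[OF assms(1,2)]) (rule assms(3))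
  then show ?thesis by (simp add: coord_nijenhuis_def assms(2,3))
qed

context
  fixes M :: "('a, 'e::euclidean_space) mfd" and W p c
  assumes M: "smooth_manifold M" and p: "p \<in> W" and c: "c \<in> charts_at M p"
begin

lemma coord_mem: "cmap c p \<in> cmap c ` (cdom c \<inter> W)" "cinv c (cmap c p) = p"
  using charts_atD[OF c] p chart_cinv[OF M] by auto

lemma coord_open_W: "vector_field M W X \<Longrightarrow> open (cmap c ` (cdom c \<inter> W))"
  by (rule chart_open_Int[OF M charts_atD(1)[OF c] vector_field_openin])

lemma endo_field_derivative:
  assumes A: "smooth_lin (cmap c ` cdom c) (coord_endo M c A)" and X: "vector_field M W X"
  shows "frechet_derivative (\<lambda>y. A (cinv c y) (X (cinv c y)) c) (at (cmap c p)) v =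
    coord_deriv (coord_endo M c A) (cmap c p) v (X p c)
    + coord_endo M c A (cmap c p) (frechet_derivative (\<lambda>y. X (cinv c y) c) (at (cmap c p)) v)"
proof -
  note cA = charts_atD(1)[OF c]
  note o = coord_open_W[OF X]
  have "frechet_derivative (\<lambda>y. A (cinv c y) (X (cinv c y)) c) (at (cmap c p)) =
    frechet_derivative (\<lambda>y. coord_endo M c A y (X (cinv c y) c)) (at (cmap c p))"
    by (rule frechet_derivative_cong[OF o coord_mem(1)]) (rule coord_endo_apply[OF M X cA])
  moreover have "smooth_lin (cmap c ` (cdom c \<inter> W)) (coord_endo M c A)"
    by (rule smooth_lin_subset[OF A]) auto
  ultimately show ?thesis
    using smooth_lin_derivative[OF o _ coord_mem(1)
        smooth_on_differentiable[OF vector_field_coord[OF X cA] coord_mem(1)], of "coord_endo M c A" v]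
    by (simp add: coord_mem(2))
qed

lemma form_field_derivative:
  assumes A: "smooth_lin (cmap c ` cdom c) (coord_form M c \<theta>)" and X: "vector_field M W X"
  shows "frechet_derivative (\<lambda>y. \<theta> (cinv c y) (X (cinv c y))) (at (cmap c p)) v =
    coord_deriv (coord_form M c \<theta>) (cmap c p) v (X p c)
    + coord_form M c \<theta> (cmap c p) (frechet_derivative (\<lambda>y. X (cinv c y) c) (at (cmap c p)) v)"
proof -
  note cA = charts_atD(1)[OF c]
  note o = coord_open_W[OF X]
  have "frechet_derivative (\<lambda>y. \<theta> (cinv c y) (X (cinv c y))) (at (cmap c p)) =
    frechet_derivative (\<lambda>y. coord_form M c \<theta> y (X (cinv c y) c)) (at (cmap c p))"
    by (rule frechet_derivative_cong[OF o coord_mem(1)]) (rule coord_form_apply[OF M X cA])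
  moreover have "smooth_lin (cmap c ` (cdom c \<inter> W)) (coord_form M c \<theta>)"
    by (rule smooth_lin_subset[OF A]) auto
  ultimately show ?thesis
    using smooth_lin_derivative[OF o _ coord_mem(1)
        smooth_on_differentiable[OF vector_field_coord[OF X cA] coord_mem(1)], of "coord_form M c \<theta>" v]
    by (simp add: coord_mem(2))
qed

lemma form2_field_derivative:
  assumes A: "smooth_bilin (cmap c ` cdom c) (coord_form2 M c g)"
    and X: "vector_field M W X" and Y: "vector_field M W Y"
  shows "frechet_derivative (\<lambda>y. g (cinv c y) (X (cinv c y)) (Y (cinv c y))) (at (cmap c p)) v =
    coord_deriv (\<lambda>z. coord_form2 M c g z (X p c)) (cmap c p) v (Y p c)
    + coord_form2 M c g (cmap c p) (frechet_derivative (\<lambda>y. X (cinv c y) c) (at (cmap c p)) v) (Y p c)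
    + coord_form2 M c g (cmap c p) (X p c) (frechet_derivative (\<lambda>y. Y (cinv c y) c) (at (cmap c p)) v)"
proof -
  note cA = charts_atD(1)[OF c]
  note o = coord_open_W[OF X]
  have "frechet_derivative (\<lambda>y. g (cinv c y) (X (cinv c y)) (Y (cinv c y))) (at (cmap c p)) =
    frechet_derivative (\<lambda>y. coord_form2 M c g y (X (cinv c y) c) (Y (cinv c y) c)) (at (cmap c p))"
    by (rule frechet_derivative_cong[OF o coord_mem(1)]) (rule coord_form2_apply[OF M X Y cA])
  moreover have "smooth_bilin (cmap c ` (cdom c \<inter> W)) (coord_form2 M c g)"
    by (rule smooth_bilin_subset[OF A]) auto
  ultimately show ?thesis
    using smooth_bilin_derivative[OF o _ coord_mem(1) vector_field_coord[OF X cA]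
        vector_field_coord[OF Y cA], of "coord_form2 M c g" v]
    by (simp add: coord_mem(2))
qed

text \<open>Tensoriality: the derivatives of the components of \<open>X\<close> and \<open>Y\<close> cancel, by linearity of \<open>A\<close>. The same happens
  for exterior derivatives; in the case of a 2-form it is a consequence of its being alternating.\<close>

lemma nijenhuis_coord:
  assumes T: "endo_tangent M A"
    and S: "\<And>c. c \<in> atlas M \<Longrightarrow> smooth_lin (cmap c ` cdom c) (coord_endo M c A)"
    and X: "vector_field M W X" and Y: "vector_field M W Y"
  shows "nijenhuis M A X Y p \<in> tangent_space M p"
    and "nijenhuis M A X Y p c = coord_nijenhuis (coord_endo M c A) (cmap c p) (X p c) (Y p c)"
proof -
  note cA = charts_atD[OF c]
  note AX = vector_field_endo[OF M T S X] and AY = vector_field_endo[OF M T S Y]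
  note XY = lie_bracket_mem[OF M X Y p] and AXY = lie_bracket_mem[OF M AX Y p]
    and XAY = lie_bracket_mem[OF M X AY p] and AXAY = lie_bracket_mem[OF M AX AY p]
  have pc: "p \<in> carr M" by (rule vector_field_carr[OF X p])
  have At: "A p v \<in> tangent_space M p" if "v \<in> tangent_space M p" for v
    using T pc that by (simp add: endo_tangent_def)
  note sum = tangent_add[OF M AXY XAY]
  show "nijenhuis M A X Y p \<in> tangent_space M p"
    unfolding nijenhuis_def
    by (intro tangent_add[OF M] tangent_diff[OF M] At XY AXY XAY AXAY)
  have lin: "linear (coord_endo M c A (cmap c p))"
    by (rule smooth_lin_linear[OF S]) (use cA in auto)
  note d = endo_field_derivative[OF S[OF cA(1)]]
  show "nijenhuis M A X Y p c = coord_nijenhuis (coord_endo M c A) (cmap c p) (X p c) (Y p c)"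
    unfolding nijenhuis_def coord_nijenhuis_def
    by (simp add: coord_endo_tangent[OF M c At[OF XY]] coord_endo_tangent[OF M c XY]
        coord_endo_tangent[OF M c sum] lie_bracket_coord[OF c] d[OF X] d[OF Y]
        coord_endo_tangent[OF M c vector_field_mem[OF X p]]
        coord_endo_tangent[OF M c vector_field_mem[OF Y p]]
        linear_add[OF lin] linear_diff[OF lin])
qed

lemma ext_deriv1_coord:
  assumes S: "\<And>c. c \<in> atlas M \<Longrightarrow> smooth_lin (cmap c ` cdom c) (coord_form M c \<theta>)"
    and X: "vector_field M W X" and Y: "vector_field M W Y"
  shows "ext_deriv1 M \<theta> X Y p = coord_d1 (coord_form M c \<theta>) (cmap c p) (X p c) (Y p c)"
proof -
  note cA = charts_atD[OF c]
  have lin: "linear (coord_form M c \<theta> (cmap c p))"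
    by (rule smooth_lin_linear[OF S]) (use cA in auto)
  note d = form_field_derivative[OF S[OF cA(1)]]
  have sf: "smooth_fun M W (\<lambda>p. \<theta> p (X p))" if "vector_field M W X" for X
    by (rule smooth_fun_form[OF M S that])
  note dd = dderiv_coord[OF M sf _ p c]
  note oW = vector_field_openin[OF X]
  show ?thesis
    unfolding ext_deriv1_def coord_d1_def
    by (simp add: dd[OF Y oW vector_field_mem[OF X p]] dd[OF X oW vector_field_mem[OF Y p]]
        d[OF X] d[OF Y] coord_form_tangent[OF M c lie_bracket_mem[OF M X Y p]]
        lie_bracket_coord[OF c] linear_diff[OF lin])
qed

lemma ext_deriv2_coord:
  assumes S: "\<And>c. c \<in> atlas M \<Longrightarrow> smooth_bilin (cmap c ` cdom c) (coord_form2 M c \<omega>)"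
    and alt: "\<And>v w. coord_form2 M c \<omega> (cmap c p) v w = - coord_form2 M c \<omega> (cmap c p) w v"
    and X: "vector_field M W X" and Y: "vector_field M W Y" and Z: "vector_field M W Z"
  shows "ext_deriv2 M \<omega> X Y Z p = coord_d2 (coord_form2 M c \<omega>) (cmap c p) (X p c) (Y p c) (Z p c)"
proof -
  note cA = charts_atD[OF c]
  let ?\<omega> = "coord_form2 M c \<omega> (cmap c p)"
  have y: "cmap c p \<in> cmap c ` cdom c" using cA by auto
  have lin: "linear (?\<omega> v)" "linear (\<lambda>v. ?\<omega> v w)" for v w
    using smooth_lin_linear[OF smooth_bilinD1[OF S[OF cA(1)]] y]
      smooth_lin_linear[OF smooth_bilinD2[OF S[OF cA(1)]] y] by auto
  note d = form2_field_derivative[OF S[OF cA(1)]]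
  have sf: "smooth_fun M W (\<lambda>p. \<omega> p (X p) (Y p))" if "vector_field M W X" "vector_field M W Y" for X Y
    by (rule smooth_fun_form2[OF M S that])
  note dd = dderiv_coord[OF M sf vector_field_openin[OF X] p c]
  note tX = vector_field_mem[OF X p] and tY = vector_field_mem[OF Y p] and tZ = vector_field_mem[OF Z p]
  note f = coord_form2_tangent[OF M c]
  let ?d = "\<lambda>X v. frechet_derivative (\<lambda>y. X (cinv c y) c) (at (cmap c p)) v"
  have a: "?\<omega> (Y p c) (?d Z (X p c)) = - ?\<omega> (?d Z (X p c)) (Y p c)"
    "?\<omega> (X p c) (?d Z (Y p c)) = - ?\<omega> (?d Z (Y p c)) (X p c)"
    "?\<omega> (X p c) (?d Y (Z p c)) = - ?\<omega> (?d Y (Z p c)) (X p c)"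
    by (rule alt)+
  show ?thesis
    unfolding ext_deriv2_def coord_d2_def dd[OF Y Z tX] dd[OF X Z tY] dd[OF X Y tZ]
      d[OF Y Z] d[OF X Z] d[OF X Y] f[OF lie_bracket_mem[OF M X Y p] tZ]
      f[OF lie_bracket_mem[OF M X Z p] tY] f[OF lie_bracket_mem[OF M Y Z p] tX]
      lie_bracket_coord[OF c] linear_diff[OF lin(2)] a
    by simp
qed

end

lemma coord_form_compose:
  assumes "smooth_manifold M" "endo_tangent M J" "c \<in> atlas M" "y \<in> cmap c ` cdom c"
  shows "coord_form M c (\<lambda>p v. - \<theta> p (J p v)) y v = - coord_form M c \<theta> y (coord_endo M c J y v)"
proof -
  note cy = cinv_charts_at[OF assms(3,4)] and py = cinv_carr[OF assms(1,3,4)]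
  have "J (cinv c y) (tvec M c (cinv c y) v) \<in> tangent_space M (cinv c y)"
    using assms(2) py tvec_mem[OF assms(1) cy] by (simp add: endo_tangent_def)
  from tangent_eq_tvec[OF assms(1) cy this] show ?thesis by (simp add: coord_form_def coord_endo_def)
qed

lemma coord_fundamental_form:
  assumes "smooth_manifold M" "endo_tangent M J" "c \<in> atlas M" "y \<in> cmap c ` cdom c"
  shows "coord_form2 M c (fundamental_form g J) y v w = coord_form2 M c g y v (coord_endo M c J y w)"
proof -
  note cy = cinv_charts_at[OF assms(3,4)] and py = cinv_carr[OF assms(1,3,4)]
  have "J (cinv c y) (tvec M c (cinv c y) w) \<in> tangent_space M (cinv c y)"
    using assms(2) py tvec_mem[OF assms(1) cy] by (simp add: endo_tangent_def)
  from tangent_eq_tvec[OF assms(1) cy this] show ?thesis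
    by (simp add: coord_form2_def coord_endo_def fundamental_form_def)
qed

lemma smooth_bilin_cong:
  assumes "open S" "smooth_bilin S g" "\<And>y v w. y \<in> S \<Longrightarrow> g y v w = g' y v w"
  shows "smooth_bilin S g'"
  unfolding smooth_bilin_def
proof (intro conjI allI)
  show "smooth_lin S (\<lambda>y. g' y v)" for v
    by (rule smooth_lin_cong[OF assms(1) smooth_bilinD1[OF assms(2)]]) (rule assms(3))
  show "smooth_lin S (\<lambda>y v. g' y v w)" for w
    by (rule smooth_lin_cong[OF assms(1) smooth_bilinD2[OF assms(2)]]) (rule assms(3))
qed

section \<open>Quasi-Vaisman and quasi-Sasakian structures in coordinates\<close>

text \<open>The vector \<open>u\<close> stands for the dual field of \<open>\<theta>\<close>, taken to have constant components. This covers the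
  field \<open>\<partial>/\<partial>t\<close> and reduces Lie derivatives along it to directional derivatives.\<close>

definition quasi_vaisman_coords ::
  "'e::euclidean_space set \<Rightarrow> ('e \<Rightarrow> 'e \<Rightarrow> 'e) \<Rightarrow> ('e \<Rightarrow> 'e \<Rightarrow> 'e \<Rightarrow> real) \<Rightarrow> ('e \<Rightarrow> 'e \<Rightarrow> real) \<Rightarrow>
   'e \<Rightarrow> bool" where
  "quasi_vaisman_coords S J g \<theta> u \<longleftrightarrow>
     smooth_lin S J \<and> smooth_bilin S g \<and> smooth_lin S \<theta> \<and>
     (\<forall>y\<in>S. \<forall>v w.
        J y (J y v) = - v \<and> coord_nijenhuis J y v w = 0 \<and>
        g y v w = g y w v \<and> (v \<noteq> 0 \<longrightarrow> g y v v > 0) \<and> g y (J y v) (J y w) = g y v w \<and>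
        coord_d1 \<theta> y v w = 0 \<and> g y u v = \<theta> y v \<and> g y u u = 1 \<and>
        coord_deriv (\<lambda>z. g z v) y u w = 0 \<and> coord_deriv J y u w = 0 \<and>
        (\<forall>x. coord_d2 (\<lambda>y v w. g y v (J y w)) y v w x =
           coord_d1 (\<lambda>y v. - \<theta> y (J y v)) y v w * \<theta> y x
           + coord_d1 (\<lambda>y v. - \<theta> y (J y v)) y w x * \<theta> y v
           + coord_d1 (\<lambda>y v. - \<theta> y (J y v)) y x v * \<theta> y w))"

text \<open>If the components of \<open>U\<close> are constant, then \<open>[U, X]\<close> is the derivative of the components of \<open>X\<close>
  along \<open>U\<close>. The Killing condition and \<open>L\<^sub>U J = 0\<close> thus say that the components of \<open>g\<close> and \<open>J\<close> do not
  change in the direction of \<open>U\<close>.\<close>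

theorem quasi_vaismanI:
  fixes M :: "('a, 'e::euclidean_space) mfd"
  assumes M: "smooth_manifold M" and T: "endo_tangent M J"
    and U: "\<And>p. p \<in> carr M \<Longrightarrow> U p \<in> tangent_space M p"
    and Uc: "\<And>p c. c \<in> charts_at M p \<Longrightarrow> U p c = u"
    and Q: "\<And>c. c \<in> atlas M \<Longrightarrow> quasi_vaisman_coords (cmap c ` cdom c)
      (coord_endo M c J) (coord_form2 M c g) (coord_form M c \<theta>) u"
  shows "quasi_vaisman M J g \<theta>"
proof -
  have SJ: "smooth_lin (cmap c ` cdom c) (coord_endo M c J)"
    and Sg: "smooth_bilin (cmap c ` cdom c) (coord_form2 M c g)"
    and S\<theta>: "smooth_lin (cmap c ` cdom c) (coord_form M c \<theta>)" if "c \<in> atlas M" for c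
    using Q[OF that] by (simp_all add: quasi_vaisman_coords_def)
  note QD = Q[unfolded quasi_vaisman_coords_def, THEN conjunct2, THEN conjunct2, THEN conjunct2,
      rule_format]
  have atp: "\<exists>c. c \<in> charts_at M p" if "p \<in> carr M" for p using chart_at_mem[OF M that] by blast
  have cy: "c \<in> atlas M" "cmap c p \<in> cmap c ` cdom c" if "c \<in> charts_at M p" for c p
    using charts_atD[OF that] by auto
  have JT: "J p v \<in> tangent_space M p" if "p \<in> carr M" "v \<in> tangent_space M p" for p v
    using T that by (simp add: endo_tangent_def)
  have o: "open (cmap c ` cdom c)" if "c \<in> atlas M" for c by (rule chart_open[OF M that])
  have UV: "vector_field M (carr M) U"
    unfolding vector_field_def
  proof (intro conjI ballI)
    fix c assume c: "c \<in> atlas M"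
    have dom: "cdom c \<inter> carr M = cdom c" using chart_dom_carr[OF M c] by auto
    show "smooth_on (cmap c ` (cdom c \<inter> carr M)) (\<lambda>y. U (cinv c y) c)"
      unfolding dom
      by (rule smooth_on_cong[OF o[OF c] _ smooth_on_const[of _ u]])
        (simp add: Uc[OF cinv_charts_at[OF c]])
  qed (auto simp: U carr_def)
  have UW: "vector_field M W U" if "vector_field M W X" for W X
    by (rule vector_field_restrict[OF UV vector_field_openin[OF that]])
      (use vector_field_carr[OF that] in auto)
  have UX: "lie_bracket M U X p c = frechet_derivative (\<lambda>y. X (cinv c y) c) (at (cmap c p)) u"
    if c: "c \<in> charts_at M p" for X p c
  proof -
    have "frechet_derivative (\<lambda>y. U (cinv c y) c) (at (cmap c p)) =
        frechet_derivative (\<lambda>y. u) (at (cmap c p))"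
      by (rule frechet_derivative_cong[OF o[OF cy(1)[OF c]] cy(2)[OF c]])
        (rule Uc[OF cinv_charts_at[OF cy(1)[OF c]]])
    then show ?thesis by (simp add: lie_bracket_coord[OF c] Uc[OF c])
  qed
  have "endomorphism_field M J" by (rule endomorphism_fieldI[OF M T SJ])
  moreover have "J p (J p v) = - v" if p: "p \<in> carr M" and v: "v \<in> tangent_space M p" for p v
  proof -
    obtain c where c: "c \<in> charts_at M p" using atp[OF p] by blast
    show ?thesis
      by (rule tangent_eqI[OF M c JT[OF p JT[OF p v]] tangent_minus[OF M v]])
        (use QD[OF cy[OF c]] in \<open>simp add: coord_endo_tangent[OF M c JT[OF p v]] coord_endo_tangent[OF M c v]\<close>)
  qed
  moreover have "nijenhuis M J X Y p = 0"
    if X: "vector_field M W X" and Y: "vector_field M W Y" and p: "p \<in> W" for W X Y p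
  proof -
    obtain c where c: "c \<in> charts_at M p" using atp[OF vector_field_carr[OF X p]] by blast
    have "coord_nijenhuis (coord_endo M c J) (cmap c p) (X p c) (Y p c) = 0"
      using QD[OF cy[OF c]] by simp
    then have "nijenhuis M J X Y p c = 0"
      by (simp only: nijenhuis_coord(2)[OF M p c T SJ X Y])
    then show ?thesis
      by (intro tangent_eqI[OF M c nijenhuis_coord(1)[OF M p c T SJ X Y] tangent_zero[OF M]]) simp_all
  qed
  moreover have "riemannian_metric M g"
    by (rule riemannian_metricI[OF M Sg]) (use QD in auto)
  moreover have "g p (J p v) (J p w) = g p v w"
    if p: "p \<in> carr M" and v: "v \<in> tangent_space M p" and w: "w \<in> tangent_space M p" for p v w
  proof -
    obtain c where c: "c \<in> charts_at M p" using atp[OF p] by blast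
    show ?thesis using QD[OF cy[OF c]]
      by (simp add: coord_form2_tangent[OF M c JT[OF p v] JT[OF p w]] coord_form2_tangent[OF M c v w]
          coord_endo_tangent[OF M c v] coord_endo_tangent[OF M c w])
  qed
  ultimately have herm: "hermitian_structure M J g"
    unfolding hermitian_structure_def integrable_almost_complex_def by blast
  have oneform: "one_form M \<theta>" by (rule one_formI[OF M S\<theta>])
  have closed: "ext_deriv1 M \<theta> X Y p = 0"
    if X: "vector_field M W X" and Y: "vector_field M W Y" and p: "p \<in> W" for W X Y p
  proof -
    obtain c where c: "c \<in> charts_at M p" using atp[OF vector_field_carr[OF X p]] by blast
    show ?thesis using QD[OF cy[OF c]] by (simp add: ext_deriv1_coord[OF M p c S\<theta> X Y])
  qed
  have dual: "metric_dual M g \<theta> U"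
    unfolding metric_dual_def
  proof (intro conjI ballI UV)
    fix p v assume p: "p \<in> carr M" and v: "v \<in> tangent_space M p"
    obtain c where c: "c \<in> charts_at M p" using atp[OF p] by blast
    show "g p (U p) v = \<theta> p v" using QD[OF cy[OF c]]
      by (simp add: coord_form2_tangent[OF M c U[OF p] v] coord_form_tangent[OF M c v] Uc[OF c])
  qed
  have unit: "g p (U p) (U p) = 1" if p: "p \<in> carr M" for p
  proof -
    obtain c where c: "c \<in> charts_at M p" using atp[OF p] by blast
    have "coord_form2 M c g (cmap c p) u u = 1" using QD[OF cy[OF c]] by blast
    then show ?thesis by (simp only: coord_form2_tangent[OF M c U[OF p] U[OF p]] Uc[OF c])
  qed
  have killing: "killing_field M g U"
    unfolding killing_field_def
  proof (intro allI impI ballI, elim conjE)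
    fix W X Y p assume X: "vector_field M W X" and Y: "vector_field M W Y" and p: "p \<in> W"
    have pc: "p \<in> carr M" by (rule vector_field_carr[OF X p])
    obtain c where c: "c \<in> charts_at M p" using atp[OF pc] by blast
    have sf: "smooth_fun M W (\<lambda>p. g p (X p) (Y p))" by (rule smooth_fun_form2[OF M Sg X Y])
    show "dderiv M p (U p) (\<lambda>x. g x (X x) (Y x)) - g p (lie_bracket M U X p) (Y p)
      - g p (X p) (lie_bracket M U Y p) = 0"
      unfolding dderiv_coord[OF M sf vector_field_openin[OF X] p c U[OF pc]] Uc[OF c]
        form2_field_derivative[OF M p c Sg[OF cy(1)[OF c]] X Y]
        coord_form2_tangent[OF M c lie_bracket_mem[OF M UW[OF X] X p] vector_field_mem[OF Y p]]
        coord_form2_tangent[OF M c vector_field_mem[OF X p] lie_bracket_mem[OF M UW[OF X] Y p]]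
        UX[OF c]
      using QD[OF cy[OF c]] by simp
  qed
  have lieJ: "lie_deriv_endo_zero M J U"
    unfolding lie_deriv_endo_zero_def
  proof (intro allI impI ballI)
    fix W X p assume X: "vector_field M W X" and p: "p \<in> W"
    have pc: "p \<in> carr M" by (rule vector_field_carr[OF X p])
    obtain c where c: "c \<in> charts_at M p" using atp[OF pc] by blast
    have JX: "vector_field M W (\<lambda>p. J p (X p))" by (rule vector_field_endo[OF M T SJ X])
    note b1 = lie_bracket_mem[OF M UW[OF X] X p] and b2 = lie_bracket_mem[OF M UW[OF X] JX p]
    have z: "coord_deriv (coord_endo M c J) (cmap c p) u (X p c) = 0" using QD[OF cy[OF c]] by blast
    show "lie_bracket M U (\<lambda>x. J x (X x)) p - J p (lie_bracket M U X p) = 0"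
    proof (rule tangent_eqI[OF M c tangent_diff[OF M b2 JT[OF pc b1]] tangent_zero[OF M]])
      show "(lie_bracket M U (\<lambda>x. J x (X x)) p - J p (lie_bracket M U X p)) c = 0 c"
        unfolding fun_diff_def coord_endo_tangent[OF M c b1] UX[OF c]
          endo_field_derivative[OF M p c SJ[OF cy(1)[OF c]] X]
        using z by simp
    qed
  qed
  have d\<Omega>: "ext_deriv2 M (fundamental_form g J) X Y Z p =
      ext_deriv1 M (\<lambda>p v. - \<theta> p (J p v)) X Y p * \<theta> p (Z p)
      + ext_deriv1 M (\<lambda>p v. - \<theta> p (J p v)) Y Z p * \<theta> p (X p)
      + ext_deriv1 M (\<lambda>p v. - \<theta> p (J p v)) Z X p * \<theta> p (Y p)"
    if X: "vector_field M W X" and Y: "vector_field M W Y" and Z: "vector_field M W Z" and p: "p \<in> W"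
    for W X Y Z p
  proof -
    obtain c where c: "c \<in> charts_at M p" using atp[OF vector_field_carr[OF X p]] by blast
    let ?J = "coord_endo M c J" and ?g = "coord_form2 M c g" and ?\<theta> = "coord_form M c \<theta>"
    note d = QD[OF cy[OF c]]
    have S\<Omega>: "smooth_bilin (cmap c ` cdom c) (coord_form2 M c (fundamental_form g J))"
      if c: "c \<in> atlas M" for c
      by (rule smooth_bilin_cong[OF o[OF c] smooth_bilin_compose[OF o[OF c] Sg[OF c] SJ[OF c]]])
        (rule coord_fundamental_form[OF M T c, symmetric])
    have S\<eta>: "smooth_lin (cmap c ` cdom c) (coord_form M c (\<lambda>p v. - \<theta> p (J p v)))"
      if c: "c \<in> atlas M" for c
      by (rule smooth_lin_cong[OF o[OF c] smooth_lin_uminus[OF o[OF c]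
              smooth_lin_compose[OF o[OF c] S\<theta>[OF c] SJ[OF c]]]])
        (rule coord_form_compose[OF M T c, symmetric])
    have alt: "coord_form2 M c (fundamental_form g J) (cmap c p) v w =
        - coord_form2 M c (fundamental_form g J) (cmap c p) w v" for v w
    proof -
      have lin: "linear (\<lambda>v. ?g (cmap c p) v w)"
        by (rule smooth_lin_linear[OF smooth_bilinD2[OF Sg[OF cy(1)[OF c]]] cy(2)[OF c]])
      have "?g (cmap c p) v (?J (cmap c p) w) =
          ?g (cmap c p) (?J (cmap c p) v) (?J (cmap c p) (?J (cmap c p) w))"
        using d by metis
      also have "\<dots> = ?g (cmap c p) (- w) (?J (cmap c p) v)" using d by metis
      also have "\<dots> = - ?g (cmap c p) w (?J (cmap c p) v)"
        by (rule linear_neg[OF smooth_lin_linear[OF smooth_bilinD2[OF Sg[OF cy(1)[OF c]]] cy(2)[OF c]]])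
      finally show ?thesis by (simp add: coord_fundamental_form[OF M T cy[OF c]])
    qed
    have e\<Omega>: "coord_d2 (coord_form2 M c (fundamental_form g J)) (cmap c p) a b e =
        coord_d2 (\<lambda>y v w. ?g y v (?J y w)) (cmap c p) a b e" for a b e
      by (rule coord_d2_cong[OF o[OF cy(1)[OF c]] cy(2)[OF c]])
        (rule coord_fundamental_form[OF M T cy(1)[OF c]])
    have e\<eta>: "coord_d1 (coord_form M c (\<lambda>p v. - \<theta> p (J p v))) (cmap c p) a b =
        coord_d1 (\<lambda>y v. - ?\<theta> y (?J y v)) (cmap c p) a b" for a b
      by (rule coord_d1_cong[OF o[OF cy(1)[OF c]] cy(2)[OF c]])
        (rule coord_form_compose[OF M T cy(1)[OF c]])
    have E2: "ext_deriv2 M (fundamental_form g J) X Y Z p =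
        coord_d2 (coord_form2 M c (fundamental_form g J)) (cmap c p) (X p c) (Y p c) (Z p c)"
      by (rule ext_deriv2_coord[OF M p c S\<Omega> alt X Y Z])
    have E1: "ext_deriv1 M (\<lambda>p v. - \<theta> p (J p v)) X Y p =
        coord_d1 (coord_form M c (\<lambda>p v. - \<theta> p (J p v))) (cmap c p) (X p c) (Y p c)"
      if "vector_field M W X" "vector_field M W Y" for X Y
      by (rule ext_deriv1_coord[OF M p c S\<eta> that])
    show ?thesis
      unfolding E2 E1[OF X Y] E1[OF Y Z] E1[OF Z X] e\<Omega> e\<eta>
        coord_form_tangent[OF M c vector_field_mem[OF X p]]
        coord_form_tangent[OF M c vector_field_mem[OF Y p]]
        coord_form_tangent[OF M c vector_field_mem[OF Z p]]
      using d[of "X p c" "Y p c"] by (elim conjE allE[of _ "Z p c"])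
  qed
  show ?thesis
    unfolding quasi_vaisman_def Let_def
    using herm oneform closed dual unit killing lieJ d\<Omega> by blast
qed

lemma quasi_vaisman_coords_restrict:
  assumes Q: "quasi_vaisman_coords S J g \<theta> u" and T: "open T" "T \<subseteq> S"
    and J: "\<And>y v. y \<in> T \<Longrightarrow> J y v = J' y v" and g: "\<And>y v w. y \<in> T \<Longrightarrow> g y v w = g' y v w"
    and \<theta>: "\<And>y v. y \<in> T \<Longrightarrow> \<theta> y v = \<theta>' y v"
  shows "quasi_vaisman_coords T J' g' \<theta>' u"
  unfolding quasi_vaisman_coords_def
proof (intro conjI ballI)
  note QD = Q[unfolded quasi_vaisman_coords_def]
  show "smooth_lin T J'" "smooth_lin T \<theta>'"
    using smooth_lin_cong[OF T(1) smooth_lin_subset[OF _ T(2)]] QD J \<theta> by blast+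
  show "smooth_bilin T g'"
    using smooth_bilin_cong[OF T(1) smooth_bilin_subset[OF _ T(2)]] QD g by blast
  fix y assume y: "y \<in> T"
  then have yS: "y \<in> S" using T(2) by blast
  have e1: "coord_nijenhuis J y v w = coord_nijenhuis J' y v w" for v w
    by (rule coord_nijenhuis_cong[OF T(1) y J])
  have e2: "coord_d1 \<theta> y v w = coord_d1 \<theta>' y v w" for v w
    by (rule coord_d1_cong[OF T(1) y \<theta>])
  have e3: "coord_d1 (\<lambda>y v. - \<theta> y (J y v)) y v w = coord_d1 (\<lambda>y v. - \<theta>' y (J' y v)) y v w" for v w
    by (rule coord_d1_cong[OF T(1) y]) (simp add: J \<theta>)
  have e4: "coord_d2 (\<lambda>y v w. g y v (J y w)) y v w x = coord_d2 (\<lambda>y v w. g' y v (J' y w)) y v w x" for v w x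
    by (rule coord_d2_cong[OF T(1) y]) (simp add: J g)
  have e5: "coord_deriv (\<lambda>z. g z v) y u w = coord_deriv (\<lambda>z. g' z v) y u w" for v w
    by (rule coord_deriv_cong[OF T(1) y]) (rule g)
  have e6: "coord_deriv J y u w = coord_deriv J' y u w" for w
    by (rule coord_deriv_cong[OF T(1) y]) (rule J)
  show "\<forall>v w.
        J' y (J' y v) = - v \<and> coord_nijenhuis J' y v w = 0 \<and>
        g' y v w = g' y w v \<and> (v \<noteq> 0 \<longrightarrow> g' y v v > 0) \<and> g' y (J' y v) (J' y w) = g' y v w \<and>
        coord_d1 \<theta>' y v w = 0 \<and> g' y u v = \<theta>' y v \<and> g' y u u = 1 \<and>
        coord_deriv (\<lambda>z. g' z v) y u w = 0 \<and> coord_deriv J' y u w = 0 \<and>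
        (\<forall>x. coord_d2 (\<lambda>y v w. g' y v (J' y w)) y v w x =
           coord_d1 (\<lambda>y v. - \<theta>' y (J' y v)) y v w * \<theta>' y x
           + coord_d1 (\<lambda>y v. - \<theta>' y (J' y v)) y w x * \<theta>' y v
           + coord_d1 (\<lambda>y v. - \<theta>' y (J' y v)) y x v * \<theta>' y w)"
    using bspec[OF QD[THEN conjunct2, THEN conjunct2, THEN conjunct2] yS]
    unfolding e1 e2 e3 e4 e5 e6 J[OF y] g[OF y] \<theta>[OF y] .
qed

definition quasi_sasakian_coords ::
  "'e::euclidean_space set \<Rightarrow> ('e \<Rightarrow> 'e \<Rightarrow> 'e) \<Rightarrow> ('e \<Rightarrow> 'e) \<Rightarrow> ('e \<Rightarrow> 'e \<Rightarrow> real) \<Rightarrow>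
   ('e \<Rightarrow> 'e \<Rightarrow> 'e \<Rightarrow> real) \<Rightarrow> bool" where
  "quasi_sasakian_coords S \<phi> \<xi> \<eta> h \<longleftrightarrow>
     smooth_lin S \<phi> \<and> smooth_on S \<xi> \<and> smooth_lin S \<eta> \<and> smooth_bilin S h \<and>
     (\<forall>y\<in>S. \<forall>v w.
        \<eta> y (\<xi> y) = 1 \<and> \<phi> y (\<phi> y v) = - v + \<eta> y v *\<^sub>R \<xi> y \<and>
        h y v w = h y w v \<and> (v \<noteq> 0 \<longrightarrow> h y v v > 0) \<and>
        h y (\<phi> y v) (\<phi> y w) = h y v w - \<eta> y v * \<eta> y w \<and>
        coord_nijenhuis \<phi> y v w + coord_d1 \<eta> y v w *\<^sub>R \<xi> y = 0 \<and>
        (\<forall>x. coord_d2 (\<lambda>y v w. h y v (\<phi> y w)) y v w x = 0))"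

text \<open>Computing \<open>\<phi>\<^sup>3 \<xi>\<close> in two ways shows that \<open>\<phi> \<xi> = r \<xi>\<close> with \<open>r\<^sup>2 = 0\<close>; then \<open>\<phi>\<^sup>3 v\<close>, computed in two ways,
  gives \<open>\<eta> (\<phi> v) \<xi> = 0\<close>.\<close>

lemma almost_contact_linear:
  fixes \<phi> :: "'e::euclidean_space \<Rightarrow> 'e" and \<eta> :: "'e \<Rightarrow> real"
  assumes lin: "linear \<phi>" "linear \<eta>" and \<xi>: "\<eta> \<xi> = 1" and \<phi>2: "\<And>v. \<phi> (\<phi> v) = - v + \<eta> v *\<^sub>R \<xi>"
  shows "\<phi> \<xi> = 0" and "\<eta> (\<phi> v) = 0"
proof -
  have \<xi>0: "\<xi> \<noteq> 0" using \<xi> linear_0[OF lin(2)] by auto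
  have \<phi>\<phi>\<xi>: "\<phi> (\<phi> \<xi>) = 0" using \<phi>2[of \<xi>] \<xi> by simp
  have "0 = - \<phi> \<xi> + \<eta> (\<phi> \<xi>) *\<^sub>R \<xi>" using \<phi>2[of "\<phi> \<xi>"] \<phi>\<phi>\<xi> linear_0[OF lin(1)] by simp
  then have e: "\<phi> \<xi> = \<eta> (\<phi> \<xi>) *\<^sub>R \<xi>" by (simp add: algebra_simps)
  have "0 = \<phi> (\<eta> (\<phi> \<xi>) *\<^sub>R \<xi>)" using e \<phi>\<phi>\<xi> by metis
  also have "\<dots> = \<eta> (\<phi> \<xi>) *\<^sub>R (\<eta> (\<phi> \<xi>) *\<^sub>R \<xi>)" using linear_cmul[OF lin(1)] e by metis
  finally have "\<eta> (\<phi> \<xi>) = 0" using \<xi>0 by simp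
  then show 0: "\<phi> \<xi> = 0" using e by simp
  have "\<phi> (\<phi> (\<phi> v)) = - \<phi> v"
    using \<phi>2[of v] 0 by (simp add: linear_diff[OF lin(1)] linear_cmul[OF lin(1)])
  then have "\<eta> (\<phi> v) *\<^sub>R \<xi> = 0" using \<phi>2[of "\<phi> v"] by simp
  then show "\<eta> (\<phi> v) = 0" using \<xi>0 by simp
qed

text \<open>The coordinate identities are the given ones evaluated on coordinate fields. For the
  fundamental form this needs it to be alternating, that is, \<open>\<phi>\<close> to be skew-symmetric.\<close>

lemma quasi_sasakian_coordsI:
  assumes M: "smooth_manifold M" and Q: "quasi_sasakian M \<phi> \<xi> \<eta> h" and c: "c \<in> atlas M"
  shows "quasi_sasakian_coords (cmap c ` cdom c) (coord_endo M c \<phi>) (\<lambda>y. \<xi> (cinv c y) c)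
    (coord_form M c \<eta>) (coord_form2 M c h)"
proof -
  have endo: "endomorphism_field M \<phi>" and V: "vector_field M (carr M) \<xi>" and of: "one_form M \<eta>"
    and rm: "riemannian_metric M h"
    and \<eta>\<xi>: "\<And>p. p \<in> carr M \<Longrightarrow> \<eta> p (\<xi> p) = 1"
    and \<phi>\<phi>: "\<And>p v. p \<in> carr M \<Longrightarrow> v \<in> tangent_space M p \<Longrightarrow> \<phi> p (\<phi> p v) = - v + \<eta> p v *\<^sub>T \<xi> p"
    and h\<phi>: "\<And>p v w. p \<in> carr M \<Longrightarrow> v \<in> tangent_space M p \<Longrightarrow> w \<in> tangent_space M p \<Longrightarrow>
      h p (\<phi> p v) (\<phi> p w) = h p v w - \<eta> p v * \<eta> p w"
    using Q by (simp_all add: quasi_sasakian_def almost_contact_metric_def)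
  have N: "\<And>W X Y p. vector_field M W X \<Longrightarrow> vector_field M W Y \<Longrightarrow> p \<in> W \<Longrightarrow>
      nijenhuis M \<phi> X Y p + ext_deriv1 M \<eta> X Y p *\<^sub>T \<xi> p = 0"
    and d\<Phi>: "\<And>W X Y Z p. vector_field M W X \<Longrightarrow> vector_field M W Y \<Longrightarrow> vector_field M W Z \<Longrightarrow> p \<in> W \<Longrightarrow>
      ext_deriv2 M (fundamental_form h \<phi>) X Y Z p = 0"
    using Q by (simp_all add: quasi_sasakian_def)
  note T = endomorphism_field_tangent[OF endo]
  note S\<phi> = endomorphism_field_coord[OF M endo] and S\<eta> = one_form_coord[OF M of]
    and Sh = riemannian_metric_coord(1)[OF M rm]
  have o: "open (cmap c ` cdom c)" if "c \<in> atlas M" for c by (rule chart_open[OF M that])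
  have S\<xi>: "smooth_on (cmap c ` cdom c) (\<lambda>y. \<xi> (cinv c y) c)"
    by (rule smooth_on_subset[OF vector_field_coord[OF V c]]) (use chart_dom_carr[OF M c] in auto)
  let ?\<phi> = "coord_endo M c \<phi>" and ?\<eta> = "coord_form M c \<eta>" and ?h = "coord_form2 M c h"
  have pt: "?\<eta> y (\<xi> (cinv c y) c) = 1 \<and> ?\<phi> y (?\<phi> y v) = - v + ?\<eta> y v *\<^sub>R \<xi> (cinv c y) c \<and>
      ?h y (?\<phi> y v) (?\<phi> y w) = ?h y v w - ?\<eta> y v * ?\<eta> y w \<and>
      coord_nijenhuis ?\<phi> y v w + coord_d1 ?\<eta> y v w *\<^sub>R \<xi> (cinv c y) c = 0 \<and>
      coord_d2 (\<lambda>y v w. ?h y v (?\<phi> y w)) y v w x = 0"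
    if y: "y \<in> cmap c ` cdom c" for y v w x
  proof -
    let ?p = "cinv c y" and ?V = "\<lambda>v p. tvec M c p v"
    note cp = cinv_charts_at[OF c y] and pM = cinv_carr[OF M c y] and pc = cinv_in[OF y]
    have cy: "cmap c ?p = y" by (rule cmap_cinv[OF y])
    note F = vector_field_const[OF M c] and t = tvec_mem[OF M cp] and s = tvec_self[OF M cp]
    have \<phi>T: "\<phi> ?p v \<in> tangent_space M ?p" if "v \<in> tangent_space M ?p" for v
      using T pM that by (simp add: endo_tangent_def)
    have 1: "?\<eta> y (\<xi> ?p c) = 1"
      using \<eta>\<xi>[OF pM] coord_form_tangent[OF M cp vector_field_mem[OF V pM], of \<eta>] by (simp add: cy)
    have 2: "?\<phi> y (?\<phi> y v) = - v + ?\<eta> y v *\<^sub>R \<xi> ?p c" for v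
      using arg_cong[OF \<phi>\<phi>[OF pM t[of v]], of "\<lambda>u. u c"]
      by (simp add: coord_endo_tangent[OF M cp \<phi>T[OF t]] coord_endo_tangent[OF M cp t]
          coord_form_tangent[OF M cp t] cy s)
    have 3: "?h y (?\<phi> y v) (?\<phi> y w) = ?h y v w - ?\<eta> y v * ?\<eta> y w" for v w
      using h\<phi>[OF pM t[of v] t[of w]]
      by (simp add: coord_form2_tangent[OF M cp \<phi>T[OF t] \<phi>T[OF t]] coord_endo_tangent[OF M cp t]
          coord_form2_tangent[OF M cp t t] coord_form_tangent[OF M cp t] cy s)
    have 4: "coord_nijenhuis ?\<phi> y v w + coord_d1 ?\<eta> y v w *\<^sub>R \<xi> ?p c = 0"
      using arg_cong[OF N[OF F[of v] F[of w] pc], of "\<lambda>u. u c"]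
      by (simp add: nijenhuis_coord(2)[OF M pc cp T S\<phi> F F] ext_deriv1_coord[OF M pc cp S\<eta> F F] cy s)
    have S\<Phi>: "smooth_bilin (cmap c ` cdom c) (coord_form2 M c (fundamental_form h \<phi>))"
      if c: "c \<in> atlas M" for c
      by (rule smooth_bilin_cong[OF o[OF c] smooth_bilin_compose[OF o[OF c] Sh[OF c] S\<phi>[OF c]]])
        (rule coord_fundamental_form[OF M T c, symmetric])
    have lin: "linear (?\<phi> y)" "linear (?\<eta> y)" "linear (?h y v)" for v
      using smooth_lin_linear[OF S\<phi>[OF c] y] smooth_lin_linear[OF S\<eta>[OF c] y]
        smooth_lin_linear[OF smooth_bilinD1[OF Sh[OF c]] y] by auto
    note ac = almost_contact_linear[OF lin(1,2) 1 2]
    note hs = riemannian_metric_coord(2)[OF M rm c y]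
    have skew: "?h y v (?\<phi> y w) = - ?h y w (?\<phi> y v)" for v w
    proof -
      have "?h y (?\<phi> y v) (\<xi> ?p c) = 0"
        using 3[of "?\<phi> y v" "\<xi> ?p c"] by (simp add: ac 1 linear_0[OF lin(3)])
      moreover have "?h y v (?\<phi> y w) = ?h y (?\<phi> y v) (?\<phi> y (?\<phi> y w))" using 3[of v "?\<phi> y w"] ac by simp
      ultimately show ?thesis
        by (simp add: 2 linear_diff[OF lin(3)] linear_cmul[OF lin(3)] hs[of w])
    qed
    have alt: "coord_form2 M c (fundamental_form h \<phi>) (cmap c ?p) v w =
        - coord_form2 M c (fundamental_form h \<phi>) (cmap c ?p) w v" for v w
      unfolding cy coord_fundamental_form[OF M T c y] by (rule skew)
    have "coord_d2 (\<lambda>y v w. ?h y v (?\<phi> y w)) y v w x =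
        coord_d2 (coord_form2 M c (fundamental_form h \<phi>)) y v w x"
      by (rule coord_d2_cong[OF o[OF c] y]) (rule coord_fundamental_form[OF M T c, symmetric])
    also have "\<dots> = 0"
      using d\<Phi>[OF F[of v] F[of w] F[of x] pc]
      by (simp add: ext_deriv2_coord[OF M pc cp S\<Phi> alt F F F] cy s)
    finally show ?thesis using 1 2 3 4 by blast
  qed
  show ?thesis
    unfolding quasi_sasakian_coords_def
  proof (intro conjI ballI allI impI S\<phi>[OF c] S\<xi> S\<eta>[OF c] Sh[OF c])
    fix y v w x assume y: "y \<in> cmap c ` cdom c"
    show "?h y v w = ?h y w v" by (rule riemannian_metric_coord(2)[OF M rm c y])
    show "v \<noteq> 0 \<Longrightarrow> ?h y v v > 0" by (rule riemannian_metric_coord(3)[OF M rm c y])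
  qed (use pt in simp_all)
qed

section \<open>From normal almost contact structures to complex structures\<close>

text \<open>Here \<open>D\<phi>\<close>, \<open>D\<xi>\<close>, \<open>D\<eta>\<close> are the derivatives of the components at a point, related by the differentiated
  identities \<open>\<eta> \<xi> = 1\<close>, \<open>\<phi> \<xi> = 0\<close> and \<open>\<eta> \<circ> \<phi> = 0\<close>, and \<open>L v = (L\<^sub>\<xi> \<phi>) v\<close> is the left-hand side of the second
  conclusion. Normality with \<open>w = \<xi>\<close> says that \<open>\<phi> (L v) + d\<eta>(v, \<xi>) \<xi> = 0\<close>. Its \<open>\<eta>\<close>-component is the first
  conclusion; what remains is \<open>\<phi> (L v) = 0\<close>, and \<open>\<eta> (L v) = d\<eta>(\<phi> v, \<xi>)\<close> vanishes as well. The \<open>\<eta>\<close>-component of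
  normality in general is \<open>d\<eta>(\<phi> v, \<phi> w) = d\<eta>(v, w)\<close>, which yields the third conclusion with \<open>\<phi> v\<close> for \<open>v\<close>.\<close>

lemma normal_almost_contact_consequences:
  fixes \<phi> :: "'e::euclidean_space \<Rightarrow> 'e" and \<eta> :: "'e \<Rightarrow> real" and D\<xi> :: "'e \<Rightarrow> 'e"
  assumes lin: "linear \<phi>" "linear \<eta>" "\<And>w. linear (\<lambda>v. D\<phi> v w)" "\<And>w. linear (\<lambda>v. D\<eta> v w)" "\<And>u. linear (D\<eta> u)"
    and \<xi>: "\<eta> \<xi> = 1" and \<phi>2: "\<And>v. \<phi> (\<phi> v) = - v + \<eta> v *\<^sub>R \<xi>"
    and D1: "\<And>u. D\<eta> u \<xi> + \<eta> (D\<xi> u) = 0" and D2: "\<And>u. D\<phi> u \<xi> + \<phi> (D\<xi> u) = 0"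
    and D3: "\<And>u v. D\<eta> u (\<phi> v) + \<eta> (D\<phi> u v) = 0"
    and N: "\<And>v w. D\<phi> (\<phi> v) w - D\<phi> (\<phi> w) v - \<phi> (D\<phi> v w - D\<phi> w v) + (D\<eta> v w - D\<eta> w v) *\<^sub>R \<xi> = 0"
  shows "D\<eta> \<xi> v - D\<eta> v \<xi> = 0"
    and "D\<phi> \<xi> v - D\<xi> (\<phi> v) + \<phi> (D\<xi> v) = 0"
    and "D\<eta> (\<phi> v) w - D\<eta> w (\<phi> v) + (D\<eta> v (\<phi> w) - D\<eta> (\<phi> w) v) = 0"
proof -
  note ac = almost_contact_linear[OF lin(1,2) \<xi> \<phi>2]
  have \<phi>0: "D\<phi> 0 v = 0" for v using linear_0[OF lin(3)] .
  define L where "L = (\<lambda>v. D\<phi> \<xi> v - D\<xi> (\<phi> v) + \<phi> (D\<xi> v))"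
  have D2': "D\<phi> u \<xi> = - \<phi> (D\<xi> u)" for u using D2[of u] by (simp add: eq_neg_iff_add_eq_0)
  have L: "\<phi> (L v) + (D\<eta> v \<xi> - D\<eta> \<xi> v) *\<^sub>R \<xi> = 0" for v
    using N[of v \<xi>] unfolding L_def ac D2' \<phi>0
    by (simp add: linear_add[OF lin(1)] linear_diff[OF lin(1)] linear_neg[OF lin(1)] algebra_simps)
  have d\<xi>: "D\<eta> v \<xi> - D\<eta> \<xi> v = 0" for v
    using arg_cong[OF L[of v], of \<eta>]
    by (simp add: linear_add[OF lin(2)] linear_cmul[OF lin(2)] linear_0[OF lin(2)] ac \<xi>)
  then show "D\<eta> \<xi> v - D\<eta> v \<xi> = 0" by simp
  have "\<phi> (L v) = 0" using L[of v] d\<xi>[of v] by simp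
  then have "\<phi> (\<phi> (L v)) = 0" by (simp add: linear_0[OF lin(1)])
  then have L2: "L v = \<eta> (L v) *\<^sub>R \<xi>" using \<phi>2[of "L v"] by simp
  have "\<eta> (L v) = \<eta> (D\<phi> \<xi> v) - \<eta> (D\<xi> (\<phi> v))"
    unfolding L_def by (simp add: linear_add[OF lin(2)] linear_diff[OF lin(2)] ac)
  also have "\<dots> = D\<eta> (\<phi> v) \<xi> - D\<eta> \<xi> (\<phi> v)" using D1[of "\<phi> v"] D3[of \<xi> v] by simp
  finally have "\<eta> (L v) = 0" using d\<xi>[of "\<phi> v"] by simp
  then show "D\<phi> \<xi> v - D\<xi> (\<phi> v) + \<phi> (D\<xi> v) = 0" using L2 unfolding L_def by simp
  have inv: "D\<eta> (\<phi> v) (\<phi> w) - D\<eta> (\<phi> w) (\<phi> v) = D\<eta> v w - D\<eta> w v" for v w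
    using arg_cong[OF N[of v w], of \<eta>] D3[of "\<phi> v" w] D3[of "\<phi> w" v]
    by (simp add: linear_add[OF lin(2)] linear_diff[OF lin(2)] linear_cmul[OF lin(2)]
        linear_0[OF lin(2)] ac \<xi>)
  have "D\<eta> (\<phi> (\<phi> v)) (\<phi> w) = - D\<eta> v (\<phi> w) + \<eta> v * D\<eta> \<xi> (\<phi> w)"
    unfolding \<phi>2 by (simp add: linear_diff[OF lin(4)] linear_cmul[OF lin(4)])
  moreover have "D\<eta> (\<phi> w) (\<phi> (\<phi> v)) = - D\<eta> (\<phi> w) v + \<eta> v * D\<eta> (\<phi> w) \<xi>"
    unfolding \<phi>2 by (simp add: linear_diff[OF lin(5)] linear_cmul[OF lin(5)])
  moreover have "D\<eta> \<xi> (\<phi> w) = D\<eta> (\<phi> w) \<xi>" using d\<xi>[of "\<phi> w"] by simp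
  ultimately show "D\<eta> (\<phi> v) w - D\<eta> w (\<phi> v) + (D\<eta> v (\<phi> w) - D\<eta> (\<phi> w) v) = 0"
    using inv[of "\<phi> v" w] by simp
qed

lemma frechet_derivative_fst:
  assumes "f differentiable (at (fst z))"
  shows "frechet_derivative (\<lambda>z. f (fst z)) (at z) v = frechet_derivative f (at (fst z)) (fst v)"
proof -
  have "((\<lambda>z. f (fst z)) has_derivative (\<lambda>v. frechet_derivative f (at (fst z)) (fst v))) (at z)"
    using bounded_linear_imp_has_derivative[OF bounded_linear_fst]
      assms[unfolded frechet_derivative_works] by (rule has_derivative_compose)
  from frechet_derivative_at[OF this] show ?thesis by metis
qed

lemma smooth_on_fst_arg:
  fixes f :: "'e::euclidean_space \<Rightarrow> 'f::real_normed_vector"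
  assumes "open S" "smooth_on S f"
  shows "smooth_on (S \<times> (UNIV :: real set)) (\<lambda>z. f (fst z))"
proof -
  have o: "open (S \<times> (UNIV :: real set))" by (simp add: assms(1) open_Times)
  show ?thesis
    by (rule smooth_on_compose[OF o assms(1) _ smooth_on_fst[OF o smooth_on_id] assms(2)]) auto
qed

definition cyl_coord_J ::
  "('e::euclidean_space \<Rightarrow> 'e \<Rightarrow> 'e) \<Rightarrow> ('e \<Rightarrow> 'e) \<Rightarrow> ('e \<Rightarrow> 'e \<Rightarrow> real) \<Rightarrow> 'e \<times> real \<Rightarrow> 'e \<times> real \<Rightarrow> 'e \<times> real"
  where "cyl_coord_J \<phi> \<xi> \<eta> z v =
    (\<phi> (fst z) (fst v) + snd v *\<^sub>R \<xi> (fst z), - \<eta> (fst z) (fst v))"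

definition cyl_coord_g ::
  "('e::euclidean_space \<Rightarrow> 'e \<Rightarrow> 'e \<Rightarrow> real) \<Rightarrow> 'e \<times> real \<Rightarrow> 'e \<times> real \<Rightarrow> 'e \<times> real \<Rightarrow> real"
  where "cyl_coord_g h z v w = h (fst z) (fst v) (fst w) + snd v * snd w"

text \<open>The structure tensors do not depend on the coordinate of the line. The Nijenhuis tensor of \<open>J\<close> has
  \<open>N\<^sub>\<phi> + d\<eta> \<otimes> \<xi>\<close> and the three tensors of the lemma \<open>normal_almost_contact_consequences\<close> as components. The
  fundamental form of \<open>J\<close> is \<open>\<Phi> + \<eta> \<and> dt\<close>, so its exterior derivative is \<open>d\<eta> \<and> dt\<close>.\<close>

theorem quasi_vaisman_coords_cylinder:
  fixes S :: "'e::euclidean_space set"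
  assumes S: "open S" and Q: "quasi_sasakian_coords S \<phi> \<xi> \<eta> h"
  shows "quasi_vaisman_coords (S \<times> UNIV) (cyl_coord_J \<phi> \<xi> \<eta>) (cyl_coord_g h) (\<lambda>z v. snd v) (0, 1)"
proof -
  let ?J = "cyl_coord_J \<phi> \<xi> \<eta>" and ?g = "cyl_coord_g h"
  let ?S = "S \<times> (UNIV :: real set)"
  have o: "open ?S" by (simp add: S open_Times)
  have s\<phi>: "smooth_lin S \<phi>" and s\<xi>: "smooth_on S \<xi>" and s\<eta>: "smooth_lin S \<eta>" and sh: "smooth_bilin S h"
    and pt: "\<And>y v w. y \<in> S \<Longrightarrow> \<eta> y (\<xi> y) = 1 \<and> \<phi> y (\<phi> y v) = - v + \<eta> y v *\<^sub>R \<xi> y \<and>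
        h y v w = h y w v \<and> (v \<noteq> 0 \<longrightarrow> h y v v > 0) \<and>
        h y (\<phi> y v) (\<phi> y w) = h y v w - \<eta> y v * \<eta> y w \<and>
        coord_nijenhuis \<phi> y v w + coord_d1 \<eta> y v w *\<^sub>R \<xi> y = 0 \<and>
        (\<forall>x. coord_d2 (\<lambda>y v w. h y v (\<phi> y w)) y v w x = 0)"
    using Q by (simp_all add: quasi_sasakian_coords_def)
  have con: "smooth_on S (\<lambda>y. \<phi> y w)" "smooth_on S (\<lambda>y. \<eta> y w)" "smooth_on S (\<lambda>y. h y v w)" for v w
    using s\<phi> s\<eta> sh by (simp_all add: smooth_lin_def smooth_bilin_def)
  have lin: "linear (\<phi> y)" "linear (\<eta> y)" "linear (h y v)" "linear (\<lambda>v. h y v w)" if "y \<in> S" for y v w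
    using s\<phi> s\<eta> sh that by (simp_all add: smooth_lin_def smooth_bilin_def)
  have ac: "\<phi> y (\<xi> y) = 0" "\<eta> y (\<phi> y v) = 0" "h y v (\<xi> y) = \<eta> y v" if y: "y \<in> S" for y v
  proof -
    show 0: "\<phi> y (\<xi> y) = 0" "\<eta> y (\<phi> y v) = 0"
      using almost_contact_linear[OF lin(1,2)[OF y], of "\<xi> y"] pt[OF y] by blast+
    have "h y (\<phi> y v) (\<phi> y (\<xi> y)) = h y v (\<xi> y) - \<eta> y v * \<eta> y (\<xi> y)" using pt[OF y] by blast
    then show "h y v (\<xi> y) = \<eta> y v" using pt[OF y] by (simp add: 0 linear_0[OF lin(3)[OF y]] linear_0[OF lin(4)[OF y]])
  qed
  define D\<xi> where "D\<xi> y = frechet_derivative \<xi> (at y)" for y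
  have dJ: "coord_deriv ?J z V W = (coord_deriv \<phi> (fst z) (fst V) (fst W) + snd W *\<^sub>R D\<xi> (fst z) (fst V),
      - coord_deriv \<eta> (fst z) (fst V) (fst W))" if z: "z \<in> ?S" for z V W
  proof -
    have y: "fst z \<in> S" using z by auto
    let ?F = "\<lambda>y. (\<phi> y (fst W) + snd W *\<^sub>R \<xi> y, - \<eta> y (fst W))"
    have hd: "(?F has_derivative (\<lambda>v. (coord_deriv \<phi> (fst z) v (fst W) + snd W *\<^sub>R D\<xi> (fst z) v,
        - coord_deriv \<eta> (fst z) v (fst W)))) (at (fst z))"
      unfolding coord_deriv_def D\<xi>_def
      by (intro has_derivative_Pair has_derivative_add has_derivative_minus has_derivative_scaleR_right
          smooth_on_has_derivative[OF con(1) y] smooth_on_has_derivative[OF con(2) y]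
          smooth_on_has_derivative[OF s\<xi> y])
    have "coord_deriv ?J z V W = frechet_derivative (\<lambda>z. ?F (fst z)) (at z) V"
      by (simp add: coord_deriv_def cyl_coord_J_def)
    also have "\<dots> = frechet_derivative ?F (at (fst z)) (fst V)"
      by (rule frechet_derivative_fst[OF differentiableI[OF hd]])
    finally show ?thesis by (simp add: frechet_derivative_at[OF hd, symmetric])
  qed
  have smJ: "smooth_lin ?S ?J"
    unfolding smooth_lin_def
  proof (intro conjI ballI allI)
    fix z assume "z \<in> ?S"
    then have y: "fst z \<in> S" by auto
    show "linear (?J z)"
      by (rule linearI) (simp_all add: cyl_coord_J_def linear_add[OF lin(1)[OF y]] linear_add[OF lin(2)[OF y]]
          linear_cmul[OF lin(1)[OF y]] linear_cmul[OF lin(2)[OF y]] algebra_simps)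
  next
    fix W
    have "smooth_on S (\<lambda>y. (\<phi> y (fst W) + snd W *\<^sub>R \<xi> y, - \<eta> y (fst W)))"
      by (intro smooth_on_Pair[OF S] smooth_on_add[OF S] smooth_on_uminus[OF S] con s\<xi>
          smooth_on_bounded_linear[OF bounded_linear_scaleR_right S])
    from smooth_on_fst_arg[OF S this] show "smooth_on ?S (\<lambda>z. ?J z W)" by (simp add: cyl_coord_J_def)
  qed
  have smg: "smooth_bilin ?S ?g"
  proof -
    have 1: "smooth_on ?S (\<lambda>z. ?g z V W)" for V W
      using smooth_on_fst_arg[OF S smooth_on_add[OF S con(3) smooth_on_const]]
      unfolding cyl_coord_g_def by simp
    have 2: "linear (?g z V)" "linear (\<lambda>V. ?g z V W)" if "z \<in> ?S" for z V W
    proof -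
      have y: "fst z \<in> S" using that by auto
      show "linear (?g z V)" "linear (\<lambda>V. ?g z V W)"
        by (rule linearI, simp_all add: cyl_coord_g_def linear_add[OF lin(3)[OF y]]
            linear_add[OF lin(4)[OF y]] linear_cmul[OF lin(3)[OF y]] linear_cmul[OF lin(4)[OF y]]
            algebra_simps)+
    qed
    show ?thesis using 1 2 by (simp add: smooth_bilin_def smooth_lin_def)
  qed
  have sm\<theta>: "smooth_lin ?S (\<lambda>z v. snd v)"
    unfolding smooth_lin_def by (auto intro!: linearI smooth_on_const)
  have d\<theta>: "coord_deriv (\<lambda>z v. snd v) z V W = 0" for z :: "'e \<times> real" and V and W :: "'e \<times> real"
    by (simp add: coord_deriv_def)
  have J\<theta>: "coord_d1 (\<lambda>z v. - snd (?J z v)) z V W = coord_d1 \<eta> (fst z) (fst V) (fst W)" if z: "z \<in> ?S" for z V W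
  proof -
    have y: "fst z \<in> S" using z by auto
    have "coord_deriv (\<lambda>z v. - snd (?J z v)) z V W = coord_deriv \<eta> (fst z) (fst V) (fst W)" for V W
      unfolding coord_deriv_def cyl_coord_J_def
      by (simp add: frechet_derivative_fst[OF smooth_on_differentiable[OF con(2) y]])
    then show ?thesis by (simp add: coord_d1_def)
  qed
  have g_inv: "coord_deriv (\<lambda>z. ?g z V) z (0, 1) W = 0" if z: "z \<in> ?S" for z V W
  proof -
    have y: "fst z \<in> S" using z by auto
    have d: "(\<lambda>y. h y (fst V) (fst W) + snd V * snd W) differentiable (at (fst z))"
      by (rule smooth_on_differentiable[OF smooth_on_add[OF S con(3) smooth_on_const] y])
    show ?thesis unfolding coord_deriv_def cyl_coord_g_def
      by (simp add: frechet_derivative_fst[OF d] linear_0[OF linear_frechet_derivative[OF d]])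
  qed
  have cd0: "coord_deriv \<phi> y 0 w = 0" "coord_deriv \<eta> y 0 w = 0" "D\<xi> y 0 = 0" if y: "y \<in> S" for y w
    using linear_0[OF coord_deriv_linear1[OF s\<phi> y]] linear_0[OF coord_deriv_linear1[OF s\<eta> y]]
      linear_0[OF linear_frechet_derivative[OF smooth_on_differentiable[OF s\<xi> y]]]
    by (auto simp: D\<xi>_def)
  have J_inv: "coord_deriv ?J z (0, 1) W = 0" if z: "z \<in> ?S" for z W
    using z cd0[of "fst z"] by (auto simp: dJ[OF z] zero_prod_def)
  have nij: "coord_nijenhuis ?J z V W = 0" if z: "z \<in> ?S" for z V W
  proof -
    define y v s w r where "y = fst z" and "v = fst V" and "s = snd V" and "w = fst W" and "r = snd W"
    note abbr = y_def[symmetric] v_def[symmetric] s_def[symmetric] w_def[symmetric] r_def[symmetric]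
    have y: "y \<in> S" using z by (auto simp: y_def)
    let ?\<phi> = "\<phi> y" and ?\<eta> = "\<eta> y" and ?\<xi> = "\<xi> y"
    let ?D\<phi> = "coord_deriv \<phi> y" and ?D\<eta> = "coord_deriv \<eta> y" and ?D\<xi> = "D\<xi> y"
    have l\<xi>: "linear ?D\<xi>" unfolding D\<xi>_def
      by (rule linear_frechet_derivative[OF smooth_on_differentiable[OF s\<xi> y]])
    note l\<phi> = coord_deriv_linear1[OF s\<phi> y] and l\<eta> = coord_deriv_linear1[OF s\<eta> y]
      and l\<eta>2 = coord_deriv_linear2[OF S s\<eta> y]
    have const: "frechet_derivative F (at y) u = 0" if "\<And>x. x \<in> S \<Longrightarrow> F x = k"
      for F :: "'e \<Rightarrow> 'f::real_normed_vector" and k u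
    proof -
      have "frechet_derivative F (at y) = frechet_derivative (\<lambda>x. k) (at y)"
        by (rule frechet_derivative_cong[OF S y that])
      then show ?thesis by simp
    qed
    have D1: "?D\<eta> u ?\<xi> + ?\<eta> (?D\<xi> u) = 0" for u
      using smooth_lin_derivative[OF S s\<eta> y smooth_on_differentiable[OF s\<xi> y], of u]
        const[of "\<lambda>x. \<eta> x (\<xi> x)" 1 u] pt by (simp add: D\<xi>_def)
    have D2: "?D\<phi> u ?\<xi> + ?\<phi> (?D\<xi> u) = 0" for u
      using smooth_lin_derivative[OF S s\<phi> y smooth_on_differentiable[OF s\<xi> y], of u]
        const[of "\<lambda>x. \<phi> x (\<xi> x)" 0 u] ac by (simp add: D\<xi>_def)
    have D3: "?D\<eta> u (?\<phi> a) + ?\<eta> (?D\<phi> u a) = 0" for u a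
      using smooth_lin_derivative[OF S s\<eta> y smooth_on_differentiable[OF con(1) y], of a u]
        const[of "\<lambda>x. \<eta> x (\<phi> x a)" 0 u] ac by (simp add: coord_deriv_def)
    have N: "?D\<phi> (?\<phi> a) b - ?D\<phi> (?\<phi> b) a - ?\<phi> (?D\<phi> a b - ?D\<phi> b a) + (?D\<eta> a b - ?D\<eta> b a) *\<^sub>R ?\<xi> = 0"
      for a b using pt[OF y, of a b] by (simp add: coord_nijenhuis_def coord_d1_def)
    have "?\<eta> ?\<xi> = 1" and \<phi>\<phi>: "\<And>a. ?\<phi> (?\<phi> a) = - a + ?\<eta> a *\<^sub>R ?\<xi>" using pt[OF y] by blast+
    note C = normal_almost_contact_consequences[where D\<phi>="?D\<phi>" and D\<eta>="?D\<eta>" and D\<xi>="?D\<xi>",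
        OF lin(1,2)[OF y] l\<phi> l\<eta> l\<eta>2 \<open>?\<eta> ?\<xi> = 1\<close> \<phi>\<phi> D1 D2 D3 N]
    \<comment> \<open>the component tangent to \<open>S\<close>: normality, plus Lie derivatives of \<open>\<phi>\<close> weighted by \<open>s\<close> and \<open>r\<close>\<close>
    have "fst (coord_nijenhuis ?J z V W) =
        (?D\<phi> (?\<phi> v) w - ?D\<phi> (?\<phi> w) v - ?\<phi> (?D\<phi> v w - ?D\<phi> w v) + (?D\<eta> v w - ?D\<eta> w v) *\<^sub>R ?\<xi>)
        + s *\<^sub>R (?D\<phi> ?\<xi> w - ?D\<xi> (?\<phi> w) + ?\<phi> (?D\<xi> w)) - r *\<^sub>R (?D\<phi> ?\<xi> v - ?D\<xi> (?\<phi> v) + ?\<phi> (?D\<xi> v))"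
      unfolding coord_nijenhuis_def dJ[OF z] cyl_coord_J_def abbr fst_conv snd_conv
      by (simp add: fst_diff snd_diff fst_add snd_add abbr
          linear_add[OF lin(1)[OF y]] linear_diff[OF lin(1)[OF y]] linear_cmul[OF lin(1)[OF y]]
          linear_add[OF l\<phi>] linear_cmul[OF l\<phi>] linear_add[OF l\<xi>] linear_cmul[OF l\<xi>] algebra_simps)
    then have f: "fst (coord_nijenhuis ?J z V W) = 0" unfolding N C(2) by simp
    \<comment> \<open>the component along the line; the terms are grouped so that each bracket is known to vanish\<close>
    have "snd (coord_nijenhuis ?J z V W) =
        - (?D\<eta> (?\<phi> v) w - ?D\<eta> w (?\<phi> v) + (?D\<eta> v (?\<phi> w) - ?D\<eta> (?\<phi> w) v))
        + (?\<eta> (?D\<phi> v w) + ?D\<eta> v (?\<phi> w)) - (?\<eta> (?D\<phi> w v) + ?D\<eta> w (?\<phi> v))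
        - s * (?D\<eta> ?\<xi> w + ?\<eta> (?D\<xi> w)) + r * (?D\<eta> ?\<xi> v + ?\<eta> (?D\<xi> v))"
      unfolding coord_nijenhuis_def dJ[OF z] cyl_coord_J_def abbr fst_conv snd_conv
      by (simp add: fst_diff snd_diff fst_add snd_add abbr
          linear_add[OF lin(2)[OF y]] linear_diff[OF lin(2)[OF y]] linear_cmul[OF lin(2)[OF y]]
          linear_add[OF l\<eta>] linear_cmul[OF l\<eta>] algebra_simps)
    moreover have "?\<eta> (?D\<phi> a b) + ?D\<eta> a (?\<phi> b) = 0" "?D\<eta> ?\<xi> b + ?\<eta> (?D\<xi> b) = 0" for a b
      using D3[of a b] D1[of b] C(1)[of b] by simp_all
    ultimately have "snd (coord_nijenhuis ?J z V W) = 0" unfolding C(3) by simp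
    with f show ?thesis by (simp add: prod_eq_iff)
  qed
  have d\<Omega>: "coord_d2 (\<lambda>z v w. ?g z v (?J z w)) z V W X =
      coord_d1 \<eta> (fst z) (fst V) (fst W) * snd X + coord_d1 \<eta> (fst z) (fst W) (fst X) * snd V
      + coord_d1 \<eta> (fst z) (fst X) (fst V) * snd W" if z: "z \<in> ?S" for z V W X
  proof -
    let ?y = "fst z"
    have y: "?y \<in> S" using z by auto
    let ?\<Phi> = "\<lambda>y v w. h y v (\<phi> y w)"
    let ?\<Omega> = "\<lambda>z v w. ?\<Phi> (fst z) (fst v) (fst w) + snd w * \<eta> (fst z) (fst v) - snd v * \<eta> (fst z) (fst w)"
    have e1: "coord_d2 (\<lambda>z v w. ?g z v (?J z w)) z V W X = coord_d2 ?\<Omega> z V W X"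
    proof (rule coord_d2_cong[OF o z])
      fix x :: "'e \<times> real" and v w :: "'e \<times> real" assume "x \<in> ?S"
      then have x: "fst x \<in> S" by auto
      show "?g x v (?J x w) = ?\<Omega> x v w"
        by (simp add: cyl_coord_g_def cyl_coord_J_def linear_add[OF lin(3)[OF x]]
            linear_cmul[OF lin(3)[OF x]] ac(3)[OF x])
    qed
    have e2: "coord_deriv (\<lambda>z. ?\<Omega> z v) z u w = coord_deriv (\<lambda>y. ?\<Phi> y (fst v)) ?y (fst u) (fst w)
        + snd w * coord_deriv \<eta> ?y (fst u) (fst v) - snd v * coord_deriv \<eta> ?y (fst u) (fst w)" for u v w
    proof -
      let ?F = "\<lambda>y. ?\<Phi> y (fst v) (fst w) + snd w * \<eta> y (fst v) - snd v * \<eta> y (fst w)"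
      have s\<Phi>: "smooth_on S (\<lambda>y. ?\<Phi> y a b)" for a b
        by (rule smooth_lin_apply[OF S smooth_bilinD1[OF sh] con(1)])
      have hd: "(?F has_derivative (\<lambda>u. coord_deriv (\<lambda>y. ?\<Phi> y (fst v)) ?y u (fst w)
        + snd w * coord_deriv \<eta> ?y u (fst v) - snd v * coord_deriv \<eta> ?y u (fst w))) (at ?y)"
        unfolding coord_deriv_def
        by (intro has_derivative_add has_derivative_diff has_derivative_mult_right
            smooth_on_has_derivative[OF con(2) y] smooth_on_has_derivative[OF s\<Phi> y])
      have "coord_deriv (\<lambda>z. ?\<Omega> z v) z u w = frechet_derivative (\<lambda>z. ?F (fst z)) (at z) u"
        by (simp add: coord_deriv_def)
      also have "\<dots> = frechet_derivative ?F (at ?y) (fst u)"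
        by (rule frechet_derivative_fst[OF differentiableI[OF hd]])
      finally show ?thesis by (simp add: frechet_derivative_at[OF hd, symmetric])
    qed
    have e3: "coord_d2 ?\<Phi> ?y (fst V) (fst W) (fst X) = 0" using pt[OF y] by blast
    show ?thesis
      using e3 unfolding e1 unfolding coord_d2_def coord_d1_def e2 by (simp add: algebra_simps)
  qed
  show ?thesis
    unfolding quasi_vaisman_coords_def
  proof (intro conjI ballI allI impI smJ smg sm\<theta>)
    fix z :: "'e \<times> real" and V W X :: "'e \<times> real" assume z: "z \<in> ?S"
    then have y: "fst z \<in> S" by auto
    note P = pt[OF y]
    have \<xi>1: "\<eta> (fst z) (\<xi> (fst z)) = 1" and \<phi>\<phi>: "\<And>a. \<phi> (fst z) (\<phi> (fst z) a) = - a + \<eta> (fst z) a *\<^sub>R \<xi> (fst z)"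
      and hsym: "\<And>a b. h (fst z) a b = h (fst z) b a" and hpos: "\<And>a. a \<noteq> 0 \<Longrightarrow> h (fst z) a a > 0"
      and h\<phi>: "\<And>a b. h (fst z) (\<phi> (fst z) a) (\<phi> (fst z) b) = h (fst z) a b - \<eta> (fst z) a * \<eta> (fst z) b"
      using P by blast+
    show "?J z (?J z V) = - V"
      by (simp add: cyl_coord_J_def prod_eq_iff linear_add[OF lin(1)[OF y]] linear_add[OF lin(2)[OF y]]
          linear_cmul[OF lin(1)[OF y]] linear_cmul[OF lin(2)[OF y]] ac[OF y] \<phi>\<phi> \<xi>1)
    show "?g z V W = ?g z W V" by (simp add: cyl_coord_g_def hsym[of "fst V"])
    show "?g z V V > 0" if "V \<noteq> 0"
    proof (cases "fst V = 0")
      case True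
      then have "snd V \<noteq> 0" using that by (auto simp: prod_eq_iff)
      then show ?thesis using True by (auto simp: cyl_coord_g_def linear_0[OF lin(3)[OF y]] zero_less_mult_iff)
    next
      case False
      then show ?thesis using hpos by (simp add: cyl_coord_g_def add_pos_nonneg)
    qed
    have \<xi>h: "h (fst z) (\<xi> (fst z)) a = \<eta> (fst z) a" for a using ac(3)[OF y, of a] hsym by simp
    show "?g z (?J z V) (?J z W) = ?g z V W"
      by (simp add: cyl_coord_g_def cyl_coord_J_def linear_add[OF lin(3)[OF y]] linear_add[OF lin(4)[OF y]]
          linear_cmul[OF lin(3)[OF y]] linear_cmul[OF lin(4)[OF y]] h\<phi> \<xi>h ac[OF y] \<xi>1
          linear_add[OF lin(2)[OF y]] linear_cmul[OF lin(2)[OF y]] algebra_simps)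
    show "coord_d1 (\<lambda>z v. snd v) z V W = 0" by (simp add: coord_d1_def d\<theta>)
    show "?g z (0, 1) V = snd V" by (simp add: cyl_coord_g_def linear_0[OF lin(4)[OF y]])
    show "?g z (0, 1) (0, 1) = 1" by (simp add: cyl_coord_g_def linear_0[OF lin(4)[OF y]])
    show "coord_d2 (\<lambda>z v w. ?g z v (?J z w)) z V W X =
        coord_d1 (\<lambda>z v. - snd (?J z v)) z V W * snd X + coord_d1 (\<lambda>z v. - snd (?J z v)) z W X * snd V
        + coord_d1 (\<lambda>z v. - snd (?J z v)) z X V * snd W"
      by (simp add: d\<Omega>[OF z] J\<theta>[OF z])
  qed (use nij g_inv J_inv in simp_all)
qed

section \<open>Products of manifolds and the cylinder\<close>

definition prod_chart :: "('a, 'e) chart \<Rightarrow> ('b, 'f) chart \<Rightarrow> ('a \<times> 'b, 'e \<times> 'f) chart" where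
  "prod_chart c d = Chart (cdom c \<times> cdom d) (map_prod (cmap c) (cmap d))"

lemma cdom_prod_chart [simp]: "cdom (prod_chart c d) = cdom c \<times> cdom d"
  by (simp add: prod_chart_def)

lemma cmap_prod_chart [simp]: "cmap (prod_chart c d) p = (cmap c (fst p), cmap d (snd p))"
  by (cases p) (simp add: prod_chart_def)

lemma image_prod_chart: "cmap (prod_chart c d) ` (A \<times> B) = cmap c ` A \<times> cmap d ` B"
  by (force simp: image_iff)

lemma atlas_prod_mfd: "atlas (prod_mfd M N) = {prod_chart c d | c d. c \<in> atlas M \<and> d \<in> atlas N}"
  by (simp add: prod_mfd_def prod_chart_def)

lemma mtop_prod_mfd [simp]: "mtop (prod_mfd M N) = prod_topology (mtop M) (mtop N)"
  by (simp add: prod_mfd_def)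

lemma carr_prod_mfd: "carr (prod_mfd M N) = carr M \<times> carr N"
  by (simp add: carr_def)

lemma prod_chart_charts_at:
  "c \<in> charts_at M (fst p) \<Longrightarrow> d \<in> charts_at N (snd p) \<Longrightarrow> prod_chart c d \<in> charts_at (prod_mfd M N) p"
  by (cases p) (auto simp: charts_at_def atlas_prod_mfd)

lemma is_chart_prod:
  assumes c: "is_chart X c" and d: "is_chart Y d"
  shows "is_chart (prod_topology X Y) (prod_chart c d)"
  unfolding is_chart_def
proof (intro conjI)
  show "openin (prod_topology X Y) (cdom (prod_chart c d))"
    using is_chart_dom[OF c] is_chart_dom[OF d] by (simp add: openin_prod_Times_iff)
  show "open (cmap (prod_chart c d) ` cdom (prod_chart c d))"
    using c d unfolding cdom_prod_chart image_prod_chart is_chart_def by (simp add: open_Times)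
  obtain c' where c': "homeomorphic_maps (subtopology X (cdom c)) (top_of_set (cmap c ` cdom c)) (cmap c) c'"
    using c unfolding is_chart_def homeomorphic_map_maps by blast
  obtain d' where d': "homeomorphic_maps (subtopology Y (cdom d)) (top_of_set (cmap d ` cdom d)) (cmap d) d'"
    using d unfolding is_chart_def homeomorphic_map_maps by blast
  have "homeomorphic_maps
      (prod_topology (subtopology X (cdom c)) (subtopology Y (cdom d)))
      (prod_topology (top_of_set (cmap c ` cdom c)) (top_of_set (cmap d ` cdom d)))
      (\<lambda>(x, y). (cmap c x, cmap d y)) (\<lambda>(x, y). (c' x, d' y))"
    using c' d' unfolding homeomorphic_maps_prod by blast
  moreover have "(\<lambda>(x, y). (cmap c x, cmap d y)) = cmap (prod_chart c d)" by auto
  ultimately show "homeomorphic_map (subtopology (prod_topology X Y) (cdom (prod_chart c d)))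
      (top_of_set (cmap (prod_chart c d) ` cdom (prod_chart c d))) (cmap (prod_chart c d))"
    unfolding homeomorphic_map_maps cdom_prod_chart image_prod_chart subtopology_Times
      prod_topology_subtopology_eu by metis
qed

lemma second_countable_prod_topology:
  assumes "second_countable X" "second_countable Y"
  shows "second_countable (prod_topology X Y)"
proof -
  obtain \<B> where B: "countable \<B>" "\<And>V. V \<in> \<B> \<Longrightarrow> openin X V"
    "\<And>U x. openin X U \<Longrightarrow> x \<in> U \<Longrightarrow> \<exists>V\<in>\<B>. x \<in> V \<and> V \<subseteq> U"
    using assms(1) unfolding second_countable_def by auto
  obtain \<C> where C: "countable \<C>" "\<And>V. V \<in> \<C> \<Longrightarrow> openin Y V"
    "\<And>U x. openin Y U \<Longrightarrow> x \<in> U \<Longrightarrow> \<exists>V\<in>\<C>. x \<in> V \<and> V \<subseteq> U"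
    using assms(2) unfolding second_countable_def by auto
  show ?thesis
    unfolding second_countable_def
  proof (intro exI conjI ballI allI impI)
    show "countable ((\<lambda>(V, W). V \<times> W) ` (\<B> \<times> \<C>))" using B(1) C(1) by simp
    show "openin (prod_topology X Y) V" if "V \<in> (\<lambda>(V, W). V \<times> W) ` (\<B> \<times> \<C>)" for V
      using that B(2) C(2) by (auto simp: openin_prod_Times_iff)
    fix U x assume U: "openin (prod_topology X Y) U \<and> x \<in> U"
    then obtain V W where VW: "openin X V" "openin Y W" "fst x \<in> V" "snd x \<in> W" "V \<times> W \<subseteq> U"
      unfolding openin_prod_topology_alt by (metis prod.collapse)
    obtain V' where V': "V' \<in> \<B>" "fst x \<in> V'" "V' \<subseteq> V" using B(3)[OF VW(1,3)] by blast
    obtain W' where W': "W' \<in> \<C>" "snd x \<in> W'" "W' \<subseteq> W" using C(3)[OF VW(2,4)] by blast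
    have "x \<in> V' \<times> W'" using V' W' by (simp add: mem_Times_iff)
    moreover have "V' \<times> W' \<subseteq> U" using V' W' VW(5) by blast
    moreover have "V' \<times> W' \<in> (\<lambda>(V, W). V \<times> W) ` (\<B> \<times> \<C>)"
      by (rule image_eqI[of _ _ "(V', W')"]) (simp_all add: V'(1) W'(1))
    ultimately show "\<exists>V\<in>(\<lambda>(V, W). V \<times> W) ` (\<B> \<times> \<C>). x \<in> V \<and> V \<subseteq> U"
      by (intro bexI[of _ "V' \<times> W'"] conjI)
  qed
qed

lemma cinv_prod_chart:
  assumes "is_chart X c" "is_chart Y d" "z \<in> cmap c ` cdom c \<times> cmap d ` cdom d"
  shows "cinv (prod_chart c d) z = (cinv c (fst z), cinv d (snd z))"
proof -
  obtain x y where xy: "x \<in> cdom c" "y \<in> cdom d" "z = (cmap c x, cmap d y)" using assms(3) by auto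
  have "cinv (prod_chart c d) (cmap (prod_chart c d) (x, y)) = (x, y)"
    using xy by (intro is_chart_cinv[OF is_chart_prod[OF assms(1,2)]]) simp
  then show ?thesis using xy is_chart_cinv[OF assms(1)] is_chart_cinv[OF assms(2)] by simp
qed

lemma smooth_on_prod_args:
  fixes f :: "'e::euclidean_space \<Rightarrow> 'c::euclidean_space" and g :: "'f::euclidean_space \<Rightarrow> 'd::euclidean_space"
  assumes "open S" "open T" "smooth_on S f" "smooth_on T g"
  shows "smooth_on (S \<times> T) (\<lambda>z. (f (fst z), g (snd z)))"
proof -
  have o: "open (S \<times> T)" by (rule open_Times[OF assms(1,2)])
  have "smooth_on (S \<times> T) (\<lambda>z. f (fst z))"
    by (rule smooth_on_compose[OF o assms(1) _ smooth_on_fst[OF o smooth_on_id] assms(3)]) auto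
  moreover have "smooth_on (S \<times> T) (\<lambda>z. g (snd z))"
    by (rule smooth_on_compose[OF o assms(2) _ smooth_on_snd[OF o smooth_on_id] assms(4)]) auto
  ultimately show ?thesis by (rule smooth_on_Pair[OF o])
qed

lemma smooth_manifold_prod:
  assumes M: "smooth_manifold M" and N: "smooth_manifold N"
  shows "smooth_manifold (prod_mfd M N)"
  unfolding smooth_manifold_def
proof (intro conjI ballI)
  show "Hausdorff_space (mtop (prod_mfd M N))"
    using M N by (simp add: smooth_manifold_def Hausdorff_space_prod_topology)
  show "second_countable (mtop (prod_mfd M N))"
    using M N by (simp add: smooth_manifold_def second_countable_prod_topology)
  show "is_chart (mtop (prod_mfd M N)) c" if "c \<in> atlas (prod_mfd M N)" for c
    using that is_chart_prod[OF manifold_is_chart[OF M] manifold_is_chart[OF N]]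
    by (auto simp: atlas_prod_mfd)
  have M': "(\<Union>c\<in>atlas M. cdom c) = carr M" and N': "(\<Union>c\<in>atlas N. cdom c) = carr N"
    using M N by (simp_all add: smooth_manifold_def)
  show "(\<Union>c\<in>atlas (prod_mfd M N). cdom c) = carr (prod_mfd M N)"
    unfolding carr_prod_mfd M'[symmetric] N'[symmetric] atlas_prod_mfd by force
  fix p p' assume "p \<in> atlas (prod_mfd M N)" "p' \<in> atlas (prod_mfd M N)"
  then obtain c d c' d' where p: "p = prod_chart c d" "p' = prod_chart c' d'"
    and c: "c \<in> atlas M" "c' \<in> atlas M" and d: "d \<in> atlas N" "d' \<in> atlas N"
    unfolding atlas_prod_mfd by blast
  let ?S = "cmap c ` (cdom c \<inter> cdom c')" and ?T = "cmap d ` (cdom d \<inter> cdom d')"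
  have oS: "open ?S" and oT: "open ?T" by (rule transition_open[OF M c] transition_open[OF N d])+
  have im: "cmap p ` (cdom p \<inter> cdom p') = ?S \<times> ?T"
    unfolding p cdom_prod_chart Times_Int_Times image_prod_chart ..
  have "smooth_on (?S \<times> ?T) (\<lambda>z. (cmap c' (cinv c (fst z)), cmap d' (cinv d (snd z))))"
    by (rule smooth_on_prod_args[OF oS oT transition_smooth[OF M c] transition_smooth[OF N d]])
  then show "smooth_on (cmap p ` (cdom p \<inter> cdom p')) (cmap p' \<circ> cinv p)"
    unfolding im
  proof (rule smooth_on_cong[OF open_Times[OF oS oT], rotated])
    fix z assume "z \<in> ?S \<times> ?T"
    then have "z \<in> cmap c ` cdom c \<times> cmap d ` cdom d" by auto
    from cinv_prod_chart[OF manifold_is_chart[OF M c(1)] manifold_is_chart[OF N d(1)] this]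
    show "(cmap c' (cinv c (fst z)), cmap d' (cinv d (snd z))) = (cmap p' \<circ> cinv p) z"
      by (simp add: p)
  qed
qed

lemma smooth_map_fst:
  assumes M: "smooth_manifold M" and N: "smooth_manifold N"
  shows "smooth_map (prod_mfd M N) M fst"
  unfolding smooth_map_def comp_def
proof (intro conjI ballI)
  show "continuous_map (mtop (prod_mfd M N)) (mtop M) fst" by (simp add: continuous_map_fst)
  fix p e assume "p \<in> atlas (prod_mfd M N)" and e: "e \<in> atlas M"
  then obtain c d where p: "p = prod_chart c d" and c: "c \<in> atlas M" and d: "d \<in> atlas N"
    unfolding atlas_prod_mfd by blast
  let ?S = "cmap c ` (cdom c \<inter> cdom e)" and ?T = "cmap d ` cdom d"
  have oS: "open ?S" and oT: "open ?T" by (rule transition_open[OF M c e] chart_open[OF N d])+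
  have "{x \<in> cdom p. fst x \<in> cdom e} = (cdom c \<inter> cdom e) \<times> cdom d" by (auto simp: p)
  then have im: "cmap p ` {x \<in> cdom p. fst x \<in> cdom e} = ?S \<times> ?T" by (simp only: p image_prod_chart)
  have o: "open (?S \<times> ?T)" by (rule open_Times[OF oS oT])
  have "smooth_on (?S \<times> ?T) (\<lambda>z. cmap e (cinv c (fst z)))"
    by (rule smooth_on_compose[OF o oS _ smooth_on_fst[OF o smooth_on_id] transition_smooth[OF M c e]]) auto
  then show "smooth_on (cmap p ` {x \<in> cdom p. fst x \<in> cdom e}) (\<lambda>z. cmap e (fst (cinv p z)))"
    unfolding im
  proof (rule smooth_on_cong[OF o, rotated])
    fix z assume "z \<in> ?S \<times> ?T"
    then have "z \<in> cmap c ` cdom c \<times> cmap d ` cdom d" by auto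
    from cinv_prod_chart[OF manifold_is_chart[OF M c] manifold_is_chart[OF N d] this]
    show "cmap e (cinv c (fst z)) = cmap e (fst (cinv p z))" by (simp add: p)
  qed
qed

lemma smooth_map_snd:
  assumes M: "smooth_manifold M" and N: "smooth_manifold N"
  shows "smooth_map (prod_mfd M N) N snd"
  unfolding smooth_map_def comp_def
proof (intro conjI ballI)
  show "continuous_map (mtop (prod_mfd M N)) (mtop N) snd" by (simp add: continuous_map_snd)
  fix p e assume "p \<in> atlas (prod_mfd M N)" and e: "e \<in> atlas N"
  then obtain c d where p: "p = prod_chart c d" and c: "c \<in> atlas M" and d: "d \<in> atlas N"
    unfolding atlas_prod_mfd by blast
  let ?S = "cmap c ` cdom c" and ?T = "cmap d ` (cdom d \<inter> cdom e)"
  have oS: "open ?S" and oT: "open ?T" by (rule transition_open[OF N d e] chart_open[OF M c])+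
  have "{x \<in> cdom p. snd x \<in> cdom e} = cdom c \<times> (cdom d \<inter> cdom e)" by (auto simp: p)
  then have im: "cmap p ` {x \<in> cdom p. snd x \<in> cdom e} = ?S \<times> ?T" by (simp only: p image_prod_chart)
  have o: "open (?S \<times> ?T)" by (rule open_Times[OF oS oT])
  have "smooth_on (?S \<times> ?T) (\<lambda>z. cmap e (cinv d (snd z)))"
    by (rule smooth_on_compose[OF o oT _ smooth_on_snd[OF o smooth_on_id] transition_smooth[OF N d e]]) auto
  then show "smooth_on (cmap p ` {x \<in> cdom p. snd x \<in> cdom e}) (\<lambda>z. cmap e (snd (cinv p z)))"
    unfolding im
  proof (rule smooth_on_cong[OF o, rotated])
    fix z assume "z \<in> ?S \<times> ?T"
    then have "z \<in> cmap c ` cdom c \<times> cmap d ` cdom d" by auto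
    from cinv_prod_chart[OF manifold_is_chart[OF M c] manifold_is_chart[OF N d] this]
    show "cmap e (cinv d (snd z)) = cmap e (snd (cinv p z))" by (simp add: p)
  qed
qed

lemma smooth_map_Pair:
  assumes P: "smooth_manifold P" and M: "smooth_manifold M" and N: "smooth_manifold N"
    and F: "smooth_map P M F" and G: "smooth_map P N G"
  shows "smooth_map P (prod_mfd M N) (\<lambda>x. (F x, G x))"
  unfolding smooth_map_def comp_def
proof (intro conjI ballI)
  show cts: "continuous_map (mtop P) (mtop (prod_mfd M N)) (\<lambda>x. (F x, G x))"
    using smooth_map_continuous[OF F] smooth_map_continuous[OF G] by (simp add: continuous_map_paired)
  fix e p assume e: "e \<in> atlas P" and p': "p \<in> atlas (prod_mfd M N)"
  then obtain c d where p: "p = prod_chart c d" and c: "c \<in> atlas M" and d: "d \<in> atlas N"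
    unfolding atlas_prod_mfd by blast
  let ?S = "cmap e ` {x \<in> cdom e. (F x, G x) \<in> cdom p}"
  have o: "open ?S" by (rule smooth_map_coord_open[OF P smooth_manifold_prod[OF M N] cts e p'])
  have "smooth_on ?S (\<lambda>y. cmap c (F (cinv e y)))"
    by (rule smooth_on_subset[OF smooth_map_coord[OF F e c]]) (auto simp: p)
  moreover have "smooth_on ?S (\<lambda>y. cmap d (G (cinv e y)))"
    by (rule smooth_on_subset[OF smooth_map_coord[OF G e d]]) (auto simp: p)
  ultimately show "smooth_on ?S (\<lambda>y. cmap p (F (cinv e y), G (cinv e y)))"
    using smooth_on_Pair[OF o] by (simp add: p)
qed

lemma smooth_map_const: "q \<in> carr N \<Longrightarrow> smooth_map M N (\<lambda>_. q)"
  unfolding smooth_map_def comp_def by (simp add: smooth_on_const carr_def)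

subsection \<open>The line\<close>

definition line_chart :: "(real, real) chart" where
  "line_chart = Chart UNIV id"

lemma line_chart_simps [simp]: "cdom line_chart = UNIV" "cmap line_chart t = t" "cinv line_chart t = t"
  by (simp_all add: line_chart_def cinv_def)

lemma atlas_real_mfd [simp]: "atlas real_mfd = {line_chart}"
  by (simp add: real_mfd_def line_chart_def)

lemma mtop_real_mfd [simp]: "mtop real_mfd = euclideanreal"
  by (simp add: real_mfd_def)

lemma carr_real_mfd [simp]: "carr real_mfd = UNIV"
  by (simp add: carr_def)

lemma charts_at_real_mfd [simp]: "charts_at real_mfd t = {line_chart}"
  by (auto simp: charts_at_def)

lemma smooth_manifold_real: "smooth_manifold real_mfd"
proof -
  have "cmap line_chart = id" by (simp add: line_chart_def)
  then have "is_chart euclideanreal line_chart" by (simp add: is_chart_def)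
  moreover have "second_countable euclideanreal"
  proof -
    obtain \<B> :: "real set set" where B: "countable \<B>" "\<And>C. C \<in> \<B> \<Longrightarrow> open C"
      "\<And>S. open S \<Longrightarrow> \<exists>U. U \<subseteq> \<B> \<and> S = \<Union>U"
      using univ_second_countable by blast
    show ?thesis
      unfolding second_countable_def
    proof (intro exI conjI ballI allI impI)
      show "countable \<B>" by (rule B(1))
      show "openin euclideanreal V" if "V \<in> \<B>" for V using B(2)[OF that] by simp
      fix U and x :: real assume U: "openin euclideanreal U \<and> x \<in> U"
      then obtain \<V> where "\<V> \<subseteq> \<B>" "U = \<Union>\<V>" using B(3)[of U] by auto
      then show "\<exists>V\<in>\<B>. x \<in> V \<and> V \<subseteq> U" using U by auto
    qed
  qed
  moreover have "smooth_on UNIV (cmap line_chart \<circ> cinv line_chart)"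
    by (rule smooth_on_cong[OF open_UNIV _ smooth_on_id]) simp
  moreover have "cmap line_chart ` UNIV = UNIV" by auto
  ultimately show ?thesis by (simp add: smooth_manifold_def)
qed

lemma smooth_map_line_translation: "smooth_map real_mfd real_mfd (\<lambda>t. t + a)"
  unfolding smooth_map_def comp_def
proof (intro conjI ballI)
  fix c c' assume "c \<in> atlas real_mfd" "c' \<in> atlas real_mfd"
  moreover have "smooth_on S (\<lambda>t :: real. t + a)" if "open S" for S
    by (rule smooth_on_add[OF that smooth_on_id smooth_on_const])
  moreover have "cmap line_chart ` UNIV = UNIV" by auto
  ultimately show "smooth_on (cmap c ` {t \<in> cdom c. t + a \<in> cdom c'}) (\<lambda>t. cmap c' (cinv c t + a))"
    by simp
qed (simp add: continuous_on_add continuous_on_id)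

subsection \<open>The cylinder\<close>

abbreviation cyl_chart :: "('a, 'e) chart \<Rightarrow> ('a \<times> real, 'e \<times> real) chart" where
  "cyl_chart c \<equiv> prod_chart c line_chart"

lemma smooth_manifold_cyl: "smooth_manifold M \<Longrightarrow> smooth_manifold (cyl M)"
  unfolding cyl_def by (rule smooth_manifold_prod[OF _ smooth_manifold_real])

lemma atlas_cyl: "atlas (cyl M) = cyl_chart ` atlas M"
  by (auto simp: cyl_def atlas_prod_mfd)

lemma carr_cyl: "carr (cyl M) = carr M \<times> UNIV"
  by (simp add: cyl_def carr_prod_mfd)

lemma cyl_chart_charts_at: "c \<in> charts_at M (fst p) \<Longrightarrow> cyl_chart c \<in> charts_at (cyl M) p"
  unfolding cyl_def by (rule prod_chart_charts_at) simp_all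

lemma cyl_chart_image: "cmap (cyl_chart c) ` cdom (cyl_chart c) = cmap c ` cdom c \<times> UNIV"
proof -
  have "cmap line_chart ` UNIV = UNIV" by auto
  then show ?thesis unfolding cdom_prod_chart image_prod_chart by simp
qed

lemma cinv_cyl_chart:
  "smooth_manifold M \<Longrightarrow> c \<in> atlas M \<Longrightarrow> z \<in> cmap c ` cdom c \<times> UNIV \<Longrightarrow>
    cinv (cyl_chart c) z = (cinv c (fst z), snd z)"
  using cinv_prod_chart[OF manifold_is_chart[of M c] manifold_is_chart[OF smooth_manifold_real, of line_chart]]
  by (auto simp: image_iff)

context
  fixes M :: "('a, 'e::euclidean_space) mfd"
  assumes M: "smooth_manifold M"
begin

lemma smooth_map_cyl_fst: "smooth_map (cyl M) M fst"
  unfolding cyl_def by (rule smooth_map_fst[OF M smooth_manifold_real])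

lemma smooth_map_cyl_snd: "smooth_map (cyl M) real_mfd snd"
  unfolding cyl_def by (rule smooth_map_snd[OF M smooth_manifold_real])

lemma smooth_map_cyl_slice: "smooth_map M (cyl M) (\<lambda>x. (x, t))"
  unfolding cyl_def
  by (rule smooth_map_Pair[OF M M smooth_manifold_real smooth_map_id[OF M] smooth_map_const]) simp

lemma smooth_map_cyl_fibre: "x \<in> carr M \<Longrightarrow> smooth_map real_mfd (cyl M) (\<lambda>s. (x, s))"
  unfolding cyl_def
  by (rule smooth_map_Pair[OF smooth_manifold_real M smooth_manifold_real smooth_map_const
        smooth_map_id[OF smooth_manifold_real]])

lemma cyl_proj_coord:
  assumes c: "c \<in> charts_at M (fst p)" and v: "v \<in> tangent_space (cyl M) p"
  shows "cyl_proj M p v c = fst (v (cyl_chart c))"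
proof -
  note cA = charts_atD[OF c]
  have "cyl_proj M p v c = frechet_derivative (\<lambda>z. cmap c (fst (cinv (cyl_chart c) z)))
      (at (cmap (cyl_chart c) p)) (v (cyl_chart c))"
    unfolding cyl_proj_def
    by (rule differential_coord[OF smooth_manifold_cyl[OF M] M smooth_map_cyl_fst
          cyl_chart_charts_at[OF c] c v])
  also have "frechet_derivative (\<lambda>z. cmap c (fst (cinv (cyl_chart c) z))) (at (cmap (cyl_chart c) p)) =
      frechet_derivative fst (at (cmap (cyl_chart c) p))"
  proof (rule frechet_derivative_cong)
    show "open (cmap c ` cdom c \<times> (UNIV :: real set))" by (simp add: open_Times chart_open[OF M cA(1)])
    show "cmap (cyl_chart c) p \<in> cmap c ` cdom c \<times> UNIV" using cA by simp
    show "cmap c (fst (cinv (cyl_chart c) z)) = fst z" if "z \<in> cmap c ` cdom c \<times> UNIV" for z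
      using that by (simp add: cinv_cyl_chart[OF M cA(1) that] mem_Times_iff cmap_cinv)
  qed
  also have "\<dots> = fst"
    using frechet_derivative_at[OF bounded_linear_imp_has_derivative[OF bounded_linear_fst]] by metis
  finally show ?thesis .
qed

lemma smooth_fun_cyl_snd: "smooth_fun (cyl M) (carr (cyl M)) snd"
  unfolding smooth_fun_def comp_def
proof
  fix e assume "e \<in> atlas (cyl M)"
  then obtain c where c: "c \<in> atlas M" and e: "e = cyl_chart c" by (auto simp: atlas_cyl)
  have dom: "cdom e \<inter> carr (cyl M) = cdom e" using chart_dom_carr[OF M c] by (auto simp: e carr_cyl)
  have o: "open (cmap c ` cdom c \<times> (UNIV :: real set))" by (simp add: open_Times chart_open[OF M c])
  show "smooth_on (cmap e ` (cdom e \<inter> carr (cyl M))) (\<lambda>z. snd (cinv e z))"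
    unfolding dom unfolding e cyl_chart_image
    by (rule smooth_on_cong[OF o _ smooth_on_snd[OF o smooth_on_id]]) (simp add: cinv_cyl_chart[OF M c])
qed

lemma cyl_dt_coord:
  assumes c: "c \<in> charts_at M (fst p)" and v: "v \<in> tangent_space (cyl M) p"
  shows "cyl_dt M p v = snd (v (cyl_chart c))"
proof -
  note cA = charts_atD[OF c]
  have pc: "p \<in> carr (cyl M)" using charts_at_carr[OF M c] by (simp add: carr_cyl mem_Times_iff)
  have op: "openin (mtop (cyl M)) (carr (cyl M))" by (simp add: carr_def)
  have "cyl_dt M p v = frechet_derivative (\<lambda>z. snd (cinv (cyl_chart c) z))
      (at (cmap (cyl_chart c) p)) (v (cyl_chart c))"
    unfolding cyl_dt_def
    by (rule dderiv_coord[OF smooth_manifold_cyl[OF M] smooth_fun_cyl_snd op pc cyl_chart_charts_at[OF c] v])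
  also have "frechet_derivative (\<lambda>z. snd (cinv (cyl_chart c) z)) (at (cmap (cyl_chart c) p)) =
      frechet_derivative snd (at (cmap (cyl_chart c) p))"
  proof (rule frechet_derivative_cong)
    show "open (cmap c ` cdom c \<times> (UNIV :: real set))" by (simp add: open_Times chart_open[OF M cA(1)])
    show "cmap (cyl_chart c) p \<in> cmap c ` cdom c \<times> UNIV" using cA by simp
    show "snd (cinv (cyl_chart c) z) = snd z" if "z \<in> cmap c ` cdom c \<times> UNIV" for z
      by (simp add: cinv_cyl_chart[OF M cA(1) that])
  qed
  also have "\<dots> = snd"
    using frechet_derivative_at[OF bounded_linear_imp_has_derivative[OF bounded_linear_snd]] by metis
  finally show ?thesis .
qed

lemma cyl_lift_coord:
  assumes c: "c \<in> charts_at M (fst p)" and w: "w \<in> tangent_space M (fst p)"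
  shows "cyl_lift M p w (cyl_chart c) = (w c, 0)"
proof -
  note cA = charts_atD[OF c]
  have cp: "cyl_chart c \<in> charts_at (cyl M) (fst p, snd p)" using cyl_chart_charts_at[OF c] by simp
  have "cyl_lift M p w (cyl_chart c) =
      frechet_derivative (\<lambda>y. cmap (cyl_chart c) (cinv c y, snd p)) (at (cmap c (fst p))) (w c)"
    unfolding cyl_lift_def
    by (rule differential_coord[OF M smooth_manifold_cyl[OF M] smooth_map_cyl_slice c cp w])
  also have "frechet_derivative (\<lambda>y. cmap (cyl_chart c) (cinv c y, snd p)) (at (cmap c (fst p))) =
      frechet_derivative (\<lambda>y. (y, snd p)) (at (cmap c (fst p)))"
    by (rule frechet_derivative_cong[OF chart_open[OF M cA(1)]]) (use cA in \<open>auto simp: cmap_cinv\<close>)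
  also have "\<dots> = (\<lambda>v. (v, 0))"
    by (rule frechet_derivative_at[symmetric]) (auto intro!: derivative_eq_intros)
  finally show ?thesis .
qed

lemma cyl_dt_vfield_coord:
  assumes c: "c \<in> charts_at M (fst p)"
  shows "cyl_dt_vfield M p (cyl_chart c) = (0, 1)"
proof -
  have cp: "cyl_chart c \<in> charts_at (cyl M) (fst p, snd p)" using cyl_chart_charts_at[OF c] by simp
  have "real_unit_vfield (snd p) = tvec real_mfd line_chart (snd p) 1"
    by (auto simp: real_unit_vfield_def tvec_def)
  then have u: "real_unit_vfield (snd p) \<in> tangent_space real_mfd (snd p)"
    using tvec_mem[OF smooth_manifold_real, of line_chart "snd p" 1] by simp
  have "cyl_dt_vfield M p (cyl_chart c) =
      frechet_derivative (\<lambda>s. cmap (cyl_chart c) (fst p, cinv line_chart s))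
        (at (cmap line_chart (snd p))) (real_unit_vfield (snd p) line_chart)"
    unfolding cyl_dt_vfield_def
    by (rule differential_coord[OF smooth_manifold_real smooth_manifold_cyl[OF M]
          smooth_map_cyl_fibre[OF charts_at_carr[OF M c]] _ cp u]) simp
  also have "\<dots> = frechet_derivative (\<lambda>s. (cmap c (fst p), s)) (at (snd p)) 1"
    by (simp add: real_unit_vfield_def)
  also have "frechet_derivative (\<lambda>s. (cmap c (fst p), s)) (at (snd p)) = (\<lambda>s. (0, s))"
    by (rule frechet_derivative_at[symmetric]) (auto intro!: derivative_eq_intros)
  finally show ?thesis .
qed

end

subsection \<open>The structure of the cylinder in coordinates\<close>

lemma cyl_charts_atE:
  assumes "e \<in> charts_at (cyl M) p"
  obtains c where "c \<in> charts_at M (fst p)" "e = cyl_chart c"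
  using assms by (auto simp: charts_at_def atlas_cyl mem_Times_iff)

lemma cyl_proj_mem:
  "smooth_manifold M \<Longrightarrow> p \<in> carr (cyl M) \<Longrightarrow> v \<in> tangent_space (cyl M) p \<Longrightarrow>
    cyl_proj M p v \<in> tangent_space M (fst p)"
  unfolding cyl_proj_def by (rule differential_mem[OF smooth_manifold_cyl _ smooth_map_cyl_fst])

lemma cyl_lift_mem:
  assumes "smooth_manifold M" "p \<in> carr (cyl M)" "w \<in> tangent_space M (fst p)"
  shows "cyl_lift M p w \<in> tangent_space (cyl M) p"
proof -
  have "fst p \<in> carr M" using assms(2) by (auto simp: carr_cyl)
  from differential_mem[OF assms(1) smooth_manifold_cyl[OF assms(1)] smooth_map_cyl_slice[OF assms(1)] this
      assms(3), of "snd p"]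
  show ?thesis by (simp add: cyl_lift_def)
qed

lemma cyl_dt_vfield_mem:
  assumes M: "smooth_manifold M" and p: "p \<in> carr (cyl M)"
  shows "cyl_dt_vfield M p \<in> tangent_space (cyl M) p"
proof -
  have p1: "fst p \<in> carr M" using p by (auto simp: carr_cyl)
  have "real_unit_vfield (snd p) = tvec real_mfd line_chart (snd p) 1"
    by (auto simp: real_unit_vfield_def tvec_def)
  then have u: "real_unit_vfield (snd p) \<in> tangent_space real_mfd (snd p)"
    using tvec_mem[OF smooth_manifold_real, of line_chart "snd p" 1] by simp
  from differential_mem[OF smooth_manifold_real smooth_manifold_cyl[OF M] smooth_map_cyl_fibre[OF M p1] _ u]
  show ?thesis by (simp add: cyl_dt_vfield_def)
qed

lemma cyl_tvec:
  assumes M: "smooth_manifold M" and c: "c \<in> atlas M" and z: "z \<in> cmap c ` cdom c \<times> UNIV"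
  shows "cyl_proj M (cinv (cyl_chart c) z) (tvec (cyl M) (cyl_chart c) (cinv (cyl_chart c) z) V) =
      tvec M c (cinv c (fst z)) (fst V)"
    and "cyl_dt M (cinv (cyl_chart c) z) (tvec (cyl M) (cyl_chart c) (cinv (cyl_chart c) z) V) = snd V"
    and "fst (cinv (cyl_chart c) z) = cinv c (fst z)"
proof -
  have y: "fst z \<in> cmap c ` cdom c" using z by auto
  define p where "p = cinv (cyl_chart c) z"
  have p: "p = (cinv c (fst z), snd z)" unfolding p_def by (rule cinv_cyl_chart[OF M c z])
  have c': "c \<in> charts_at M (fst p)" using cinv_charts_at[OF c y] by (simp add: p)
  note e = cyl_chart_charts_at[OF c']
  note v = tvec_mem[OF smooth_manifold_cyl[OF M] e, of V]
  have pc: "p \<in> carr (cyl M)" by (rule charts_at_carr[OF smooth_manifold_cyl[OF M] e])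
  let ?v = "tvec (cyl M) (cyl_chart c) p V"
  have "cyl_proj M p ?v = tvec M c (fst p) (fst V)"
    by (rule tangent_eqI[OF M c' cyl_proj_mem[OF M pc v] tvec_mem[OF M c']])
      (simp add: cyl_proj_coord[OF M c' v] tvec_self[OF M c'] tvec_self[OF smooth_manifold_cyl[OF M] e])
  moreover have "cyl_dt M p ?v = snd V"
    by (simp add: cyl_dt_coord[OF M c' v] tvec_self[OF smooth_manifold_cyl[OF M] e])
  ultimately show "cyl_proj M (cinv (cyl_chart c) z) (tvec (cyl M) (cyl_chart c) (cinv (cyl_chart c) z) V) =
      tvec M c (cinv c (fst z)) (fst V)"
    "cyl_dt M (cinv (cyl_chart c) z) (tvec (cyl M) (cyl_chart c) (cinv (cyl_chart c) z) V) = snd V"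
    "fst (cinv (cyl_chart c) z) = cinv c (fst z)"
    unfolding p_def[symmetric] by (simp_all add: p)
qed

context
  fixes M :: "('a, 'e::euclidean_space) mfd" and \<phi> :: "('a, 'e) endo" and \<xi> :: "('a, 'e) vfield"
    and \<eta> :: "('a, 'e) form1"
  assumes M: "smooth_manifold M" and T\<phi>: "endo_tangent M \<phi>"
    and T\<xi>: "\<And>x. x \<in> carr M \<Longrightarrow> \<xi> x \<in> tangent_space M x"
begin

lemma endo_tangent_cyl_J: "endo_tangent (cyl M) (cyl_J M \<phi> \<xi> \<eta>)"
  unfolding endo_tangent_def
proof (intro ballI)
  fix p v assume p: "p \<in> carr (cyl M)" and v: "v \<in> tangent_space (cyl M) p"
  have x: "fst p \<in> carr M" using p by (auto simp: carr_cyl)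
  note C = smooth_manifold_cyl[OF M]
  have "\<phi> (fst p) (cyl_proj M p v) \<in> tangent_space M (fst p)"
    using T\<phi> x cyl_proj_mem[OF M p v] by (simp add: endo_tangent_def)
  then show "cyl_J M \<phi> \<xi> \<eta> p v \<in> tangent_space (cyl M) p"
    unfolding cyl_J_def
    by (intro tangent_add[OF C] tangent_diff[OF C] tangent_scale[OF C] cyl_lift_mem[OF M p]
        cyl_dt_vfield_mem[OF M p] T\<xi>[OF x])
qed

lemma cyl_J_coord:
  assumes c: "c \<in> charts_at M (fst p)" and v: "v \<in> tangent_space (cyl M) p"
  shows "cyl_J M \<phi> \<xi> \<eta> p v (cyl_chart c) =
    (\<phi> (fst p) (cyl_proj M p v) c + cyl_dt M p v *\<^sub>R \<xi> (fst p) c, - \<eta> (fst p) (cyl_proj M p v))"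
proof -
  have x: "fst p \<in> carr M" by (rule charts_at_carr[OF M c])
  then have p: "p \<in> carr (cyl M)" by (simp add: carr_cyl mem_Times_iff)
  have "\<phi> (fst p) (cyl_proj M p v) \<in> tangent_space M (fst p)"
    using T\<phi> x cyl_proj_mem[OF M p v] by (simp add: endo_tangent_def)
  then show ?thesis
    by (simp add: cyl_J_def cyl_lift_coord[OF M c] T\<xi>[OF x] cyl_dt_vfield_coord[OF M c])
qed

lemma cyl_J_coord_endo:
  assumes c: "c \<in> atlas M" and z: "z \<in> cmap c ` cdom c \<times> UNIV"
  shows "coord_endo (cyl M) (cyl_chart c) (cyl_J M \<phi> \<xi> \<eta>) z V =
    cyl_coord_J (coord_endo M c \<phi>) (\<lambda>y. \<xi> (cinv c y) c) (coord_form M c \<eta>) z V"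
proof -
  have y: "fst z \<in> cmap c ` cdom c" using z by auto
  have c': "c \<in> charts_at M (fst (cinv (cyl_chart c) z))"
    unfolding cyl_tvec(3)[OF M c z] by (rule cinv_charts_at[OF c y])
  show ?thesis
    unfolding coord_endo_def[of "cyl M"]
      cyl_J_coord[OF c' tvec_mem[OF smooth_manifold_cyl[OF M] cyl_chart_charts_at[OF c']]] cyl_tvec[OF M c z]
    by (simp add: cyl_coord_J_def coord_endo_def coord_form_def)
qed

end

lemma cyl_quasi_vaisman_coords:
  assumes M: "smooth_manifold M" and Q: "quasi_sasakian M \<phi> \<xi> \<eta> h" and e: "e \<in> atlas (cyl M)"
  shows "quasi_vaisman_coords (cmap e ` cdom e) (coord_endo (cyl M) e (cyl_J M \<phi> \<xi> \<eta>))
    (coord_form2 (cyl M) e (cyl_metric M h)) (coord_form (cyl M) e (cyl_dt M)) (0, 1)"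
proof -
  obtain c where c: "c \<in> atlas M" and ec: "e = cyl_chart c" using e by (auto simp: atlas_cyl)
  have T: "endo_tangent M \<phi>" and V: "vector_field M (carr M) \<xi>"
    using Q by (auto simp: quasi_sasakian_def almost_contact_metric_def intro: endomorphism_field_tangent)
  let ?S = "cmap c ` cdom c"
  have im: "cmap e ` cdom e = ?S \<times> UNIV" unfolding ec by (rule cyl_chart_image)
  have o: "open (?S \<times> (UNIV :: real set))" by (simp add: open_Times chart_open[OF M c])
  show ?thesis
    unfolding im
  proof (rule quasi_vaisman_coords_restrict[OF quasi_vaisman_coords_cylinder[OF chart_open[OF M c]
          quasi_sasakian_coordsI[OF M Q c]] o order_refl])
    fix z :: "'b \<times> real" and V W assume z: "z \<in> ?S \<times> UNIV"
    show "cyl_coord_J (coord_endo M c \<phi>) (\<lambda>y. \<xi> (cinv c y) c) (coord_form M c \<eta>) z V =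
        coord_endo (cyl M) e (cyl_J M \<phi> \<xi> \<eta>) z V"
      unfolding ec by (rule cyl_J_coord_endo[OF M T vector_field_mem[OF \<open>vector_field M (carr M) \<xi>\<close>] c z, symmetric])
    show "cyl_coord_g (coord_form2 M c h) z V W = coord_form2 (cyl M) e (cyl_metric M h) z V W"
      unfolding ec coord_form2_def[of "cyl M"] cyl_metric_def cyl_tvec[OF M c z]
      by (simp add: cyl_coord_g_def coord_form2_def)
    show "snd V = coord_form (cyl M) e (cyl_dt M) z V"
      unfolding ec coord_form_def cyl_tvec[OF M c z] ..
  qed
qed

theorem quasi_vaisman_cyl:
  assumes M: "smooth_manifold M" and Q: "quasi_sasakian M \<phi> \<xi> \<eta> h"
  shows "quasi_vaisman (cyl M) (cyl_J M \<phi> \<xi> \<eta>) (cyl_metric M h) (cyl_dt M)"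
proof (rule quasi_vaismanI[OF smooth_manifold_cyl[OF M] _ cyl_dt_vfield_mem[OF M] _
      cyl_quasi_vaisman_coords[OF M Q]])
  have T: "endo_tangent M \<phi>" and V: "vector_field M (carr M) \<xi>"
    using Q by (auto simp: quasi_sasakian_def almost_contact_metric_def intro: endomorphism_field_tangent)
  show "endo_tangent (cyl M) (cyl_J M \<phi> \<xi> \<eta>)"
    by (rule endo_tangent_cyl_J[OF M T vector_field_mem[OF V]])
  fix p e assume "e \<in> charts_at (cyl M) p"
  then obtain c where "c \<in> charts_at M (fst p)" "e = cyl_chart c" by (rule cyl_charts_atE)
  then show "cyl_dt_vfield M p e = (0, 1)" by (simp add: cyl_dt_vfield_coord[OF M])
qed

section \<open>Invariance of the structure of the cylinder\<close>

definition cyl_map :: "('a \<Rightarrow> 'a) \<Rightarrow> real \<Rightarrow> 'a \<times> real \<Rightarrow> 'a \<times> real" where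
  "cyl_map F b p = (F (fst p), snd p + b)"

lemma torus_action_eq: "torus_action M f a k = cyl_map (int_iterate (carr M) f k) (of_int k * a)"
  by (auto simp: torus_action_def cyl_map_def)

context
  fixes M :: "('a, 'e::euclidean_space) mfd" and F :: "'a \<Rightarrow> 'a" and b :: real
  assumes M: "smooth_manifold M" and F: "smooth_map M M F"
begin

lemma smooth_map_cyl_map: "smooth_map (cyl M) (cyl M) (cyl_map F b)"
proof -
  note C = smooth_manifold_cyl[OF M]
  have "smooth_map (cyl M) M (\<lambda>p. F (fst p))"
    by (rule smooth_map_compose[OF C M M smooth_map_cyl_fst[OF M] F])
  moreover have "smooth_map (cyl M) real_mfd (\<lambda>p. snd p + b)"
    by (rule smooth_map_compose[OF C smooth_manifold_real smooth_manifold_real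
          smooth_map_cyl_snd[OF M] smooth_map_line_translation])
  ultimately have "smooth_map (cyl M) (prod_mfd M real_mfd) (\<lambda>p. (F (fst p), snd p + b))"
    by (rule smooth_map_Pair[OF C M smooth_manifold_real])
  then show ?thesis by (simp add: cyl_def cyl_map_def[abs_def])
qed

text \<open>With respect to \<open>T(M \<times> \<real>) = TM \<oplus> T\<real>\<close> the differential is \<open>dF\<close> plus the identity. This one formula
  gives the invariance of all structure tensors.\<close>

lemma cyl_map_differential_coord:
  assumes p: "p \<in> carr (cyl M)" and v: "v \<in> tangent_space (cyl M) p"
    and d: "d \<in> charts_at M (F (fst p))"
  shows "differential (cyl M) (cyl M) (cyl_map F b) p v (cyl_chart d) =
    (differential M M F (fst p) (cyl_proj M p v) d, cyl_dt M p v)"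
proof -
  have x: "fst p \<in> carr M" using p by (auto simp: carr_cyl)
  obtain c where c: "c \<in> charts_at M (fst p)" using chart_at_mem[OF M x] by blast
  note cA = charts_atD[OF c]
  note C = smooth_manifold_cyl[OF M]
  have d': "cyl_chart d \<in> charts_at (cyl M) (cyl_map F b p)"
    by (rule cyl_chart_charts_at) (simp add: d cyl_map_def)
  let ?F = "\<lambda>y. cmap d (F (cinv c y))"
  let ?G = "\<lambda>z. (?F (fst z), snd z + b)"
  have F': "(?F has_derivative frechet_derivative ?F (at (cmap c (fst p)))) (at (fst (cmap (cyl_chart c) p)))"
    using smooth_map_coord_differentiable[OF M F c d] by (simp add: frechet_derivative_works)
  have hd: "(?G has_derivative (\<lambda>v. (frechet_derivative ?F (at (cmap c (fst p))) (fst v), snd v)))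
      (at (cmap (cyl_chart c) p))"
  proof (rule has_derivative_Pair)
    show "((\<lambda>z. ?F (fst z)) has_derivative (\<lambda>v. frechet_derivative ?F (at (cmap c (fst p))) (fst v)))
        (at (cmap (cyl_chart c) p))"
      using bounded_linear_imp_has_derivative[OF bounded_linear_fst] F' by (rule has_derivative_compose)
    show "((\<lambda>z. snd z + b) has_derivative snd) (at (cmap (cyl_chart c) p))"
      by (auto intro!: derivative_eq_intros bounded_linear_imp_has_derivative bounded_linear_snd)
  qed
  have "differential (cyl M) (cyl M) (cyl_map F b) p v (cyl_chart d) =
      frechet_derivative (\<lambda>z. cmap (cyl_chart d) (cyl_map F b (cinv (cyl_chart c) z)))
        (at (cmap (cyl_chart c) p)) (v (cyl_chart c))"
    by (rule differential_coord[OF C C smooth_map_cyl_map cyl_chart_charts_at[OF c] d' v])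
  also have "frechet_derivative (\<lambda>z. cmap (cyl_chart d) (cyl_map F b (cinv (cyl_chart c) z)))
        (at (cmap (cyl_chart c) p)) = frechet_derivative ?G (at (cmap (cyl_chart c) p))"
  proof (rule frechet_derivative_cong)
    show "open (cmap c ` cdom c \<times> (UNIV :: real set))" by (simp add: open_Times chart_open[OF M cA(1)])
    show "cmap (cyl_chart c) p \<in> cmap c ` cdom c \<times> UNIV" using cA by simp
    show "cmap (cyl_chart d) (cyl_map F b (cinv (cyl_chart c) z)) = ?G z"
      if "z \<in> cmap c ` cdom c \<times> UNIV" for z
      by (simp add: cinv_cyl_chart[OF M cA(1) that] cyl_map_def)
  qed
  also have "\<dots> = (\<lambda>v. (frechet_derivative ?F (at (cmap c (fst p))) (fst v), snd v))"
    by (rule frechet_derivative_at[OF hd, symmetric])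
  finally show ?thesis
    by (simp add: differential_coord[OF M M F c d cyl_proj_mem[OF M p v]] cyl_proj_coord[OF M c v]
        cyl_dt_coord[OF M c v])
qed

lemma cyl_map_carr: "p \<in> carr (cyl M) \<Longrightarrow> cyl_map F b p \<in> carr (cyl M)"
  by (rule smooth_map_carr[OF smooth_map_cyl_map])

lemma cyl_map_differential:
  assumes p: "p \<in> carr (cyl M)" and v: "v \<in> tangent_space (cyl M) p"
  shows "cyl_proj M (cyl_map F b p) (differential (cyl M) (cyl M) (cyl_map F b) p v) =
      differential M M F (fst p) (cyl_proj M p v)"
    and "cyl_dt M (cyl_map F b p) (differential (cyl M) (cyl M) (cyl_map F b) p v) = cyl_dt M p v"
proof -
  have x: "fst p \<in> carr M" using p by (auto simp: carr_cyl)
  note C = smooth_manifold_cyl[OF M]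
  obtain d where d: "d \<in> charts_at M (F (fst p))"
    using chart_at_mem[OF M smooth_map_carr[OF F x]] by blast
  then have d': "d \<in> charts_at M (fst (cyl_map F b p))" by (simp add: cyl_map_def)
  note dv = differential_mem[OF C C smooth_map_cyl_map p v]
  have "cyl_proj M (cyl_map F b p) (differential (cyl M) (cyl M) (cyl_map F b) p v) \<in> tangent_space M (F (fst p))"
    using cyl_proj_mem[OF M cyl_map_carr[OF p] dv] by (simp add: cyl_map_def)
  then show "cyl_proj M (cyl_map F b p) (differential (cyl M) (cyl M) (cyl_map F b) p v) =
      differential M M F (fst p) (cyl_proj M p v)"
    by (rule tangent_eqI[OF M d _ differential_mem[OF M M F x cyl_proj_mem[OF M p v]]])
      (simp add: cyl_proj_coord[OF M d' dv] cyl_map_differential_coord[OF p v d])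
  show "cyl_dt M (cyl_map F b p) (differential (cyl M) (cyl M) (cyl_map F b) p v) = cyl_dt M p v"
    by (simp add: cyl_dt_coord[OF M d' dv] cyl_map_differential_coord[OF p v d])
qed

lemma cyl_map_preserves:
  assumes T\<phi>: "endo_tangent M \<phi>" and T\<xi>: "\<And>x. x \<in> carr M \<Longrightarrow> \<xi> x \<in> tangent_space M x"
    and P: "preserves_almost_contact_metric M F \<phi> \<xi> \<eta> h"
  shows "preserves_quasi_vaisman (cyl M) (cyl_map F b) (cyl_J M \<phi> \<xi> \<eta>) (cyl_metric M h) (cyl_dt M)"
    and "preserves_vfield (cyl M) (cyl_map F b) (cyl_dt_vfield M)"
proof -
  note C = smooth_manifold_cyl[OF M]
  have P\<phi>: "differential M M F x (\<phi> x v) = \<phi> (F x) (differential M M F x v)"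
    and P\<eta>: "\<eta> (F x) (differential M M F x v) = \<eta> x v"
    and Ph: "w \<in> tangent_space M x \<Longrightarrow> h (F x) (differential M M F x v) (differential M M F x w) = h x v w"
    and P\<xi>: "differential M M F x (\<xi> x) = \<xi> (F x)"
    if "x \<in> carr M" "v \<in> tangent_space M x" for x v w
    using P that unfolding preserves_almost_contact_metric_def preserves_endo_def preserves_form1_def
      preserves_metric_def preserves_vfield_def by auto
  let ?D = "differential (cyl M) (cyl M) (cyl_map F b)" and ?J = "cyl_J M \<phi> \<xi> \<eta>"
  note TJ = endo_tangent_cyl_J[OF M T\<phi> T\<xi>]
  have "?D p (?J p v) = ?J (cyl_map F b p) (?D p v)"
    if p: "p \<in> carr (cyl M)" and v: "v \<in> tangent_space (cyl M) p" for p v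
  proof -
    have x: "fst p \<in> carr M" using p by (auto simp: carr_cyl)
    obtain c where c: "c \<in> charts_at M (fst p)" using chart_at_mem[OF M x] by blast
    obtain d where d: "d \<in> charts_at M (F (fst p))"
      using chart_at_mem[OF M smooth_map_carr[OF F x]] by blast
    then have d': "d \<in> charts_at M (fst (cyl_map F b p))" by (simp add: cyl_map_def)
    have Jv: "?J p v \<in> tangent_space (cyl M) p" using TJ p v by (simp add: endo_tangent_def)
    note DJv = differential_mem[OF C C smooth_map_cyl_map p Jv]
    note Dv = differential_mem[OF C C smooth_map_cyl_map p v]
    have JDv: "?J (cyl_map F b p) (?D p v) \<in> tangent_space (cyl M) (cyl_map F b p)"
      using TJ cyl_map_carr[OF p] Dv by (simp add: endo_tangent_def)
    let ?w = "cyl_proj M p v"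
    note w = cyl_proj_mem[OF M p v]
    have \<phi>w: "\<phi> (fst p) ?w \<in> tangent_space M (fst p)" using T\<phi> x w by (simp add: endo_tangent_def)
    note t\<xi> = tangent_scale[OF M T\<xi>[OF x], of "cyl_dt M p v"]
    have pJ: "cyl_proj M p (?J p v) = \<phi> (fst p) ?w + cyl_dt M p v *\<^sub>T \<xi> (fst p)"
      by (rule tangent_eqI[OF M c cyl_proj_mem[OF M p Jv] tangent_add[OF M \<phi>w t\<xi>]])
        (simp add: cyl_proj_coord[OF M c Jv] cyl_J_coord[OF M T\<phi> T\<xi> c v])
    let ?x = "fst (cyl_map F b p)" and ?v = "cyl_proj M (cyl_map F b p) (?D p v)"
    have JD: "?J (cyl_map F b p) (?D p v) (cyl_chart d) =
        (\<phi> ?x ?v d + cyl_dt M (cyl_map F b p) (?D p v) *\<^sub>R \<xi> ?x d, - \<eta> ?x ?v)"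
      by (rule cyl_J_coord[OF M T\<phi> T\<xi> d' Dv])
    have "?D p (?J p v) (cyl_chart d) = ?J (cyl_map F b p) (?D p v) (cyl_chart d)"
      unfolding cyl_map_differential_coord[OF p Jv d] JD
        cyl_map_differential[OF p v] pJ differential_linear(1)[OF M M F x \<phi>w t\<xi>]
        differential_linear(2)[OF M M F x T\<xi>[OF x]] P\<phi>[OF x w]
      using P\<xi>[OF x w] P\<eta>[OF x w]
      by (simp add: cyl_map_def cyl_dt_coord[OF M c Jv] cyl_J_coord[OF M T\<phi> T\<xi> c v])
    then show ?thesis
      by (rule tangent_eqI[OF C cyl_chart_charts_at[OF d'] DJv JDv])
  qed
  moreover have "cyl_metric M h (cyl_map F b p) (?D p v) (?D p w) = cyl_metric M h p v w"
    if p: "p \<in> carr (cyl M)" and v: "v \<in> tangent_space (cyl M) p" and w: "w \<in> tangent_space (cyl M) p" for p v w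
  proof -
    have x: "fst p \<in> carr M" using p by (auto simp: carr_cyl)
    show ?thesis
      unfolding cyl_metric_def cyl_map_differential[OF p v] cyl_map_differential[OF p w]
      using Ph[OF x cyl_proj_mem[OF M p v] cyl_proj_mem[OF M p w]] by (simp add: cyl_map_def)
  qed
  moreover have "cyl_dt M (cyl_map F b p) (?D p v) = cyl_dt M p v"
    if p: "p \<in> carr (cyl M)" and v: "v \<in> tangent_space (cyl M) p" for p v
    by (rule cyl_map_differential(2)[OF p v])
  ultimately show "preserves_quasi_vaisman (cyl M) (cyl_map F b) ?J (cyl_metric M h) (cyl_dt M)"
    by (simp add: preserves_quasi_vaisman_def preserves_endo_def preserves_metric_def preserves_form1_def)
  show "preserves_vfield (cyl M) (cyl_map F b) (cyl_dt_vfield M)"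
    unfolding preserves_vfield_def
  proof
    fix p assume p: "p \<in> carr (cyl M)"
    have x: "fst p \<in> carr M" using p by (auto simp: carr_cyl)
    obtain c where c: "c \<in> charts_at M (fst p)" using chart_at_mem[OF M x] by blast
    obtain d where d: "d \<in> charts_at M (F (fst p))"
      using chart_at_mem[OF M smooth_map_carr[OF F x]] by blast
    then have d': "d \<in> charts_at M (fst (cyl_map F b p))" by (simp add: cyl_map_def)
    note u = cyl_dt_vfield_mem[OF M p]
    have "cyl_proj M p (cyl_dt_vfield M p) = 0"
      by (rule tangent_eqI[OF M c cyl_proj_mem[OF M p u] tangent_zero[OF M]])
        (simp add: cyl_proj_coord[OF M c u] cyl_dt_vfield_coord[OF M c])
    moreover have "differential M M F (fst p) 0 = 0"
      using differential_linear(2)[OF M M F x tangent_zero[OF M], of 0] by (simp add: tscale_def zero_fun_def)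
    ultimately have "?D p (cyl_dt_vfield M p) (cyl_chart d) = cyl_dt_vfield M (cyl_map F b p) (cyl_chart d)"
      by (simp add: cyl_map_differential_coord[OF p u d] cyl_dt_vfield_coord[OF M d']
          cyl_dt_coord[OF M c u] cyl_dt_vfield_coord[OF M c])
    then show "?D p (cyl_dt_vfield M p) = cyl_dt_vfield M (cyl_map F b p)"
      by (rule tangent_eqI[OF C cyl_chart_charts_at[OF d'] differential_mem[OF C C smooth_map_cyl_map p u]
            cyl_dt_vfield_mem[OF M cyl_map_carr[OF p]]])
  qed
qed

end

subsection \<open>Iterates of a diffeomorphism\<close>

lemma preserves_almost_contact_metric_compose:
  assumes M: "smooth_manifold M" and F: "smooth_map M M F" and G: "smooth_map M M G"
    and T\<phi>: "endo_tangent M \<phi>" and T\<xi>: "\<And>x. x \<in> carr M \<Longrightarrow> \<xi> x \<in> tangent_space M x"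
    and PF: "preserves_almost_contact_metric M F \<phi> \<xi> \<eta> h"
    and PG: "preserves_almost_contact_metric M G \<phi> \<xi> \<eta> h"
  shows "preserves_almost_contact_metric M (\<lambda>x. G (F x)) \<phi> \<xi> \<eta> h"
proof -
  have t: "\<phi> x v \<in> tangent_space M x" if "x \<in> carr M" "v \<in> tangent_space M x" for x v
    using T\<phi> that by (simp add: endo_tangent_def)
  note d = differential_compose[OF M M M F G] and m = differential_mem[OF M M F] and c = smooth_map_carr[OF F]
  show ?thesis
    using PF PG
    by (simp add: preserves_almost_contact_metric_def preserves_endo_def preserves_vfield_def
        preserves_form1_def preserves_metric_def d m c t T\<xi>)
qed

text \<open>Invariance under \<open>F\<close> is read backwards: each tangent vector at \<open>x\<close> is the image under \<open>dF\<close> of its image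
  under \<open>dG\<close>.\<close>

lemma preserves_almost_contact_metric_inverse:
  assumes M: "smooth_manifold M" and F: "smooth_map M M F" and G: "smooth_map M M G"
    and inv: "\<And>x. x \<in> carr M \<Longrightarrow> F (G x) = x" "\<And>x. x \<in> carr M \<Longrightarrow> G (F x) = x"
    and T\<phi>: "endo_tangent M \<phi>" and T\<xi>: "\<And>x. x \<in> carr M \<Longrightarrow> \<xi> x \<in> tangent_space M x"
    and P: "preserves_almost_contact_metric M F \<phi> \<xi> \<eta> h"
  shows "preserves_almost_contact_metric M G \<phi> \<xi> \<eta> h"
proof -
  have t: "\<phi> x v \<in> tangent_space M x" if "x \<in> carr M" "v \<in> tangent_space M x" for x v
    using T\<phi> that by (simp add: endo_tangent_def)
  note c = smooth_map_carr[OF G] and mG = differential_mem[OF M M G]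
  have FG: "differential M M F (G x) (differential M M G x v) = v"
    if x: "x \<in> carr M" and v: "v \<in> tangent_space M x" for x v
    using differential_compose[OF M M M G F x v] differential_cong[OF M, of "\<lambda>x. F (G x)" "\<lambda>x. x" x M v]
      inv(1) x differential_ident[OF M x v] by simp
  have GF: "differential M M G (F x) (differential M M F x v) = v"
    if x: "x \<in> carr M" and v: "v \<in> tangent_space M x" for x v
    using differential_compose[OF M M M F G x v] differential_cong[OF M, of "\<lambda>x. G (F x)" "\<lambda>x. x" x M v]
      inv(2) x differential_ident[OF M x v] by simp
  have P\<phi>: "differential M M F y (\<phi> y u) = \<phi> (F y) (differential M M F y u)"
    and P\<eta>: "\<eta> (F y) (differential M M F y u) = \<eta> y u"
    and Ph: "u' \<in> tangent_space M y \<Longrightarrow> h (F y) (differential M M F y u) (differential M M F y u') = h y u u'"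
    and P\<xi>: "differential M M F y (\<xi> y) = \<xi> (F y)"
    if "y \<in> carr M" "u \<in> tangent_space M y" for y u u'
    using P that unfolding preserves_almost_contact_metric_def preserves_endo_def preserves_form1_def
      preserves_metric_def preserves_vfield_def by auto
  let ?dG = "differential M M G"
  have "?dG x (\<phi> x v) = \<phi> (G x) (?dG x v)" if x: "x \<in> carr M" and v: "v \<in> tangent_space M x" for x v
    using GF[OF c[OF x] t[OF c[OF x] mG[OF x v]]] P\<phi>[OF c[OF x] mG[OF x v]]
    by (simp add: FG[OF x v] inv(1)[OF x])
  moreover have "?dG x (\<xi> x) = \<xi> (G x)" if x: "x \<in> carr M" for x
    using GF[OF c[OF x] T\<xi>[OF c[OF x]]] P\<xi>[OF c[OF x] T\<xi>[OF c[OF x]]] by (simp add: inv(1)[OF x])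
  moreover have "\<eta> (G x) (?dG x v) = \<eta> x v" if x: "x \<in> carr M" and v: "v \<in> tangent_space M x" for x v
    using P\<eta>[OF c[OF x] mG[OF x v]] by (simp add: FG[OF x v] inv(1)[OF x])
  moreover have "h (G x) (?dG x v) (?dG x w) = h x v w"
    if x: "x \<in> carr M" and v: "v \<in> tangent_space M x" and w: "w \<in> tangent_space M x" for x v w
    using Ph[OF c[OF x] mG[OF x v] mG[OF x w]] by (simp add: FG[OF x v] FG[OF x w] inv(1)[OF x])
  ultimately show ?thesis
    by (simp add: preserves_almost_contact_metric_def preserves_endo_def preserves_vfield_def
        preserves_form1_def preserves_metric_def)
qed

lemma funpow_smooth_preserves:
  assumes M: "smooth_manifold M" and F: "smooth_map M M F"
    and T\<phi>: "endo_tangent M \<phi>" and T\<xi>: "\<And>x. x \<in> carr M \<Longrightarrow> \<xi> x \<in> tangent_space M x"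
    and P: "preserves_almost_contact_metric M F \<phi> \<xi> \<eta> h"
  shows "smooth_map M M (F ^^ n) \<and> preserves_almost_contact_metric M (F ^^ n) \<phi> \<xi> \<eta> h"
proof (induction n)
  case 0
  have t: "\<phi> x v \<in> tangent_space M x" if "x \<in> carr M" "v \<in> tangent_space M x" for x v
    using T\<phi> that by (simp add: endo_tangent_def)
  have "preserves_almost_contact_metric M (\<lambda>x. x) \<phi> \<xi> \<eta> h"
    by (simp add: preserves_almost_contact_metric_def preserves_endo_def preserves_vfield_def
        preserves_form1_def preserves_metric_def differential_ident[OF M] t T\<xi>)
  then show ?case using smooth_map_id[OF M] by (simp add: id_def)
next
  case (Suc n)
  have "F ^^ Suc n = (\<lambda>x. F ((F ^^ n) x))" by auto
  then show ?case
    using smooth_map_compose[OF M M M _ F] preserves_almost_contact_metric_compose[OF M _ F T\<phi> T\<xi> _ P] Suc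
    by metis
qed

context
  fixes M :: "('a, 'e::euclidean_space) mfd" and f :: "'a \<Rightarrow> 'a"
  assumes M: "smooth_manifold M" and f: "diffeomorphism M M f"
begin

lemma diffeo_smooth: "smooth_map M M f" "smooth_map M M (inv_into (carr M) f)"
  using f by (simp_all add: diffeomorphism_def)

lemma diffeo_inverse:
  assumes "x \<in> carr M"
  shows "f (inv_into (carr M) f x) = x" "inv_into (carr M) f (f x) = x"
  using f assms unfolding diffeomorphism_def bij_betw_def by (auto simp: f_inv_into_f)

lemma int_iterate_smooth_preserves:
  assumes T\<phi>: "endo_tangent M \<phi>" and T\<xi>: "\<And>x. x \<in> carr M \<Longrightarrow> \<xi> x \<in> tangent_space M x"
    and P: "preserves_almost_contact_metric M f \<phi> \<xi> \<eta> h"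
  shows "smooth_map M M (int_iterate (carr M) f k)"
    and "preserves_almost_contact_metric M (int_iterate (carr M) f k) \<phi> \<xi> \<eta> h"
  using funpow_smooth_preserves[OF M diffeo_smooth(1) T\<phi> T\<xi> P]
    funpow_smooth_preserves[OF M diffeo_smooth(2) T\<phi> T\<xi>
      preserves_almost_contact_metric_inverse[OF M diffeo_smooth diffeo_inverse T\<phi> T\<xi> P]]
  by (auto simp: int_iterate_def)

lemma funpow_carr:
  "x \<in> carr M \<Longrightarrow> (f ^^ n) x \<in> carr M" "x \<in> carr M \<Longrightarrow> (inv_into (carr M) f ^^ n) x \<in> carr M"
  by (induction n) (auto intro: smooth_map_carr[OF diffeo_smooth(1)] smooth_map_carr[OF diffeo_smooth(2)])

lemma int_iterate_carr: "x \<in> carr M \<Longrightarrow> int_iterate (carr M) f k x \<in> carr M"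
  by (simp add: int_iterate_def funpow_carr)

lemma int_iterate_step:
  assumes x: "x \<in> carr M"
  shows "int_iterate (carr M) f (k + 1) x = f (int_iterate (carr M) f k x)"
proof -
  have "k \<ge> 0 \<or> k \<le> - 1" by linarith
  then show ?thesis
  proof
    assume "k \<ge> 0"
    then show ?thesis by (simp add: int_iterate_def nat_add_distrib)
  next
    assume 2: "k \<le> - 1"
    then have "nat (- k) = Suc (nat (- (k + 1)))" by simp
    then have "int_iterate (carr M) f k x =
        inv_into (carr M) f ((inv_into (carr M) f ^^ nat (- (k + 1))) x)"
      using 2 by (simp add: int_iterate_def)
    moreover have "int_iterate (carr M) f (k + 1) x = (inv_into (carr M) f ^^ nat (- (k + 1))) x"
      using 2 by (auto simp: int_iterate_def)
    ultimately show ?thesis using diffeo_inverse(1)[OF funpow_carr(2)[OF x]] by simp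
  qed
qed

lemma int_iterate_add:
  assumes x: "x \<in> carr M"
  shows "int_iterate (carr M) f (k + l) x = int_iterate (carr M) f k (int_iterate (carr M) f l x)"
proof (induction k rule: int_induct[where k = 0])
  case base
  show ?case by (simp add: int_iterate_def)
next
  case (step1 k)
  have "int_iterate (carr M) f (k + 1 + l) x = f (int_iterate (carr M) f (k + l) x)"
    using int_iterate_step[OF x, of "k + l"] by (simp add: algebra_simps)
  then show ?case using step1.IH int_iterate_step[OF int_iterate_carr[OF x]] by simp
next
  case (step2 k)
  have pred: "int_iterate (carr M) f (k - 1) y = inv_into (carr M) f (int_iterate (carr M) f k y)"
    if "y \<in> carr M" for k y
    using int_iterate_step[OF that, of "k - 1"] diffeo_inverse(2)[OF int_iterate_carr[OF that]] by simp
  have "int_iterate (carr M) f (k - 1 + l) x = inv_into (carr M) f (int_iterate (carr M) f (k + l) x)"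
    using pred[OF x, of "k + l"] by (simp add: algebra_simps)
  then show ?case using step2.IH pred[OF int_iterate_carr[OF x]] by simp
qed

end

section \<open>Quotients by free discontinuous actions\<close>

definition orbit_of :: "(int \<Rightarrow> 'a \<Rightarrow> 'a) \<Rightarrow> 'a \<Rightarrow> 'a set" where
  "orbit_of T p = range (\<lambda>k. T k p)"

lemma openin_quotient_top:
  "openin (quotient_top X q) V \<longleftrightarrow> V \<subseteq> q ` topspace X \<and> openin X {x \<in> topspace X. q x \<in> V}"
proof -
  have "istopology (\<lambda>V. V \<subseteq> q ` topspace X \<and> openin X {x \<in> topspace X. q x \<in> V})"
    unfolding istopology_def
  proof (intro conjI allI impI)
    fix S T assume S: "S \<subseteq> q ` topspace X \<and> openin X {x \<in> topspace X. q x \<in> S}"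
      and T: "T \<subseteq> q ` topspace X \<and> openin X {x \<in> topspace X. q x \<in> T}"
    have "{x \<in> topspace X. q x \<in> S \<inter> T} = {x \<in> topspace X. q x \<in> S} \<inter> {x \<in> topspace X. q x \<in> T}" by auto
    then show "openin X {x \<in> topspace X. q x \<in> S \<inter> T}" using S T by auto
    show "S \<inter> T \<subseteq> q ` topspace X" using S by auto
  next
    fix \<K> assume K: "\<forall>K\<in>\<K>. K \<subseteq> q ` topspace X \<and> openin X {x \<in> topspace X. q x \<in> K}"
    have "{x \<in> topspace X. q x \<in> \<Union>\<K>} = (\<Union>K\<in>\<K>. {x \<in> topspace X. q x \<in> K})" by auto
    then show "openin X {x \<in> topspace X. q x \<in> \<Union>\<K>}" using K by auto
    show "\<Union>\<K> \<subseteq> q ` topspace X" using K by auto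
  qed
  then show ?thesis unfolding quotient_top_def by (simp add: topology_inverse')
qed

lemma topspace_quotient_top: "topspace (quotient_top X q) = q ` topspace X"
proof
  show "topspace (quotient_top X q) \<subseteq> q ` topspace X"
    using openin_topspace[of "quotient_top X q"] unfolding openin_quotient_top by blast
  have "{x \<in> topspace X. q x \<in> q ` topspace X} = topspace X" by auto
  then have "openin (quotient_top X q) (q ` topspace X)" by (simp add: openin_quotient_top)
  then show "q ` topspace X \<subseteq> topspace (quotient_top X q)" by (rule openin_subset)
qed

lemma continuous_map_quotient_top: "continuous_map X (quotient_top X q) q"
  unfolding continuous_map_def by (auto simp: topspace_quotient_top openin_quotient_top)

definition quotient_chart :: "('a \<Rightarrow> 'b) \<Rightarrow> ('a, 'e) chart \<Rightarrow> 'a set \<Rightarrow> ('b, 'e) chart" where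
  "quotient_chart q c W = Chart (q ` W) (cmap c \<circ> inv_into W q)"

text \<open>The assumption \<open>free\<close> makes the orbit map locally injective, which provides charts of the quotient;
  \<open>separated\<close> makes the quotient a Hausdorff space.\<close>

locale discrete_action =
  fixes N :: "('a, 'e::euclidean_space) mfd" and T :: "int \<Rightarrow> 'a \<Rightarrow> 'a"
  assumes N: "smooth_manifold N"
    and smooth: "smooth_map N N (T k)"
    and zero: "p \<in> carr N \<Longrightarrow> T 0 p = p"
    and add: "p \<in> carr N \<Longrightarrow> T (k + l) p = T k (T l p)"
    and free: "p \<in> carr N \<Longrightarrow>
      \<exists>W. openin (mtop N) W \<and> p \<in> W \<and> (\<forall>k x. x \<in> W \<longrightarrow> T k x \<in> W \<longrightarrow> k = 0)"
    and separated: "p \<in> carr N \<Longrightarrow> p' \<in> carr N \<Longrightarrow> (\<And>k. T k p \<noteq> p') \<Longrightarrow>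
      \<exists>U V. openin (mtop N) U \<and> openin (mtop N) V \<and> p \<in> U \<and> p' \<in> V \<and> (\<forall>k x. x \<in> U \<longrightarrow> T k x \<notin> V)"
begin

abbreviation q :: "'a \<Rightarrow> 'a set" where "q \<equiv> orbit_of T"

abbreviation Q :: "('a set, 'e) mfd" where "Q \<equiv> quotient_mfd N q"

lemma T_carr: "p \<in> carr N \<Longrightarrow> T k p \<in> carr N"
  by (rule smooth_map_carr[OF smooth])

lemma T_inverse: "p \<in> carr N \<Longrightarrow> T (- k) (T k p) = p" "p \<in> carr N \<Longrightarrow> T k (T (- k) p) = p"
  using add[of p "- k" k] add[of p k "- k"] zero by simp_all

lemma q_T: "p \<in> carr N \<Longrightarrow> q (T k p) = q p"
proof -
  assume p: "p \<in> carr N"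
  have "T l (T k p) \<in> q p" for l
    unfolding orbit_of_def by (rule range_eqI[of _ _ "l + k"]) (simp add: add[OF p])
  moreover have "T l p \<in> q (T k p)" for l
    unfolding orbit_of_def by (rule range_eqI[of _ _ "l - k"]) (simp add: add[OF p, symmetric])
  ultimately show ?thesis unfolding orbit_of_def by blast
qed

lemma q_eqD:
  assumes "p \<in> carr N" "p' \<in> carr N" "q p = q p'"
  obtains k where "p' = T k p"
proof -
  have "p' \<in> q p'" using zero[OF assms(2)] by (auto simp: orbit_of_def intro: range_eqI[of _ _ 0])
  then have "p' \<in> q p" using assms(3) by simp
  then show ?thesis using that by (auto simp: orbit_of_def)
qed

lemma mtop_Q: "mtop Q = quotient_top (mtop N) q"
  by (simp add: quotient_mfd_def)

lemma carr_Q: "carr Q = q ` carr N"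
  by (simp add: carr_def mtop_Q topspace_quotient_top)

lemma atlas_Q: "atlas Q = {quotient_chart q c W | c W.
    c \<in> atlas N \<and> openin (mtop N) W \<and> W \<subseteq> cdom c \<and> inj_on q W}"
  by (simp add: quotient_mfd_def quotient_chart_def)

lemma q_continuous: "continuous_map (mtop N) (mtop Q) q"
  unfolding mtop_Q by (rule continuous_map_quotient_top)

lemma T_image_open: "openin (mtop N) U \<Longrightarrow> openin (mtop N) {x \<in> carr N. T k x \<in> U}"
  using openin_continuous_map_preimage[OF smooth_map_continuous[OF smooth]] by (simp add: carr_def)

text \<open>The saturation of an open set is the union of its translates.\<close>

lemma q_open:
  assumes U: "openin (mtop N) U"
  shows "openin (mtop Q) (q ` U)"
proof -
  have Uc: "U \<subseteq> carr N" using openin_subset[OF U] by (simp add: carr_def)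
  have "{x \<in> carr N. q x \<in> q ` U} = (\<Union>k. {x \<in> carr N. T k x \<in> U})"
  proof (intro equalityI subsetI)
    fix x assume x: "x \<in> {x \<in> carr N. q x \<in> q ` U}"
    then obtain u where u: "u \<in> U" "q x = q u" by auto
    have "x \<in> carr N" "u \<in> carr N" using x u Uc by auto
    then obtain k where "u = T k x" using u(2) by (rule q_eqD)
    then show "x \<in> (\<Union>k. {x \<in> carr N. T k x \<in> U})" using u x by auto
  next
    fix x assume "x \<in> (\<Union>k. {x \<in> carr N. T k x \<in> U})"
    then obtain k where k: "x \<in> carr N" "T k x \<in> U" by auto
    then have "q x \<in> q ` U" using q_T[OF k(1), of k] by (metis imageI)
    then show "x \<in> {x \<in> carr N. q x \<in> q ` U}" using k by simp
  qed
  moreover have "openin (mtop N) (\<Union>k. {x \<in> carr N. T k x \<in> U})" using T_image_open[OF U] by blast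
  ultimately have "openin (mtop N) {x \<in> topspace (mtop N). q x \<in> q ` U}" by (simp add: carr_def)
  moreover have "q ` U \<subseteq> q ` topspace (mtop N)" using openin_subset[OF U] by (rule image_mono)
  ultimately show ?thesis by (simp add: mtop_Q openin_quotient_top)
qed

lemma cdom_quotient_chart: "cdom (quotient_chart q c W) = q ` W"
  by (simp add: quotient_chart_def)

lemma cmap_quotient_chart: "inj_on q W \<Longrightarrow> p \<in> W \<Longrightarrow> cmap (quotient_chart q c W) (q p) = cmap c p"
  by (simp add: quotient_chart_def)

lemma image_quotient_chart:
  "inj_on q W \<Longrightarrow> V \<subseteq> W \<Longrightarrow> cmap (quotient_chart q c W) ` q ` V = cmap c ` V"
  unfolding image_image by (rule image_cong) (auto simp: cmap_quotient_chart)

text \<open>A subset of \<open>q ` W\<close> is the image of a unique subset of \<open>W\<close>, and it is open if and only if the latter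
  is, because \<open>q\<close> is continuous and open.\<close>

lemma is_chart_quotient:
  assumes c: "c \<in> atlas N" and W: "openin (mtop N) W" "W \<subseteq> cdom c" and inj: "inj_on q W"
  shows "is_chart (mtop Q) (quotient_chart q c W)"
proof -
  let ?\<kappa> = "quotient_chart q c W"
  have cC: "is_chart (mtop N) c" by (rule manifold_is_chart[OF N c])
  have im: "cmap ?\<kappa> ` q ` W = cmap c ` W" by (rule image_quotient_chart[OF inj order_refl])
  have oqW: "openin (mtop Q) (q ` W)" by (rule q_open[OF W(1)])
  have oW: "open (cmap c ` W)" by (rule is_chart_open_image[OF cC W])
  have top: "topspace (subtopology (mtop Q) (q ` W)) = q ` W"
    using openin_subset[OF oqW] by auto
  have "homeomorphic_map (subtopology (mtop Q) (q ` W)) (top_of_set (cmap c ` W)) (cmap ?\<kappa>)"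
  proof (rule bijective_open_imp_homeomorphic_map)
    show "cmap ?\<kappa> ` topspace (subtopology (mtop Q) (q ` W)) = topspace (top_of_set (cmap c ` W))"
      unfolding top by (simp add: im)
    show "inj_on (cmap ?\<kappa>) (topspace (subtopology (mtop Q) (q ` W)))"
      unfolding top
    proof (rule inj_onI)
      fix z z' assume "z \<in> q ` W" "z' \<in> q ` W" and eq: "cmap ?\<kappa> z = cmap ?\<kappa> z'"
      then obtain x x' where x: "x \<in> W" "z = q x" "x' \<in> W" "z' = q x'" by auto
      then have "cmap c x = cmap c x'" using eq by (simp add: cmap_quotient_chart[OF inj])
      then have "x = x'" using is_chart_inj[OF cC] x W(2) by (meson inj_onD subsetD)
      then show "z = z'" using x by simp
    qed
    show "continuous_map (subtopology (mtop Q) (q ` W)) (top_of_set (cmap c ` W)) (cmap ?\<kappa>)"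
      unfolding continuous_map_in_subtopology
    proof
      show "continuous_map (subtopology (mtop Q) (q ` W)) euclidean (cmap ?\<kappa>)"
        unfolding continuous_map_def top
      proof (intro conjI allI impI)
        fix S :: "'e set" assume "openin euclidean S"
        then have S: "open S" by simp
        have "openin (mtop N) (W \<inter> {p \<in> cdom c. cmap c p \<in> S})"
          by (rule openin_Int[OF W(1) is_chart_open_preimage[OF cC S]])
        then have "openin (mtop Q) (q ` (W \<inter> {p \<in> cdom c. cmap c p \<in> S}))" by (rule q_open)
        moreover have "{z \<in> q ` W. cmap ?\<kappa> z \<in> S} = q ` (W \<inter> {p \<in> cdom c. cmap c p \<in> S})"
          using W(2) by (auto simp: cmap_quotient_chart[OF inj])
        ultimately have "openin (mtop Q) {z \<in> q ` W. cmap ?\<kappa> z \<in> S}" by simp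
        then show "openin (subtopology (mtop Q) (q ` W)) {z \<in> q ` W. cmap ?\<kappa> z \<in> S}"
          unfolding openin_open_subtopology[OF oqW] by auto
      qed simp
      show "cmap ?\<kappa> \<in> topspace (subtopology (mtop Q) (q ` W)) \<rightarrow> cmap c ` W"
        unfolding top using im by auto
    qed
    show "open_map (subtopology (mtop Q) (q ` W)) (top_of_set (cmap c ` W)) (cmap ?\<kappa>)"
      unfolding open_map_def
    proof (intro allI impI)
      fix V assume V: "openin (subtopology (mtop Q) (q ` W)) V"
      then have VQ: "openin (mtop Q) V" by (rule openin_trans_full[OF _ oqW])
      have VW: "V \<subseteq> q ` W" using openin_subset[OF V] unfolding top .
      let ?V = "{p \<in> W. q p \<in> V}"
      have "openin (mtop N) {x \<in> topspace (mtop N). q x \<in> V}"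
        by (rule openin_continuous_map_preimage[OF q_continuous VQ])
      then have "openin (mtop N) (W \<inter> {x \<in> topspace (mtop N). q x \<in> V})" by (rule openin_Int[OF W(1)])
      moreover have "W \<inter> {x \<in> topspace (mtop N). q x \<in> V} = ?V" using openin_subset[OF W(1)] by auto
      ultimately have "open (cmap c ` ?V)" using W(2) by (intro is_chart_open_image[OF cC]) auto
      moreover have "V = q ` ?V" using VW by auto
      then have "cmap ?\<kappa> ` V = cmap c ` ?V" using image_quotient_chart[OF inj, of ?V c] by auto
      moreover have "cmap c ` ?V \<subseteq> cmap c ` W" by auto
      ultimately show "openin (top_of_set (cmap c ` W)) (cmap ?\<kappa> ` V)"
        by (simp only: openin_open_eq[OF oW])
    qed
  qed
  then show ?thesis
    unfolding is_chart_def cdom_quotient_chart im using oqW oW by (intro conjI)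
qed

lemma cinv_quotient_chart:
  assumes c: "c \<in> atlas N" and W: "openin (mtop N) W" "W \<subseteq> cdom c" and inj: "inj_on q W"
    and y: "y \<in> cmap c ` W"
  shows "cinv (quotient_chart q c W) y = q (cinv c y)" and "cinv c y \<in> W"
proof -
  obtain p where p: "p \<in> W" "y = cmap c p" using y by auto
  have cy: "cinv c y = p" using chart_cinv[OF N c] p W(2) by auto
  then show "cinv c y \<in> W" using p by simp
  have "cinv (quotient_chart q c W) (cmap (quotient_chart q c W) (q p)) = q p"
    by (rule is_chart_cinv[OF is_chart_quotient[OF c W inj]]) (simp add: cdom_quotient_chart p)
  then show "cinv (quotient_chart q c W) y = q (cinv c y)"
    by (simp add: cmap_quotient_chart[OF inj p(1)] p(2)[symmetric] cy)
qed

text \<open>Locally, the orbit map followed by a local inverse of it is one of the maps \<open>T k\<close>. This gives both the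
  smoothness of \<open>q\<close> and that of the changes of charts.\<close>

lemma quotient_coord_smooth:
  assumes c: "c \<in> atlas N" and c': "c' \<in> atlas N"
    and W': "openin (mtop N) W'" "W' \<subseteq> cdom c'" and inj': "inj_on q W'"
  shows "smooth_on (cmap c ` {p \<in> cdom c. q p \<in> q ` W'}) (\<lambda>y. cmap (quotient_chart q c' W') (q (cinv c y)))"
proof (rule smooth_on_local)
  fix y assume "y \<in> cmap c ` {p \<in> cdom c. q p \<in> q ` W'}"
  then obtain p p' where p: "p \<in> cdom c" "y = cmap c p" and p': "p' \<in> W'" "q p = q p'" by auto
  have pN: "p \<in> carr N" using chart_dom_carr[OF N c] p(1) by auto
  have p'N: "p' \<in> carr N" using chart_dom_carr[OF N c'] p'(1) W'(2) by auto
  obtain k where k: "p' = T k p" by (rule q_eqD[OF pN p'N p'(2)])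
  let ?A = "{x \<in> cdom c. T k x \<in> W'}"
  have "openin (mtop N) (cdom c \<inter> {x \<in> carr N. T k x \<in> W'})"
    by (rule openin_Int[OF is_chart_dom[OF manifold_is_chart[OF N c]] T_image_open[OF W'(1)]])
  moreover have "cdom c \<inter> {x \<in> carr N. T k x \<in> W'} = ?A" using chart_dom_carr[OF N c] by auto
  ultimately have oA: "open (cmap c ` ?A)" using is_chart_open_image[OF manifold_is_chart[OF N c]] by simp
  have "smooth_on (cmap c ` ?A) (\<lambda>y. cmap c' (T k (cinv c y)))"
    by (rule smooth_on_subset[OF smooth_map_coord[OF smooth c c']]) (use W'(2) in auto)
  then have "smooth_on (cmap c ` ?A) (\<lambda>y. cmap (quotient_chart q c' W') (q (cinv c y)))"
  proof (rule smooth_on_cong[OF oA, rotated])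
    fix z assume "z \<in> cmap c ` ?A"
    then obtain x where x: "x \<in> cdom c" "T k x \<in> W'" "z = cmap c x" by auto
    have zx: "cinv c z = x" using chart_cinv[OF N c] x by simp
    have "q x = q (T k x)" using q_T chart_dom_carr[OF N c] x(1) by auto
    then show "cmap c' (T k (cinv c z)) = cmap (quotient_chart q c' W') (q (cinv c z))"
      by (simp add: zx cmap_quotient_chart[OF inj' x(2)])
  qed
  moreover have "y \<in> cmap c ` ?A" using p p' k by auto
  ultimately show "\<exists>S. open S \<and> y \<in> S \<and> smooth_on S (\<lambda>y. cmap (quotient_chart q c' W') (q (cinv c y)))"
    using oA by auto
qed

lemma exists_quotient_chart:
  assumes p: "p \<in> carr N"
  obtains c W where "c \<in> atlas N" "openin (mtop N) W" "W \<subseteq> cdom c" "inj_on q W" "p \<in> W"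
proof -
  obtain W where W: "openin (mtop N) W" "p \<in> W" "\<And>k x. x \<in> W \<Longrightarrow> T k x \<in> W \<Longrightarrow> k = 0"
    using free[OF p] by auto
  obtain c where c: "c \<in> charts_at N p" using chart_at_mem[OF N p] by auto
  note cA = charts_atD[OF c]
  show ?thesis
  proof (rule that[of c "cdom c \<inter> W"])
    show "openin (mtop N) (cdom c \<inter> W)"
      by (rule openin_Int[OF is_chart_dom[OF manifold_is_chart[OF N cA(1)]] W(1)])
    show "inj_on q (cdom c \<inter> W)"
    proof (rule inj_onI)
      fix x x' assume x: "x \<in> cdom c \<inter> W" "x' \<in> cdom c \<inter> W" "q x = q x'"
      have xN: "x \<in> carr N" "x' \<in> carr N" using chart_dom_carr[OF N cA(1)] x by auto
      obtain k where k: "x' = T k x" by (rule q_eqD[OF xN x(3)])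
      then have "k = 0" using W(3)[of x k] x by auto
      then show "x = x'" using k zero[OF xN(1)] by simp
    qed
  qed (use cA W in auto)
qed

theorem smooth_manifold_quotient: "smooth_manifold Q"
  unfolding smooth_manifold_def
proof (intro conjI ballI)
  show "Hausdorff_space (mtop Q)"
    unfolding Hausdorff_space_def
  proof (intro allI impI)
    fix z z' assume z: "z \<in> topspace (mtop Q) \<and> z' \<in> topspace (mtop Q) \<and> z \<noteq> z'"
    have "topspace (mtop Q) = q ` carr N" using carr_Q by (simp add: carr_def)
    then obtain p p' where p: "p \<in> carr N" "p' \<in> carr N" "z = q p" "z' = q p'" using z by auto
    have "T k p \<noteq> p'" for k using q_T[OF p(1), of k] p z by auto
    then obtain U V where UV: "openin (mtop N) U" "openin (mtop N) V" "p \<in> U" "p' \<in> V"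
      "\<And>k x. x \<in> U \<Longrightarrow> T k x \<notin> V"
      using separated[OF p(1,2)] by auto
    have sub: "U \<subseteq> carr N" "V \<subseteq> carr N"
      using openin_subset[OF UV(1)] openin_subset[OF UV(2)] by (simp_all add: carr_def)
    have "disjnt (q ` U) (q ` V)"
      unfolding disjnt_iff
    proof (intro allI notI)
      fix w assume "w \<in> q ` U \<and> w \<in> q ` V"
      then obtain u v where uv: "u \<in> U" "v \<in> V" "q u = q v" by auto
      have "u \<in> carr N" "v \<in> carr N" using uv sub by auto
      then obtain k where "v = T k u" using uv(3) by (rule q_eqD)
      then show False using UV(5) uv by auto
    qed
    then show "\<exists>U V. openin (mtop Q) U \<and> openin (mtop Q) V \<and> z \<in> U \<and> z' \<in> V \<and> disjnt U V"
      using q_open[OF UV(1)] q_open[OF UV(2)] p UV(3,4) by blast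
  qed
  show "second_countable (mtop Q)"
  proof (rule second_countable_open_map_image[OF q_continuous])
    show "open_map (mtop N) (mtop Q) q" by (simp add: open_map_def q_open)
    show "q ` topspace (mtop N) = topspace (mtop Q)" using carr_Q by (simp add: carr_def)
    show "second_countable (mtop N)" using N by (simp add: smooth_manifold_def)
  qed
  show "is_chart (mtop Q) \<kappa>" if "\<kappa> \<in> atlas Q" for \<kappa>
    using that is_chart_quotient unfolding atlas_Q by auto
  show "(\<Union>\<kappa>\<in>atlas Q. cdom \<kappa>) = carr Q"
  proof (intro equalityI subsetI)
    fix z assume "z \<in> (\<Union>\<kappa>\<in>atlas Q. cdom \<kappa>)"
    then obtain c W where "c \<in> atlas N" "W \<subseteq> cdom c" "z \<in> q ` W"
      unfolding atlas_Q by (auto simp: cdom_quotient_chart)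
    then show "z \<in> carr Q" using chart_dom_carr[OF N] unfolding carr_Q by auto
  next
    fix z assume "z \<in> carr Q"
    then obtain p where p: "p \<in> carr N" "z = q p" unfolding carr_Q by auto
    obtain c W where "c \<in> atlas N" "openin (mtop N) W" "W \<subseteq> cdom c" "inj_on q W" "p \<in> W"
      by (rule exists_quotient_chart[OF p(1)])
    then have "quotient_chart q c W \<in> atlas Q" "z \<in> cdom (quotient_chart q c W)"
      using p unfolding atlas_Q by (auto simp: cdom_quotient_chart)
    then show "z \<in> (\<Union>\<kappa>\<in>atlas Q. cdom \<kappa>)" by auto
  qed
  fix \<kappa> \<kappa>' assume "\<kappa> \<in> atlas Q" "\<kappa>' \<in> atlas Q"
  then obtain c W c' W' where \<kappa>: "\<kappa> = quotient_chart q c W" "\<kappa>' = quotient_chart q c' W'"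
    and c: "c \<in> atlas N" and W: "openin (mtop N) W" "W \<subseteq> cdom c" and inj: "inj_on q W"
    and c': "c' \<in> atlas N" and W': "openin (mtop N) W'" "W' \<subseteq> cdom c'" and inj': "inj_on q W'"
    unfolding atlas_Q by auto
  let ?A = "{p \<in> W. q p \<in> q ` W'}"
  have im: "cmap \<kappa> ` (cdom \<kappa> \<inter> cdom \<kappa>') = cmap c ` ?A"
  proof -
    have "q ` W \<inter> q ` W' = q ` ?A" by auto
    then show ?thesis using image_quotient_chart[OF inj, of ?A c] by (auto simp: \<kappa> cdom_quotient_chart)
  qed
  have "openin (mtop N) (W \<inter> {x \<in> topspace (mtop N). q x \<in> q ` W'})"
    by (rule openin_Int[OF W(1) openin_continuous_map_preimage[OF q_continuous q_open[OF W'(1)]]])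
  moreover have "W \<inter> {x \<in> topspace (mtop N). q x \<in> q ` W'} = ?A" using openin_subset[OF W(1)] by auto
  ultimately have oA: "open (cmap c ` ?A)"
    using W(2) by (intro is_chart_open_image[OF manifold_is_chart[OF N c]]) auto
  have "smooth_on (cmap c ` ?A) (\<lambda>y. cmap \<kappa>' (q (cinv c y)))"
    unfolding \<kappa> by (rule smooth_on_subset[OF quotient_coord_smooth[OF c c' W' inj']]) (use W(2) in auto)
  then show "smooth_on (cmap \<kappa> ` (cdom \<kappa> \<inter> cdom \<kappa>')) (cmap \<kappa>' \<circ> cinv \<kappa>)"
    unfolding im
  proof (rule smooth_on_cong[OF oA, rotated])
    fix y assume "y \<in> cmap c ` ?A"
    then have "y \<in> cmap c ` W" by auto
    then show "cmap \<kappa>' (q (cinv c y)) = (cmap \<kappa>' \<circ> cinv \<kappa>) y"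
      by (simp add: \<kappa>(1) cinv_quotient_chart[OF c W inj])
  qed
qed

lemma smooth_map_q: "smooth_map N Q q"
  unfolding smooth_map_def comp_def
proof (intro conjI ballI)
  fix c \<kappa> assume c: "c \<in> atlas N" and "\<kappa> \<in> atlas Q"
  then obtain c' W' where \<kappa>: "\<kappa> = quotient_chart q c' W'" and c': "c' \<in> atlas N"
    and W': "openin (mtop N) W'" "W' \<subseteq> cdom c'" and inj': "inj_on q W'"
    unfolding atlas_Q by auto
  show "smooth_on (cmap c ` {p \<in> cdom c. q p \<in> cdom \<kappa>}) (\<lambda>y. cmap \<kappa> (q (cinv c y)))"
    using quotient_coord_smooth[OF c c' W' inj'] by (simp add: \<kappa> cdom_quotient_chart)
qed (rule q_continuous)

end

context discrete_action
begin

lemma quotient_charts_atE: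
  assumes "\<kappa> \<in> charts_at Q z"
  obtains c W p where "\<kappa> = quotient_chart q c W" "c \<in> atlas N" "openin (mtop N) W" "W \<subseteq> cdom c"
    "inj_on q W" "p \<in> W" "z = q p"
proof -
  have k: "\<kappa> \<in> atlas Q" "z \<in> cdom \<kappa>" using charts_atD[OF assms] by auto
  from k(1) obtain c W where c: "\<kappa> = quotient_chart q c W" "c \<in> atlas N" "openin (mtop N) W"
    "W \<subseteq> cdom c" "inj_on q W"
    unfolding atlas_Q by auto
  then obtain p where "p \<in> W" "z = q p" using k(2) by (auto simp: cdom_quotient_chart)
  then show ?thesis using that c by auto
qed

lemma quotient_chart_charts_at:
  assumes "c \<in> atlas N" "openin (mtop N) W" "W \<subseteq> cdom c" "inj_on q W" "p \<in> W"
  shows "quotient_chart q c W \<in> charts_at Q (q p)"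
  using assms by (auto simp: charts_at_def atlas_Q cdom_quotient_chart)

text \<open>In a chart \<open>c\<close> and the chart of the quotient made from it, the orbit map is the identity.\<close>

lemma differential_q_coord:
  assumes c: "c \<in> atlas N" and W: "openin (mtop N) W" "W \<subseteq> cdom c" and inj: "inj_on q W"
    and p: "p \<in> W" and v: "v \<in> tangent_space N p"
  shows "differential N Q q p v (quotient_chart q c W) = v c"
proof -
  let ?\<kappa> = "quotient_chart q c W"
  have cp: "c \<in> charts_at N p" using c p W(2) by (auto simp: charts_at_def)
  have "differential N Q q p v ?\<kappa> =
      frechet_derivative (\<lambda>y. cmap ?\<kappa> (q (cinv c y))) (at (cmap c p)) (v c)"
    by (rule differential_coord[OF N smooth_manifold_quotient smooth_map_q cp
          quotient_chart_charts_at[OF c W inj p] v])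
  also have "frechet_derivative (\<lambda>y. cmap ?\<kappa> (q (cinv c y))) (at (cmap c p)) =
      frechet_derivative (\<lambda>y. y) (at (cmap c p))"
  proof (rule frechet_derivative_cong)
    show "open (cmap c ` W)" by (rule is_chart_open_image[OF manifold_is_chart[OF N c] W])
    show "cmap c p \<in> cmap c ` W" using p by simp
    show "cmap ?\<kappa> (q (cinv c y)) = y" if y: "y \<in> cmap c ` W" for y
      using cmap_quotient_chart[OF inj cinv_quotient_chart(2)[OF c W inj y], of c] y W(2)
      by (auto simp: cmap_cinv)
  qed
  finally show ?thesis by simp
qed

lemma differential_q_mem:
  "p \<in> carr N \<Longrightarrow> v \<in> tangent_space N p \<Longrightarrow> differential N Q q p v \<in> tangent_space Q (q p)"
  by (rule differential_mem[OF N smooth_manifold_quotient smooth_map_q])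

lemma differential_q_inj:
  assumes p: "p \<in> carr N" and v: "v \<in> tangent_space N p" and w: "w \<in> tangent_space N p"
    and eq: "differential N Q q p v = differential N Q q p w"
  shows "v = w"
proof -
  obtain c W where cW: "c \<in> atlas N" "openin (mtop N) W" "W \<subseteq> cdom c" "inj_on q W" "p \<in> W"
    by (rule exists_quotient_chart[OF p])
  have "c \<in> charts_at N p" using cW by (auto simp: charts_at_def)
  then show ?thesis
    by (rule tangent_eqI[OF N _ v w]) (use differential_q_coord[OF cW v] differential_q_coord[OF cW w] eq in simp)
qed

lemma differential_q_T:
  assumes p: "p \<in> carr N" and v: "v \<in> tangent_space N p"
  shows "differential N Q q (T k p) (differential N N (T k) p v) = differential N Q q p v"
  using differential_compose[OF N N smooth_manifold_quotient smooth smooth_map_q p v, of k]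
    differential_cong[OF N, of "\<lambda>x. q (T k x)" q p Q v] q_T p by simp

text \<open>Tensors on the quotient are those upstairs at a chosen representative. Invariance makes them
  independent of the choice.\<close>

definition representative :: "'a set \<Rightarrow> 'a" where
  "representative z = (SOME p. p \<in> carr N \<and> q p = z)"

definition lift_tangent :: "'a set \<Rightarrow> ('a set, 'e) tangent \<Rightarrow> ('a, 'e) tangent" where
  "lift_tangent z v = (SOME u. u \<in> tangent_space N (representative z) \<and> differential N Q q (representative z) u = v)"

definition quotient_endo :: "('a, 'e) endo \<Rightarrow> ('a set, 'e) endo" where
  "quotient_endo J z v = differential N Q q (representative z) (J (representative z) (lift_tangent z v))"

definition quotient_form1 :: "('a, 'e) form1 \<Rightarrow> ('a set, 'e) form1" where
  "quotient_form1 \<theta> z v = \<theta> (representative z) (lift_tangent z v)"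

definition quotient_form2 :: "('a, 'e) form2 \<Rightarrow> ('a set, 'e) form2" where
  "quotient_form2 g z v w = g (representative z) (lift_tangent z v) (lift_tangent z w)"

definition quotient_vfield :: "('a, 'e) vfield \<Rightarrow> ('a set, 'e) vfield" where
  "quotient_vfield U z = differential N Q q (representative z) (U (representative z))"

lemma representative_q:
  assumes "p \<in> carr N"
  obtains k where "representative (q p) = T k p"
proof -
  have "representative (q p) \<in> carr N \<and> q (representative (q p)) = q p"
    unfolding representative_def by (rule someI[of "\<lambda>x. x \<in> carr N \<and> q x = q p" p]) (simp add: assms)
  then have "representative (q p) \<in> carr N" "q p = q (representative (q p))" by simp_all
  then obtain k where "representative (q p) = T k p" by (rule q_eqD[OF assms])
  then show ?thesis by (rule that)
qed

lemma lift_tangent_differential_q: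
  assumes p: "p \<in> carr N" and u: "u \<in> tangent_space N p" and k: "representative (q p) = T k p"
  shows "lift_tangent (q p) (differential N Q q p u) = differential N N (T k) p u"
proof -
  let ?u = "differential N N (T k) p u"
  have m: "?u \<in> tangent_space N (representative (q p))" unfolding k by (rule differential_mem[OF N N smooth p u])
  have e: "differential N Q q (representative (q p)) ?u = differential N Q q p u" unfolding k by (rule differential_q_T[OF p u])
  have "lift_tangent (q p) (differential N Q q p u) \<in> tangent_space N (representative (q p)) \<and>
      differential N Q q (representative (q p)) (lift_tangent (q p) (differential N Q q p u)) = differential N Q q p u"
    unfolding lift_tangent_def by (rule someI[of _ ?u]) (simp add: m e)
  then have a: "lift_tangent (q p) (differential N Q q p u) \<in> tangent_space N (representative (q p))"
    and b: "differential N Q q (representative (q p)) (lift_tangent (q p) (differential N Q q p u)) = differential N Q q p u"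
    by simp_all
  have "representative (q p) \<in> carr N" unfolding k by (rule T_carr[OF p])
  from differential_q_inj[OF this a m] show ?thesis by (simp only: b e)
qed

lemma quotient_tensors:
  assumes p: "p \<in> carr N" and u: "u \<in> tangent_space N p"
  shows "(\<And>k. preserves_endo N (T k) J) \<Longrightarrow> endo_tangent N J \<Longrightarrow>
      quotient_endo J (q p) (differential N Q q p u) = differential N Q q p (J p u)"
    and "(\<And>k. preserves_form1 N (T k) \<theta>) \<Longrightarrow> quotient_form1 \<theta> (q p) (differential N Q q p u) = \<theta> p u"
    and "(\<And>k. preserves_metric N (T k) g) \<Longrightarrow> w \<in> tangent_space N p \<Longrightarrow>
      quotient_form2 g (q p) (differential N Q q p u) (differential N Q q p w) = g p u w"
proof -
  obtain k where k: "representative (q p) = T k p" by (rule representative_q[OF p])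
  note pp = lift_tangent_differential_q[OF p _ k]
  show "quotient_endo J (q p) (differential N Q q p u) = differential N Q q p (J p u)"
    if P: "\<And>k. preserves_endo N (T k) J" and TJ: "endo_tangent N J"
  proof -
    have Ju: "J p u \<in> tangent_space N p" using TJ p u by (simp add: endo_tangent_def)
    have "J (T k p) (differential N N (T k) p u) = differential N N (T k) p (J p u)"
      using P[of k] p u by (simp add: preserves_endo_def)
    then show ?thesis by (simp add: quotient_endo_def pp[OF u] k differential_q_T[OF p Ju])
  qed
  show "quotient_form1 \<theta> (q p) (differential N Q q p u) = \<theta> p u" if "\<And>k. preserves_form1 N (T k) \<theta>"
    using that[of k] p u by (simp add: quotient_form1_def pp[OF u] k preserves_form1_def)
  show "quotient_form2 g (q p) (differential N Q q p u) (differential N Q q p w) = g p u w"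
    if "\<And>k. preserves_metric N (T k) g" "w \<in> tangent_space N p"
    using that(1)[of k] that(2) p u
    by (simp add: quotient_form2_def pp[OF u] pp[OF that(2)] k preserves_metric_def)
qed

lemma quotient_vfield_q:
  assumes p: "p \<in> carr N" and U: "U p \<in> tangent_space N p" and P: "\<And>k. preserves_vfield N (T k) U"
  shows "quotient_vfield U (q p) = differential N Q q p (U p)"
proof -
  obtain k where k: "representative (q p) = T k p" by (rule representative_q[OF p])
  have "U (T k p) = differential N N (T k) p (U p)" using P[of k] p by (simp add: preserves_vfield_def)
  then show ?thesis by (simp add: quotient_vfield_def k differential_q_T[OF p U])
qed

lemma differential_q_surj:
  assumes z: "z \<in> carr Q" and v: "v \<in> tangent_space Q z"
  obtains p u where "p \<in> carr N" "z = q p" "u \<in> tangent_space N p" "v = differential N Q q p u"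
proof -
  obtain p where p: "p \<in> carr N" "z = q p" using z by (auto simp: carr_Q)
  obtain c W where cW: "c \<in> atlas N" "openin (mtop N) W" "W \<subseteq> cdom c" "inj_on q W" "p \<in> W"
    by (rule exists_quotient_chart[OF p(1)])
  have cp: "c \<in> charts_at N p" using cW by (auto simp: charts_at_def)
  let ?u = "tvec N c p (v (quotient_chart q c W))"
  have u: "?u \<in> tangent_space N p" by (rule tvec_mem[OF N cp])
  have "v = differential N Q q p ?u"
    by (rule tangent_eqI[OF smooth_manifold_quotient quotient_chart_charts_at[OF cW] _ differential_q_mem[OF p(1) u]])
      (use v p in \<open>simp_all add: differential_q_coord[OF cW u] tvec_self[OF N cp]\<close>)
  then show ?thesis by (rule that[OF p u])
qed

text \<open>The components in a chart of the quotient equal those in the chart upstairs it comes from, on a smaller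
  open set, so the coordinate criterion carries over.\<close>

theorem quasi_vaisman_quotient:
  assumes TJ: "endo_tangent N J"
    and U: "\<And>p. p \<in> carr N \<Longrightarrow> U p \<in> tangent_space N p"
    and Uc: "\<And>p c. c \<in> charts_at N p \<Longrightarrow> U p c = u"
    and coords: "\<And>c. c \<in> atlas N \<Longrightarrow> quasi_vaisman_coords (cmap c ` cdom c)
      (coord_endo N c J) (coord_form2 N c g) (coord_form N c \<theta>) u"
    and P: "\<And>k. preserves_quasi_vaisman N (T k) J g \<theta>" and PU: "\<And>k. preserves_vfield N (T k) U"
  shows "quasi_vaisman Q (quotient_endo J) (quotient_form2 g) (quotient_form1 \<theta>)"
proof (rule quasi_vaismanI[OF smooth_manifold_quotient])
  have PJ: "preserves_endo N (T k) J" and Pg: "preserves_metric N (T k) g"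
    and P\<theta>: "preserves_form1 N (T k) \<theta>" for k
    using P[of k] by (simp_all add: preserves_quasi_vaisman_def)
  have JT: "J p v \<in> tangent_space N p" if "p \<in> carr N" "v \<in> tangent_space N p" for p v
    using TJ that by (simp add: endo_tangent_def)
  show "endo_tangent Q (quotient_endo J)"
    unfolding endo_tangent_def
  proof (intro ballI)
    fix z v assume "z \<in> carr Q" "v \<in> tangent_space Q z"
    then obtain p x where px: "p \<in> carr N" "z = q p" "x \<in> tangent_space N p" "v = differential N Q q p x"
      by (rule differential_q_surj)
    then show "quotient_endo J z v \<in> tangent_space Q z"
      using differential_q_mem[OF px(1) JT[OF px(1,3)]] quotient_tensors(1)[OF px(1,3) PJ TJ] by simp
  qed
  show "quotient_vfield U z \<in> tangent_space Q z" if "z \<in> carr Q" for z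
  proof -
    obtain p where p: "p \<in> carr N" "z = q p" using \<open>z \<in> carr Q\<close> by (auto simp: carr_Q)
    show ?thesis using differential_q_mem[OF p(1) U[OF p(1)]] quotient_vfield_q[OF p(1) U[OF p(1)] PU] p(2) by simp
  qed
  show "quotient_vfield U z \<kappa> = u" if \<kappa>z: "\<kappa> \<in> charts_at Q z" for z \<kappa>
  proof -
    obtain c W p where \<kappa>: "\<kappa> = quotient_chart q c W"
      and cW: "c \<in> atlas N" "openin (mtop N) W" "W \<subseteq> cdom c" "inj_on q W" "p \<in> W" and z: "z = q p"
      using \<kappa>z by (rule quotient_charts_atE)
    have cp: "c \<in> charts_at N p" using cW by (auto simp: charts_at_def)
    note p = charts_at_carr[OF N cp]
    show ?thesis
      by (simp add: \<kappa> z quotient_vfield_q[OF p U[OF p] PU] differential_q_coord[OF cW U[OF p]] Uc[OF cp])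
  qed
  fix \<kappa> assume "\<kappa> \<in> atlas Q"
  then obtain c W where \<kappa>: "\<kappa> = quotient_chart q c W"
    and cW: "c \<in> atlas N" "openin (mtop N) W" "W \<subseteq> cdom c" "inj_on q W"
    unfolding atlas_Q by auto
  have im: "cmap \<kappa> ` cdom \<kappa> = cmap c ` W"
    unfolding \<kappa> cdom_quotient_chart by (rule image_quotient_chart[OF cW(4) order_refl])
  have tv: "cinv \<kappa> y = q (cinv c y) \<and> cinv c y \<in> W \<and> c \<in> charts_at N (cinv c y) \<and>
      tvec Q \<kappa> (cinv \<kappa> y) w = differential N Q q (cinv c y) (tvec N c (cinv c y) w)"
    if y: "y \<in> cmap c ` W" for y w
  proof -
    note cy = cinv_quotient_chart[OF cW y]
    have cp: "c \<in> charts_at N (cinv c y)" using cW cy(2) by (auto simp: charts_at_def)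
    note \<kappa>p = quotient_chart_charts_at[OF cW cy(2)]
    have "tvec Q (quotient_chart q c W) (q (cinv c y)) w = differential N Q q (cinv c y) (tvec N c (cinv c y) w)"
      by (rule tangent_eqI[OF smooth_manifold_quotient \<kappa>p tvec_mem[OF smooth_manifold_quotient \<kappa>p]
            differential_q_mem[OF charts_at_carr[OF N cp] tvec_mem[OF N cp]]])
        (simp add: tvec_self[OF smooth_manifold_quotient \<kappa>p]
          differential_q_coord[OF cW cy(2) tvec_mem[OF N cp]] tvec_self[OF N cp])
    then show ?thesis using cy cp by (simp add: \<kappa>)
  qed
  show "quasi_vaisman_coords (cmap \<kappa> ` cdom \<kappa>) (coord_endo Q \<kappa> (quotient_endo J))
      (coord_form2 Q \<kappa> (quotient_form2 g)) (coord_form Q \<kappa> (quotient_form1 \<theta>)) u"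
    unfolding im
  proof (rule quasi_vaisman_coords_restrict[OF coords[OF cW(1)]])
    show "open (cmap c ` W)" by (rule is_chart_open_image[OF manifold_is_chart[OF N cW(1)] cW(2,3)])
    show "cmap c ` W \<subseteq> cmap c ` cdom c" using cW(3) by auto
    fix y v w assume y: "y \<in> cmap c ` W"
    have cp: "c \<in> charts_at N (cinv c y)" and yW: "cinv c y \<in> W" and cy: "cinv \<kappa> y = q (cinv c y)"
      using tv[OF y] by auto
    note p = charts_at_carr[OF N cp] and t = tvec_mem[OF N cp]
    have tvy: "tvec Q \<kappa> (q (cinv c y)) a = differential N Q q (cinv c y) (tvec N c (cinv c y) a)" for a
      using tv[OF y, of a] by (simp add: cy)
    show "coord_endo N c J y v = coord_endo Q \<kappa> (quotient_endo J) y v"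
      unfolding coord_endo_def cy tvy quotient_tensors(1)[OF p t PJ TJ]
      by (simp add: \<kappa> differential_q_coord[OF cW yW JT[OF p t]])
    show "coord_form2 N c g y v w = coord_form2 Q \<kappa> (quotient_form2 g) y v w"
      unfolding coord_form2_def cy tvy using quotient_tensors(3)[OF p t Pg t] by simp
    show "coord_form N c \<theta> y v = coord_form Q \<kappa> (quotient_form1 \<theta>) y v"
      unfolding coord_form_def cy tvy using quotient_tensors(2)[OF p t P\<theta>] by simp
  qed
qed

end

section \<open>Mapping tori\<close>

lemma torus_orbit_eq: "torus_orbit M f a = orbit_of (torus_action M f a)"
  by (auto simp: torus_orbit_def orbit_of_def fun_eq_iff)

lemma mapping_torus_eq: "mapping_torus M f a = quotient_mfd (cyl M) (orbit_of (torus_action M f a))"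
  by (simp add: mapping_torus_def torus_orbit_eq)

text \<open>At most one translate \<open>t + k a\<close> of \<open>t\<close> lies within \<open>a / 2\<close> of \<open>t'\<close>. After restricting the second coordinate
  to intervals of radius \<open>a / 4\<close>, only one element of the group matters, and the orbits are separated
  because the cylinder is a Hausdorff space.\<close>

lemma discrete_action_torus:
  fixes M :: "('a, 'e::euclidean_space) mfd"
  assumes M: "smooth_manifold M" and f: "diffeomorphism M M f"
    and sm: "\<And>k. smooth_map M M (int_iterate (carr M) f k)" and a: "a > 0"
  shows "discrete_action (cyl M) (torus_action M f a)"
proof
  let ?T = "torus_action M f a" and ?N = "cyl M"
  have T: "?T k p = (int_iterate (carr M) f k (fst p), snd p + of_int k * a)" for k p
    by (simp add: torus_action_eq cyl_map_def)
  have strip: "openin (mtop ?N) {p \<in> carr ?N. \<bar>snd p - t\<bar> < r}" for t r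
  proof -
    have "openin (mtop ?N) {p \<in> topspace (mtop ?N). snd p \<in> {s. \<bar>s - t\<bar> < r}}"
    proof (rule openin_continuous_map_preimage)
      show "continuous_map (mtop ?N) euclideanreal snd" using smooth_map_continuous[OF smooth_map_cyl_snd[OF M]] by simp
      have "{s. \<bar>s - t\<bar> < r} = ball t r" by (auto simp: dist_real_def abs_minus_commute)
      then show "openin euclideanreal {s. \<bar>s - t\<bar> < r}" by simp
    qed
    then show ?thesis by (simp add: carr_def)
  qed
  have unique: "k = l" if "\<bar>of_int k * a - x\<bar> < a / 2" "\<bar>of_int l * a - x\<bar> < a / 2" for k l :: int and x
  proof -
    have "\<bar>of_int k * a - of_int l * a\<bar> < a" using that unfolding abs_less_iff by linarith
    then have "\<bar>of_int (k - l) * a\<bar> < a" by (simp add: left_diff_distrib)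
    then have "\<bar>of_int (k - l) :: real\<bar> < 1" using a by (simp add: abs_mult)
    then show ?thesis by linarith
  qed
  show "smooth_manifold ?N" by (rule smooth_manifold_cyl[OF M])
  show smT: "smooth_map ?N ?N (?T k)" for k unfolding torus_action_eq by (rule smooth_map_cyl_map[OF M sm])
  show T0: "?T 0 p = p" for p by (simp add: T int_iterate_def)
  show "?T (k + l) p = ?T k (?T l p)" if "p \<in> carr ?N" for p k l
    using that int_iterate_add[OF M f, of "fst p" k l] by (auto simp: T carr_cyl algebra_simps)
  show "\<exists>W. openin (mtop ?N) W \<and> p \<in> W \<and> (\<forall>k x. x \<in> W \<longrightarrow> ?T k x \<in> W \<longrightarrow> k = 0)" if p: "p \<in> carr ?N" for p
  proof (intro exI conjI allI impI)
    show "openin (mtop ?N) {x \<in> carr ?N. \<bar>snd x - snd p\<bar> < a / 4}" by (rule strip)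
    show "p \<in> {x \<in> carr ?N. \<bar>snd x - snd p\<bar> < a / 4}" using p a by simp
    fix k x assume "x \<in> {x \<in> carr ?N. \<bar>snd x - snd p\<bar> < a / 4}" "?T k x \<in> {x \<in> carr ?N. \<bar>snd x - snd p\<bar> < a / 4}"
    then have "\<bar>snd x - snd p\<bar> < a / 4" "\<bar>snd x + of_int k * a - snd p\<bar> < a / 4" by (simp_all add: T)
    then have "\<bar>of_int k * a - 0\<bar> < a / 2" unfolding abs_less_iff by linarith
    then show "k = 0" using unique[of k 0 0] a by simp
  qed
  show "\<exists>U V. openin (mtop ?N) U \<and> openin (mtop ?N) V \<and> p \<in> U \<and> p' \<in> V \<and> (\<forall>k x. x \<in> U \<longrightarrow> ?T k x \<notin> V)"
    if p: "p \<in> carr ?N" and p': "p' \<in> carr ?N" and ne: "\<And>k. ?T k p \<noteq> p'" for p p'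
  proof -
    \<comment> \<open>any \<open>l\<close> will do if no translate of \<open>snd p\<close> comes near \<open>snd p'\<close>\<close>
    obtain l where l: "\<And>k. \<bar>of_int k * a - (snd p' - snd p)\<bar> < a / 2 \<Longrightarrow> k = l"
    proof (cases "\<exists>k :: int. \<bar>of_int k * a - (snd p' - snd p)\<bar> < a / 2")
      case True
      then obtain l :: int where "\<bar>of_int l * a - (snd p' - snd p)\<bar> < a / 2" ..
      then show thesis using unique that by metis
    next
      case False
      then show thesis using that by metis
    qed
    have "?T l p \<in> carr ?N" by (rule smooth_map_carr[OF smT p])
    then have "\<exists>A B. openin (mtop ?N) A \<and> openin (mtop ?N) B \<and> ?T l p \<in> A \<and> p' \<in> B \<and> disjnt A B"
      using smooth_manifold_cyl[OF M] p' ne[of l]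
      unfolding smooth_manifold_def Hausdorff_space_def carr_def by blast
    then obtain A B where AB: "openin (mtop ?N) A" "openin (mtop ?N) B" "?T l p \<in> A" "p' \<in> B" "disjnt A B"
      by auto
    let ?U = "{x \<in> topspace (mtop ?N). ?T l x \<in> A} \<inter> {x \<in> carr ?N. \<bar>snd x - snd p\<bar> < a / 4}"
    let ?V = "B \<inter> {x \<in> carr ?N. \<bar>snd x - snd p'\<bar> < a / 4}"
    show ?thesis
    proof (intro exI conjI allI impI)
      show "openin (mtop ?N) ?U"
        by (rule openin_Int[OF openin_continuous_map_preimage[OF smooth_map_continuous[OF smT] AB(1)] strip])
      show "openin (mtop ?N) ?V" by (rule openin_Int[OF AB(2) strip])
      show "p \<in> ?U" using p AB(3) a by (simp add: carr_def)
      show "p' \<in> ?V" using p' AB(4) a by simp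
      fix k x assume x: "x \<in> ?U"
      show "?T k x \<notin> ?V"
      proof
        assume k: "?T k x \<in> ?V"
        then have "\<bar>snd x + of_int k * a - snd p'\<bar> < a / 4" by (simp add: T)
        moreover have "\<bar>snd x - snd p\<bar> < a / 4" using x by simp
        ultimately have "\<bar>of_int k * a - (snd p' - snd p)\<bar> < a / 2" unfolding abs_less_iff by linarith
        then have "k = l" by (rule l)
        then have "?T l x \<in> A" "?T l x \<in> B" using x k by simp_all
        then show False using AB(5) unfolding disjnt_iff by blast
      qed
    qed
  qed
qed

lemma compact_mapping_torus:
  fixes M :: "('a, 'e::euclidean_space) mfd"
  assumes A: "discrete_action (cyl M) (torus_action M f a)" and cM: "compact_space (mtop M)" and a: "a > 0"
  shows "compact_space (mtop (mapping_torus M f a))"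
proof -
  interpret discrete_action "cyl M" "torus_action M f a" by (rule A)
  have "compactin (prod_topology (mtop M) euclideanreal) (topspace (mtop M) \<times> {0..a})"
    using cM by (simp add: compactin_Times compact_space_def)
  then have K: "compactin (mtop (cyl M)) (carr M \<times> {0..a})" by (simp add: cyl_def carr_def)
  have "topspace (mtop Q) \<subseteq> q ` (carr M \<times> {0..a})"
  proof
    fix z assume "z \<in> topspace (mtop Q)"
    then obtain p where p: "p \<in> carr (cyl M)" "z = q p" using carr_Q by (auto simp: carr_def)
    \<comment> \<open>the translation by \<open>?k a\<close> moves the second coordinate into \<open>[0, a]\<close>\<close>
    let ?k = "- \<lfloor>snd p / a\<rfloor>"
    have "of_int \<lfloor>snd p / a\<rfloor> * a \<le> snd p"
      using of_int_floor_le[of "snd p / a"] unfolding pos_le_divide_eq[OF a] .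
    moreover have "snd p \<le> (of_int \<lfloor>snd p / a\<rfloor> + 1) * a"
      using real_of_int_floor_add_one_ge[of "snd p / a"] unfolding pos_divide_le_eq[OF a] .
    ultimately have "of_int \<lfloor>snd p / a\<rfloor> * a \<le> snd p" "snd p \<le> of_int \<lfloor>snd p / a\<rfloor> * a + a"
      by (simp_all add: distrib_right)
    then have "torus_action M f a ?k p \<in> carr M \<times> {0..a}"
      using T_carr[OF p(1), of ?k] by (simp add: torus_action_eq cyl_map_def carr_cyl)
    then show "z \<in> q ` (carr M \<times> {0..a})" using q_T[OF p(1), of ?k] p(2) by (metis imageI)
  qed
  moreover have "q ` (carr M \<times> {0..a}) \<subseteq> topspace (mtop Q)"
    using image_compactin[OF K q_continuous] by (rule compactin_subset_topspace)
  ultimately have "q ` (carr M \<times> {0..a}) = topspace (mtop Q)" by auto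
  then show ?thesis
    using image_compactin[OF K q_continuous] by (simp add: compact_space_def mapping_torus_eq)
qed

theorem mainTheorem6:
  fixes M :: "('a, 'e::euclidean_space) mfd"
    and \<phi> :: "('a, 'e) endo" and \<xi> :: "('a, 'e) vfield"
    and \<eta> :: "('a, 'e) form1" and h :: "('a, 'e) form2"
    and f :: "'a \<Rightarrow> 'a" and a :: real
  assumes "smooth_manifold M" and "compact_space (mtop M)"
    and "quasi_sasakian M \<phi> \<xi> \<eta> h"
    and "diffeomorphism M M f"
    and "preserves_almost_contact_metric M f \<phi> \<xi> \<eta> h"
    and "a > 0"
  shows "smooth_manifold (cyl M) \<and>
     quasi_vaisman (cyl M) (cyl_J M \<phi> \<xi> \<eta>) (cyl_metric M h) (cyl_dt M) \<and>
     (\<forall>p\<in>carr (cyl M). torus_action M f a 0 p = p \<and>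
        (\<forall>k l. torus_action M f a (k + l) p = torus_action M f a k (torus_action M f a l p))) \<and>
     (\<forall>k. diffeomorphism (cyl M) (cyl M) (torus_action M f a k) \<and>
        preserves_quasi_vaisman (cyl M) (torus_action M f a k)
          (cyl_J M \<phi> \<xi> \<eta>) (cyl_metric M h) (cyl_dt M)) \<and>
     compact_space (mtop (mapping_torus M f a)) \<and>
     quasi_vaisman_manifold (mapping_torus M f a)"
proof -
  note M = assms(1) and Qs = assms(3) and f = assms(4) and P = assms(5) and a = assms(6)
  have T\<phi>: "endo_tangent M \<phi>" and V: "vector_field M (carr M) \<xi>"
    using Qs by (auto simp: quasi_sasakian_def almost_contact_metric_def intro: endomorphism_field_tangent)
  note T\<xi> = vector_field_mem[OF V]
  note it = int_iterate_smooth_preserves[OF M f T\<phi> T\<xi> P]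
  have A: "discrete_action (cyl M) (torus_action M f a)" by (rule discrete_action_torus[OF M f it(1) a])
  interpret discrete_action "cyl M" "torus_action M f a" by (rule A)
  have pqv: "preserves_quasi_vaisman (cyl M) (torus_action M f a k) (cyl_J M \<phi> \<xi> \<eta>) (cyl_metric M h) (cyl_dt M)"
    and pdt: "preserves_vfield (cyl M) (torus_action M f a k) (cyl_dt_vfield M)" for k
    unfolding torus_action_eq
    using cyl_map_preserves[OF M it(1) T\<phi> T\<xi> it(2)] by simp_all
  have diffeo: "diffeomorphism (cyl M) (cyl M) (torus_action M f a k)" for k
    unfolding diffeomorphism_def
  proof (intro conjI)
    show bij: "bij_betw (torus_action M f a k) (carr (cyl M)) (carr (cyl M))"
      by (rule bij_betwI[of _ _ _ "torus_action M f a (- k)"]) (auto simp: T_carr T_inverse)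
    show "smooth_map (cyl M) (cyl M) (torus_action M f a k)" by (rule smooth)
    show "smooth_map (cyl M) (cyl M) (inv_into (carr (cyl M)) (torus_action M f a k))"
    proof (rule smooth_map_cong[OF N N smooth[of "- k"]])
      fix p assume p: "p \<in> carr (cyl M)"
      have "inv_into (carr (cyl M)) (torus_action M f a k) (torus_action M f a k (torus_action M f a (- k) p)) =
          torus_action M f a (- k) p"
        by (rule inv_into_f_f[OF bij_betw_imp_inj_on[OF bij] T_carr[OF p]])
      then show "torus_action M f a (- k) p = inv_into (carr (cyl M)) (torus_action M f a k) p"
        by (simp add: T_inverse(2)[OF p])
    qed
  qed
  have dtc: "cyl_dt_vfield M p e = (0, 1)" if "e \<in> charts_at (cyl M) p" for p e
    using that by (rule cyl_charts_atE) (simp add: cyl_dt_vfield_coord[OF M])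
  have "quasi_vaisman Q (quotient_endo (cyl_J M \<phi> \<xi> \<eta>)) (quotient_form2 (cyl_metric M h))
      (quotient_form1 (cyl_dt M))"
    by (rule quasi_vaisman_quotient[OF endo_tangent_cyl_J[OF M T\<phi> T\<xi>] cyl_dt_vfield_mem[OF M] dtc
          cyl_quasi_vaisman_coords[OF M Qs] pqv pdt])
  then have "quasi_vaisman_manifold (mapping_torus M f a)"
    unfolding quasi_vaisman_manifold_def mapping_torus_eq using smooth_manifold_quotient by blast
  then show ?thesis
    using N quasi_vaisman_cyl[OF M Qs] zero add diffeo pqv compact_mapping_torus[OF A assms(2) a] by blast
qed

end
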